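(* The connected components of $\mathcal I_{P_1}(\mathcal K)$ (with the topology of the metric $\delta_{P_1}$) are precisely the subsets $\mathcal I^0_{P_1}(\mathcal K)^+$, $\mathcal I^0_{P_1}(\mathcal K)^-$ and $\mathcal I^{2m}_{P_1}(\mathcal K)$, $1\le m\le\infty$.
   Context: Let $\mathcal K$ be an infinite-dimensional separable complex Hilbert space with a complex conjugation $f\mapsto f^*$ (an antiunitary involution); for bounded $A$ put $\overline{A}f=(A(f^* ))^*$. Fix a basis projection $P_1$, i.e. an orthogonal projection with $P_1+\overline{P_1}=\mathbf 1$; put $P_2=\mathbf 1-P_1$ and $A_{mn}=P_mAP_n$, an operator from $P_n(\mathcal K)$ to $P_m(\mathcal K)$. Let $\mathcal I(\mathcal K)=\{V\in\mathfrak B(\mathcal K):V^*V=\mathbf 1,\ \overline V=V\}$ and $\mathcal I_{P_1}(\mathcal K)=\{V\in\mathcal I(\mathcal K):V_{12}\text{ is Hilbert–Schmidt}\}$, a topological semigroup with respect to the metric $$\delta_{P_1}(V,V')=\|V-V'\|+\|V_{12}-V'_{12}\|_{HS}.$$ For $m\in\mathbb N\cup\{\infty\}$ let $\mathcal I^{2m}_{P_1}(\mathcal K)=\{V\in\mathcal I_{P_1}(\mathcal K):-\tfrac12\operatorname{ind}V=m\}$, where $-\operatorname{ind}V=\dim\ker V^*$. On the group $\mathcal I^0_{P_1}(\mathcal K)$ let $\chi(U)=(-1)^{\dim\ker U_{11}}$ (where $\ker U_{11}\subset P_1(\mathcal K)$ is finite-dimensional), and $\mathcal I^0_{P_1}(\mathcal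 K)^\pm=\{U\in\mathcal I^0_{P_1}(\mathcal K):\chi(U)=\pm1\}$. *)

theory Defs
  imports "HOL-Analysis.Analysis"
begin

section \<open>Complex Hilbert spaces\<close>

class complex_vector = real_vector +
  fixes scaleC :: "complex \<Rightarrow> 'a \<Rightarrow> 'a"
  assumes scaleC_add_right: "scaleC a (x + y) = scaleC a x + scaleC a y"
    and scaleC_add_left: "scaleC (a + b) x = scaleC a x + scaleC b x"
    and scaleC_scaleC: "scaleC a (scaleC b x) = scaleC (a * b) x"
    and scaleC_of_real: "scaleC (complex_of_real r) x = scaleR r x"

text \<open>The complex inner product is linear in its second argument. Its real part is the real
  inner product of \<^class>\<open>real_inner\<close>; hence positivity, the norm
  \<open>norm x = sqrt (Re (cinner x x))\<close> and the topology come from \<^class>\<open>real_inner\<close>.\<close>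

class complex_inner = complex_vector + real_inner +
  fixes cinner :: "'a \<Rightarrow> 'a \<Rightarrow> complex"
  assumes cinner_commute: "cinner y x = cnj (cinner x y)"
    and cinner_add_right: "cinner x (y + z) = cinner x y + cinner x z"
    and cinner_scaleC_right: "cinner x (scaleC a y) = a * cinner x y"
    and Re_cinner: "Re (cinner x y) = inner x y"

class chilbert_space = complex_inner + complete_space

global_interpretation complex_vector:
  vector_space "scaleC :: complex \<Rightarrow> 'a \<Rightarrow> 'a::complex_vector"
  defines cspan = complex_vector.span
    and cdim = complex_vector.dim
proof unfold_locales
  show "scaleC 1 x = x" for x :: 'a
    using scaleC_of_real[of 1 x] by simp
qed (simp_all add: scaleC_add_right scaleC_add_left scaleC_scaleC)

definition ecdim :: "'a::complex_vector set \<Rightarrow> enat" where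
  "ecdim S = (if \<exists>B. finite B \<and> S \<subseteq> cspan B then enat (cdim S) else \<infinity>)"

definition is_onb :: "'a::complex_inner set \<Rightarrow> 'a set \<Rightarrow> bool" where
  "is_onb S E \<longleftrightarrow>
     E \<subseteq> S \<and> S \<subseteq> closure (cspan E) \<and> (\<forall>x\<in>E. \<forall>y\<in>E. cinner x y = (if x = y then 1 else 0))"


section \<open>Bounded operators\<close>

text \<open>Bounded operators are the complex-linear members of the real Banach space of bounded
  real-linear maps; the norm of the latter is the usual operator norm.\<close>

definition clinear_op :: "('a::complex_inner \<Rightarrow>\<^sub>L 'a) \<Rightarrow> bool" where
  "clinear_op A \<longleftrightarrow> (\<forall>a x. blinfun_apply A (scaleC a x) = scaleC a (blinfun_apply A x))"

text \<open>On a Hilbert space the adjoint of a bounded complex-linear operator exists and is unique.\<close>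

definition cadjoint :: "('a::chilbert_space \<Rightarrow>\<^sub>L 'a) \<Rightarrow> ('a \<Rightarrow>\<^sub>L 'a)" where
  "cadjoint A = (THE B. \<forall>x y. cinner (blinfun_apply B x) y = cinner x (blinfun_apply A y))"

definition ker_on :: "'a::complex_inner set \<Rightarrow> ('a \<Rightarrow>\<^sub>L 'a) \<Rightarrow> 'a set" where
  "ker_on S A = {x \<in> S. blinfun_apply A x = 0}"

text \<open>The Hilbert--Schmidt property and norm of the restriction of \<open>A\<close> to the closed subspace
  \<open>S\<close>; neither depends on the orthonormal basis of \<open>S\<close>.\<close>

definition hilbert_schmidt_on :: "'a::chilbert_space set \<Rightarrow> ('a \<Rightarrow>\<^sub>L 'a) \<Rightarrow> bool" where
  "hilbert_schmidt_on S A \<longleftrightarrow>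
     (\<exists>E. is_onb S E \<and> (\<lambda>e. (norm (blinfun_apply A e))\<^sup>2) summable_on E)"

definition hs_norm_on :: "'a::chilbert_space set \<Rightarrow> ('a \<Rightarrow>\<^sub>L 'a) \<Rightarrow> real" where
  "hs_norm_on S A =
     sqrt (\<Sum>\<^sub>\<infinity>e\<in>(SOME E. is_onb S E). (norm (blinfun_apply A e))\<^sup>2)"


section \<open>Conjugations and basis projections\<close>

definition conjugation :: "('a::complex_inner \<Rightarrow> 'a) \<Rightarrow> bool" where
  "conjugation J \<longleftrightarrow>
     (\<forall>x y. J (x + y) = J x + J y) \<and>
     (\<forall>a x. J (scaleC a x) = scaleC (cnj a) (J x)) \<and>
     (\<forall>x y. cinner (J x) (J y) = cnj (cinner x y)) \<and>
     (\<forall>x. J (J x) = x)"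

definition conj_op :: "('a::complex_inner \<Rightarrow> 'a) \<Rightarrow> ('a \<Rightarrow>\<^sub>L 'a) \<Rightarrow> ('a \<Rightarrow>\<^sub>L 'a)" where
  "conj_op J A = Blinfun (\<lambda>f. J (blinfun_apply A (J f)))"

lemma conj_op_apply:
  assumes "conjugation J"
  shows "blinfun_apply (conj_op J A) f = J (blinfun_apply A (J f))"
proof -
  have "norm (J x) = norm x" for x
  proof -
    have "Re (cinner (J x) (J x)) = Re (cinner x x)"
      using assms by (simp add: conjugation_def)
    then show ?thesis by (simp add: Re_cinner norm_eq_sqrt_inner)
  qed
  moreover have "J (scaleR r x) = scaleR r (J x)" for r x
    using assms unfolding conjugation_def by (metis scaleC_of_real complex_cnj_complex_of_real)
  ultimately have J: "bounded_linear J"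
    using assms by (intro bounded_linear_intro[where K = 1]) (auto simp: conjugation_def)
  have "bounded_linear (\<lambda>f. J (blinfun_apply A (J f)))"
    by (intro bounded_linear_compose[OF J] bounded_linear_compose[OF blinfun.bounded_linear_right] J)
  then show ?thesis by (simp add: conj_op_def bounded_linear_Blinfun_apply)
qed

definition basis_projection :: "('a::chilbert_space \<Rightarrow> 'a) \<Rightarrow> ('a \<Rightarrow>\<^sub>L 'a) \<Rightarrow> bool" where
  "basis_projection J P \<longleftrightarrow>
     clinear_op P \<and> P o\<^sub>L P = P \<and> cadjoint P = P \<and> P + conj_op J P = id_blinfun"

text \<open>\<open>A\<^sub>1\<^sub>1 = P\<^sub>1 A P\<^sub>1\<close> and \<open>A\<^sub>1\<^sub>2 = P\<^sub>1 A P\<^sub>2\<close> with \<open>P\<^sub>2 = 1 - P\<^sub>1\<close>. These are operators on the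
  whole space; kernels and Hilbert--Schmidt norms below are taken on the domains \<open>range P\<^sub>1\<close> and
  \<open>range P\<^sub>2\<close>, respectively.\<close>

definition block11 :: "('a::chilbert_space \<Rightarrow>\<^sub>L 'a) \<Rightarrow> ('a \<Rightarrow>\<^sub>L 'a) \<Rightarrow> ('a \<Rightarrow>\<^sub>L 'a)" where
  "block11 P A = P o\<^sub>L A o\<^sub>L P"

definition block12 :: "('a::chilbert_space \<Rightarrow>\<^sub>L 'a) \<Rightarrow> ('a \<Rightarrow>\<^sub>L 'a) \<Rightarrow> ('a \<Rightarrow>\<^sub>L 'a)" where
  "block12 P A = P o\<^sub>L A o\<^sub>L (id_blinfun - P)"


section \<open>The semigroup of Bogoliubov operators\<close>

definition bog :: "('a::chilbert_space \<Rightarrow> 'a) \<Rightarrow> ('a \<Rightarrow>\<^sub>L 'a) set" where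
  "bog J = {V. clinear_op V \<and> cadjoint V o\<^sub>L V = id_blinfun \<and> conj_op J V = V}"

definition bog_HS :: "('a::chilbert_space \<Rightarrow> 'a) \<Rightarrow> ('a \<Rightarrow>\<^sub>L 'a) \<Rightarrow> ('a \<Rightarrow>\<^sub>L 'a) set" where
  "bog_HS J P =
     {V \<in> bog J. hilbert_schmidt_on (range (blinfun_apply (id_blinfun - P))) (block12 P V)}"

definition bog_dist :: "('a::chilbert_space \<Rightarrow>\<^sub>L 'a) \<Rightarrow> ('a \<Rightarrow>\<^sub>L 'a) \<Rightarrow> ('a \<Rightarrow>\<^sub>L 'a) \<Rightarrow> real" where
  "bog_dist P V W =
     norm (V - W) +
     hs_norm_on (range (blinfun_apply (id_blinfun - P))) (block12 P V - block12 P W)"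

definition bog_topology ::
    "('a::chilbert_space \<Rightarrow> 'a) \<Rightarrow> ('a \<Rightarrow>\<^sub>L 'a) \<Rightarrow> ('a \<Rightarrow>\<^sub>L 'a) topology" where
  "bog_topology J P = Metric_space.mtopology (bog_HS J P) (bog_dist P)"

text \<open>For an isometry \<open>V\<close> this is the negative Fredholm index.\<close>

definition neg_ind :: "('a::chilbert_space \<Rightarrow>\<^sub>L 'a) \<Rightarrow> enat" where
  "neg_ind V = ecdim (ker_on UNIV (cadjoint V))"

definition bog_HS_ind ::
    "('a::chilbert_space \<Rightarrow> 'a) \<Rightarrow> ('a \<Rightarrow>\<^sub>L 'a) \<Rightarrow> enat \<Rightarrow> ('a \<Rightarrow>\<^sub>L 'a) set" where
  "bog_HS_ind J P m = {V \<in> bog_HS J P. neg_ind V = 2 * m}"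

definition bog_chi :: "('a::chilbert_space \<Rightarrow>\<^sub>L 'a) \<Rightarrow> ('a \<Rightarrow>\<^sub>L 'a) \<Rightarrow> int" where
  "bog_chi P U = (-1) ^ cdim (ker_on (range (blinfun_apply P)) (block11 P U))"

definition bog_HS_plus ::
    "('a::chilbert_space \<Rightarrow> 'a) \<Rightarrow> ('a \<Rightarrow>\<^sub>L 'a) \<Rightarrow> ('a \<Rightarrow>\<^sub>L 'a) set" where
  "bog_HS_plus J P = {U \<in> bog_HS_ind J P 0. bog_chi P U = 1}"

definition bog_HS_minus ::
    "('a::chilbert_space \<Rightarrow> 'a) \<Rightarrow> ('a \<Rightarrow>\<^sub>L 'a) \<Rightarrow> ('a \<Rightarrow>\<^sub>L 'a) set" where
  "bog_HS_minus J P = {U \<in> bog_HS_ind J P 0. bog_chi P U = -1}"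

end

theory Submission
  imports Defs
begin

text \<open>
  Write \<open>P\<close> for the basis projection and \<open>Q = 1 - P = J P J\<close>. Bogoliubov operators are the isometries
  among the operators that are complex-linear and commute with \<open>J\<close>; they preserve the symmetric bilinear
  form \<open>\<langle>J x, y\<rangle>\<close>, for which the range of \<open>P\<close> is a Lagrangian subspace. The condition on \<open>V\<^sub>1\<^sub>2\<close> says that
  the commutator of \<open>V\<close> with \<open>P\<close> is Hilbert--Schmidt. Two things are to be shown about the invariant
  that consists of the index and, in index zero, the parity of the dimension of the kernel of the
  first diagonal block: it is locally constant, and any two operators with the same invariant lie in
  a connected set. Moreover the possible values have to be determined.

  Local constancy. If \<open>norm (V - W) < 1\<close>, then the projection to the kernel of \<open>W\<^sup>\<dagger>\<close> is injective on the
  kernel of \<open>V\<^sup>\<dagger>\<close>, so that the indices agree (\<open>neg_ind_near\<close>). For the parity consider, for a unit vector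
  \<open>e\<close> in the range of \<open>P\<close>, the reflection that exchanges \<open>e\<close> and \<open>J e\<close>. Composing a unitary Bogoliubov
  operator with it changes the dimension of the kernel by exactly one
  (\<open>cdim_ker11_reflection_parity\<close>), because a Lagrangian subspace of a plane consists of one of its two
  isotropic lines. Finitely many reflections make the kernel trivial, and this is an open condition,
  since the first diagonal block has closed range (\<open>ker11_parity_locally_constant\<close>).

  Index zero. Unitary Bogoliubov operators of distance less than \<open>2\<close> are joined by an explicit path,
  obtained from Moebius transformations of the disc (\<open>linked_near\<close>). If the kernel of the first diagonal block of
  \<open>U\<close> is trivial, two such steps lead to the identity: the diagonal part of \<open>U\<close> has a polar
  decomposition with unitary part \<open>D\<close>, which is close to \<open>U\<close> (\<open>linked_id_if_ker11_zero\<close>), and some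
  unitary \<open>w\<close>, a rough substitute for a square root of \<open>D\<close>, is close to both \<open>D\<close> and the identity
  (\<open>linked_diagonal\<close>). In general finitely many reflections are split off first. Since the reflections
  can be deformed into each other, \<open>U\<close> is joined to the identity or to a reflection, according to its
  parity (\<open>linked_classification\<close>).

  Positive index. Choose a model isometry \<open>W\<close> of the given index that commutes with \<open>P\<close> and shifts an
  orthonormal basis of its range. Every other operator of this index is \<open>U W\<close> with \<open>U\<close> of index zero
  (\<open>factorization_index\<close>). The reason is that, after composing \<open>V\<close> with reflections, the orthogonal
  complement of \<open>V P\<close> in the range of \<open>P\<close> projects onto a Lagrangian subspace of the kernel of \<open>V\<^sup>\<dagger>\<close> that
  is close to the range of \<open>P\<close> in the Hilbert--Schmidt sense (\<open>lag_eq_image\<close>, \<open>is_hs_lag\<close>). This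
  Lagrangian and its conjugate span the kernel, which also shows that the index is even
  (\<open>neg_ind_lag\<close>). As some reflection fixes \<open>W\<close>, the parity of \<open>U\<close> may be taken to be even, and a path
  from \<open>U\<close> to the identity yields one from \<open>U W\<close> to \<open>W\<close>.

  All operators are treated as bounded real-linear operators with adjoints for the real inner
  product, and Hilbert--Schmidt bounds are expressed by finite real orthonormal sets. This puts the
  complex structure and the conjugation on an equal footing.
\<close>


section \<open>Real Hilbert spaces\<close>

abbreviation bmul :: "('b::real_normed_vector \<Rightarrow>\<^sub>L 'c::real_normed_vector) \<Rightarrow>
    ('a::real_normed_vector \<Rightarrow>\<^sub>L 'b) \<Rightarrow> 'a \<Rightarrow>\<^sub>L 'c" (infixl "\<odot>" 70)
  where "A \<odot> B \<equiv> A o\<^sub>L B"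

lemmas bmul_distribs =
  bounded_bilinear.add_left[OF bounded_bilinear_blinfun_compose]
  bounded_bilinear.add_right[OF bounded_bilinear_blinfun_compose]
  bounded_bilinear.diff_left[OF bounded_bilinear_blinfun_compose]
  bounded_bilinear.diff_right[OF bounded_bilinear_blinfun_compose]
  bounded_bilinear.minus_left[OF bounded_bilinear_blinfun_compose]
  bounded_bilinear.minus_right[OF bounded_bilinear_blinfun_compose]
  bounded_bilinear.scaleR_left[OF bounded_bilinear_blinfun_compose]
  bounded_bilinear.scaleR_right[OF bounded_bilinear_blinfun_compose]

lemma bmul_assoc: "(A \<odot> B) \<odot> C = A \<odot> (B \<odot> C)"
  by (rule blinfun_eqI) simp

lemma bmul_id [simp]: "id_blinfun \<odot> A = A" "A \<odot> id_blinfun = A"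
  by (rule blinfun_eqI; simp)+

lemmas blin_simps = blinfun.add_left blinfun.add_right blinfun.diff_left blinfun.diff_right
  blinfun.minus_left blinfun.minus_right blinfun.scaleR_left blinfun.scaleR_right
  blinfun.zero_left blinfun.zero_right

lemma power2_norm_add: "(norm (x + y :: 'a::real_inner))\<^sup>2 = (norm x)\<^sup>2 + 2 * (x \<bullet> y) + (norm y)\<^sup>2"
  by (simp add: power2_norm_eq_inner inner_add inner_commute)

lemma power2_norm_diff: "(norm (x - y :: 'a::real_inner))\<^sup>2 = (norm x)\<^sup>2 - 2 * (x \<bullet> y) + (norm y)\<^sup>2"
  by (simp add: power2_norm_eq_inner inner_diff inner_commute)

text \<open>By the parallelogram law every minimizing sequence for the distance to \<open>S\<close> is Cauchy.\<close>

lemma closed_subspace_projection_exists: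
  fixes S :: "'a::{real_inner,complete_space} set"
  assumes "closed S" and S: "subspace S"
  shows "\<exists>p\<in>S. \<forall>y\<in>S. (x - p) \<bullet> y = 0"
proof -
  define D where "D = (INF y\<in>S. (norm (x - y))\<^sup>2)"
  have ne: "S \<noteq> {}" using subspace_0[OF S] by auto
  have bdd: "bdd_below ((\<lambda>y. (norm (x - y))\<^sup>2) ` S)"
    by (rule bdd_belowI[where m=0]) auto
  have D_le: "D \<le> (norm (x - y))\<^sup>2" if "y \<in> S" for y
    unfolding D_def by (rule cINF_lower[OF bdd that])
  have "\<exists>y\<in>S. (norm (x - y))\<^sup>2 < D + 1 / Suc n" for n
    using cINF_less_iff[OF ne bdd, of "D + 1 / Suc n"] by (simp add: D_def)
  then obtain p where p: "\<And>n. p n \<in> S" "\<And>n. (norm (x - p n))\<^sup>2 < D + 1 / Suc n"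
    by metis
  have par: "(norm (p m - p n))\<^sup>2 \<le> 2 / Suc m + 2 / Suc n" for m n
  proof -
    have "(norm (p m - p n))\<^sup>2 =
        2 * (norm (x - p m))\<^sup>2 + 2 * (norm (x - p n))\<^sup>2 - 4 * (norm (x - (1/2) *\<^sub>R (p m + p n)))\<^sup>2"
      by (simp add: power2_norm_eq_inner inner_diff inner_add inner_commute algebra_simps)
    moreover have "D \<le> (norm (x - (1/2) *\<^sub>R (p m + p n)))\<^sup>2"
      by (intro D_le subspace_scale[OF S] subspace_add[OF S] p)
    ultimately show ?thesis using p(2)[of m] p(2)[of n] by simp
  qed
  have "Cauchy p"
  proof (rule metric_CauchyI)
    fix e :: real assume "e > 0"
    obtain M :: nat where M: "M > 4 / e\<^sup>2" using reals_Archimedean2 by blast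
    have "dist (p m) (p n) < e" if "m \<ge> M" "n \<ge> M" for m n
    proof -
      have "M > 0" using M \<open>e > 0\<close> by (metis divide_pos_pos of_nat_0_less_iff order_less_trans zero_less_numeral zero_less_power)
      have "2 / real (Suc m) \<le> 2 / M" "2 / real (Suc n) \<le> 2 / M"
        using that \<open>M > 0\<close> by (auto intro!: divide_left_mono)
      moreover have "4 / M < e\<^sup>2" using M \<open>M > 0\<close> \<open>e > 0\<close> by (simp add: field_simps)
      ultimately have "(norm (p m - p n))\<^sup>2 < e\<^sup>2" using par[of m n] by simp
      then show ?thesis using \<open>e > 0\<close> by (simp add: dist_norm power_less_imp_less_base)
    qed
    then show "\<exists>M. \<forall>m\<ge>M. \<forall>n\<ge>M. dist (p m) (p n) < e" by blast
  qed
  then obtain q where q: "p \<longlonglongrightarrow> q" using Cauchy_convergent_iff convergent_def by blast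
  have qS: "q \<in> S" using closed_sequentially[OF \<open>closed S\<close>] p(1) q by blast
  have "(norm (x - q))\<^sup>2 \<le> D"
  proof (rule LIMSEQ_le)
    show "(\<lambda>n. (norm (x - p n))\<^sup>2) \<longlonglongrightarrow> (norm (x - q))\<^sup>2" by (intro tendsto_intros q)
    have "(\<lambda>n. D + inverse (real (Suc n))) \<longlonglongrightarrow> D + 0"
      by (intro tendsto_intros LIMSEQ_inverse_real_of_nat)
    then show "(\<lambda>n. D + 1 / Suc n) \<longlonglongrightarrow> D" by (simp add: inverse_eq_divide)
    show "\<exists>N. \<forall>n\<ge>N. (norm (x - p n))\<^sup>2 \<le> D + 1 / Suc n" using p(2) less_imp_le by blast
  qed
  have "(x - q) \<bullet> y = 0" if "y \<in> S" for y
  proof (cases "y = 0")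
    case False
    define t where "t = ((x - q) \<bullet> y) / (y \<bullet> y)"
    have yy: "y \<bullet> y > 0" using False by simp
    have "D \<le> (norm (x - (q + t *\<^sub>R y)))\<^sup>2"
      by (intro D_le subspace_add[OF S] subspace_scale[OF S] qS that)
    also have "\<dots> = (norm (x - q))\<^sup>2 - 2 * t * ((x - q) \<bullet> y) + t\<^sup>2 * (y \<bullet> y)"
      using power2_norm_diff[of "x - q" "t *\<^sub>R y"]
      by (simp add: diff_diff_eq power_mult_distrib dot_square_norm)
    also have "\<dots> = (norm (x - q))\<^sup>2 - ((x - q) \<bullet> y)\<^sup>2 / (y \<bullet> y)"
      using yy by (simp add: t_def field_simps power2_eq_square)
    finally have "((x - q) \<bullet> y)\<^sup>2 / (y \<bullet> y) \<le> 0" using \<open>(norm (x - q))\<^sup>2 \<le> D\<close> by simp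
    then have "((x - q) \<bullet> y)\<^sup>2 \<le> 0" using yy by (simp add: divide_le_0_iff)
    then show ?thesis by simp
  qed simp
  then show ?thesis using qS by blast
qed

definition oproj :: "'a::{real_inner,complete_space} set \<Rightarrow> 'a \<Rightarrow>\<^sub>L 'a" where
  "oproj S = Blinfun (\<lambda>x. SOME p. p \<in> S \<and> (\<forall>y\<in>S. (x - p) \<bullet> y = 0))"

lemma
  fixes S :: "'a::{real_inner,complete_space} set"
  assumes S: "closed S" "subspace S"
  shows oproj_in: "oproj S x \<in> S"
    and oproj_orth: "y \<in> S \<Longrightarrow> (x - oproj S x) \<bullet> y = 0"
    and oproj_unique: "p \<in> S \<Longrightarrow> (\<And>y. y \<in> S \<Longrightarrow> (x - p) \<bullet> y = 0) \<Longrightarrow> oproj S x = p"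
    and norm_oproj_le: "norm (oproj S x) \<le> norm x"
proof -
  define f where "f = (\<lambda>x. SOME p. p \<in> S \<and> (\<forall>y\<in>S. (x - p) \<bullet> y = 0))"
  have f: "f x \<in> S \<and> (\<forall>y\<in>S. (x - f x) \<bullet> y = 0)" for x
    unfolding f_def by (rule someI_ex) (use closed_subspace_projection_exists[OF S, of x] in blast)
  have uniq: "f x = p" if "p \<in> S" "\<And>y. y \<in> S \<Longrightarrow> (x - p) \<bullet> y = 0" for x p
  proof -
    have d: "f x - p \<in> S" using f that subspace_diff[OF S(2)] by blast
    have "(x - p) \<bullet> (f x - p) = 0" "(x - f x) \<bullet> (f x - p) = 0"
      using f that d by blast+
    then have "(f x - p) \<bullet> (f x - p) = 0" by (simp add: inner_diff)
    then show ?thesis by simp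
  qed
  have le: "norm (f x) \<le> norm x" for x
  proof -
    have "(norm x)\<^sup>2 = (norm ((x - f x) + f x))\<^sup>2" by simp
    also have "\<dots> = (norm (x - f x))\<^sup>2 + (norm (f x))\<^sup>2"
      unfolding power2_norm_add using f[of x] by simp
    finally show ?thesis by (metis le_add_same_cancel2 norm_ge_zero power2_le_imp_le zero_le_power2)
  qed
  have "bounded_linear f"
  proof (rule bounded_linear_intro[where K=1])
    show "f (x + y) = f x + f y" for x y
    proof (rule uniq)
      show "f x + f y \<in> S" using f subspace_add[OF S(2)] by blast
      fix z assume "z \<in> S"
      then show "(x + y - (f x + f y)) \<bullet> z = 0"
        using f[of x] f[of y] by (auto simp: inner_diff inner_add)
    qed
    show "f (r *\<^sub>R x) = r *\<^sub>R f x" for r x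
    proof (rule uniq)
      show "r *\<^sub>R f x \<in> S" using f subspace_scale[OF S(2)] by blast
      fix z assume "z \<in> S"
      then show "(r *\<^sub>R x - r *\<^sub>R f x) \<bullet> z = 0"
        using f[of x] by (auto simp: inner_diff)
    qed
  qed (simp add: le)
  then have eq: "blinfun_apply (oproj S) = f"
    unfolding oproj_def f_def by (rule bounded_linear_Blinfun_apply)
  show "oproj S x \<in> S" "y \<in> S \<Longrightarrow> (x - oproj S x) \<bullet> y = 0"
    "p \<in> S \<Longrightarrow> (\<And>y. y \<in> S \<Longrightarrow> (x - p) \<bullet> y = 0) \<Longrightarrow> oproj S x = p" "norm (oproj S x) \<le> norm x"
    unfolding eq using f uniq le by blast+
qed

lemma oproj_id:
  assumes "closed S" "subspace S" "x \<in> S"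
  shows "oproj S x = (x::'a::{real_inner,complete_space})"
  by (rule oproj_unique) (use assms in auto)

text \<open>A vector orthogonal to the kernel determines the functional up to a factor.\<close>

lemma riesz_representation:
  fixes f :: "'a::{real_inner,complete_space} \<Rightarrow> real"
  assumes "bounded_linear f"
  shows "\<exists>z. \<forall>y. f y = z \<bullet> y"
proof (cases "\<forall>x. f x = 0")
  case True then show ?thesis by (intro exI[of _ 0]) auto
next
  case False
  then obtain x where x: "f x \<noteq> 0" by blast
  interpret f: bounded_linear f by fact
  define S where "S = {y. f y = 0}"
  have S: "closed S" "subspace S"
    unfolding S_def
    by (auto intro!: closed_Collect_eq continuous_intros simp: subspace_def f.add f.scaleR f.zero
        f.continuous_on)
  define z where "z = x - oproj S x"
  have fp: "f (oproj S x) = 0" using oproj_in[OF S, of x] by (simp add: S_def)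
  then have fz: "f z = f x" by (simp add: z_def f.diff)
  then have zz: "z \<bullet> z \<noteq> 0" using x f.zero by auto
  have "f y = ((f z / (z \<bullet> z)) *\<^sub>R z) \<bullet> y" for y
  proof -
    have "y - (f y / f z) *\<^sub>R z \<in> S" using x fz by (simp add: S_def f.diff f.scaleR)
    then have "z \<bullet> (y - (f y / f z) *\<^sub>R z) = 0" unfolding z_def by (rule oproj_orth[OF S])
    then show ?thesis using zz x fz by (simp add: inner_diff field_simps)
  qed
  then show ?thesis by blast
qed

text \<open>The adjoint for the real inner product. It agrees with the complex adjoint on complex-linear
  operators (\<open>cadjoint_eq_adj\<close>), and it also makes sense for the antilinear conjugation, so that
  commutation with the conjugation and with complex scalars can be treated alike.\<close>

definition adj :: "('a::{real_inner,complete_space} \<Rightarrow>\<^sub>L 'a) \<Rightarrow> 'a \<Rightarrow>\<^sub>L 'a" ("_\<^sup>\<dagger>" [1000] 1000) where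
  "A\<^sup>\<dagger> = Blinfun (\<lambda>x. SOME z. \<forall>y. x \<bullet> A y = z \<bullet> y)"

lemma adj_left: "A\<^sup>\<dagger> x \<bullet> y = x \<bullet> (blinfun_apply A y)"
proof -
  define f where "f = (\<lambda>x. SOME z. \<forall>y. x \<bullet> A y = z \<bullet> y)"
  have f: "x \<bullet> A y = f x \<bullet> y" for x y
  proof -
    have "bounded_linear (\<lambda>y. x \<bullet> A y)"
      by (intro bounded_linear_compose[OF bounded_linear_inner_right] blinfun.bounded_linear_right)
    then have "\<exists>z. \<forall>y. x \<bullet> A y = z \<bullet> y" by (rule riesz_representation)
    then have "\<forall>y. x \<bullet> A y = f x \<bullet> y"
      unfolding f_def by (rule someI_ex)
    then show ?thesis by blast
  qed
  have eqI: "u = v" if "\<And>y. u \<bullet> y = v \<bullet> y" for u v :: 'a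
    by (rule vector_eq_rdot[THEN iffD1]) (use that in simp)
  have "bounded_linear f"
  proof (rule bounded_linear_intro[where K="norm A"])
    show "f (x + y) = f x + f y" for x y
      by (rule eqI) (simp add: f[symmetric] inner_add_left)
    show "f (r *\<^sub>R x) = r *\<^sub>R f x" for r x
      by (rule eqI) (simp add: f[symmetric])
    show "norm (f x) \<le> norm x * norm A" for x
    proof (cases "f x = 0")
      case False
      have "norm (f x) * norm (f x) = f x \<bullet> f x" by (simp add: dot_square_norm power2_eq_square)
      also have "\<dots> = x \<bullet> A (f x)" by (simp add: f)
      also have "\<dots> \<le> norm x * norm (A (f x))" by (rule norm_cauchy_schwarz)
      also have "\<dots> \<le> norm x * (norm A * norm (f x))"
        by (intro mult_left_mono norm_blinfun) auto
      finally have "norm (f x) * norm (f x) \<le> (norm x * norm A) * norm (f x)"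
        by (simp add: mult.assoc)
      then show ?thesis using False by (simp add: mult_le_cancel_right)
    qed simp
  qed
  then have "blinfun_apply (A\<^sup>\<dagger>) = f" unfolding adj_def f_def by (rule bounded_linear_Blinfun_apply)
  then show ?thesis using f by simp
qed

lemma adj_right: "x \<bullet> A\<^sup>\<dagger> y = blinfun_apply A x \<bullet> y"
  by (metis adj_left inner_commute)

lemma blinfun_inner_eqI: "(\<And>x y. blinfun_apply A x \<bullet> y = blinfun_apply B x \<bullet> y) \<Longrightarrow> A = (B :: 'a::real_inner \<Rightarrow>\<^sub>L 'a)"
  by (rule blinfun_eqI, rule vector_eq_rdot[THEN iffD1]) simp

lemma adj_unique: "(\<And>x y. blinfun_apply B x \<bullet> y = x \<bullet> blinfun_apply A y) \<Longrightarrow> A\<^sup>\<dagger> = B"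
  by (rule blinfun_inner_eqI) (simp add: adj_left)

lemma adj_adj [simp]: "(A\<^sup>\<dagger>)\<^sup>\<dagger> = A"
  by (rule adj_unique) (simp add: adj_right)

lemma adj_add: "(A + B)\<^sup>\<dagger> = A\<^sup>\<dagger> + B\<^sup>\<dagger>"
  by (rule adj_unique) (simp add: blin_simps adj_left inner_add)

lemma adj_diff: "(A - B)\<^sup>\<dagger> = A\<^sup>\<dagger> - B\<^sup>\<dagger>"
  by (rule adj_unique) (simp add: blin_simps adj_left inner_diff)

lemma adj_minus: "(- A)\<^sup>\<dagger> = - A\<^sup>\<dagger>"
  by (rule adj_unique) (simp add: blin_simps adj_left)

lemma adj_scaleR: "(r *\<^sub>R A)\<^sup>\<dagger> = r *\<^sub>R A\<^sup>\<dagger>"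
  by (rule adj_unique) (simp add: blin_simps adj_left)

lemma adj_compose: "(A \<odot> B)\<^sup>\<dagger> = B\<^sup>\<dagger> \<odot> A\<^sup>\<dagger>"
  by (rule adj_unique) (simp add: adj_left)

lemma adj_id [simp]: "id_blinfun\<^sup>\<dagger> = id_blinfun"
  by (rule adj_unique) simp

lemmas adj_simps = adj_add adj_diff adj_minus adj_scaleR adj_compose

lemma norm_adj_le: "norm (A\<^sup>\<dagger>) \<le> norm A"
proof (rule norm_blinfun_bound)
  fix x show "norm (A\<^sup>\<dagger> x) \<le> norm A * norm x"
  proof (cases "A\<^sup>\<dagger> x = 0")
    case False
    have "norm (A\<^sup>\<dagger> x) * norm (A\<^sup>\<dagger> x) = x \<bullet> A (A\<^sup>\<dagger> x)"
      by (simp add: adj_left[symmetric] dot_square_norm power2_eq_square)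
    also have "\<dots> \<le> norm x * (norm A * norm (A\<^sup>\<dagger> x))"
      by (rule order_trans[OF norm_cauchy_schwarz]) (intro mult_left_mono norm_blinfun norm_ge_zero)
    finally show ?thesis using False by (simp add: mult.assoc[symmetric] mult.commute)
  qed simp
qed simp

lemma norm_adj [simp]: "norm (A\<^sup>\<dagger>) = norm A"
  using norm_adj_le[of A] norm_adj_le[of "A\<^sup>\<dagger>"] by simp

lemma adj_oproj:
  assumes S: "closed S" "subspace S"
  shows "(oproj S)\<^sup>\<dagger> = oproj S"
proof (rule adj_unique)
  fix x y
  have "oproj S x \<bullet> (y - oproj S y) = 0" "(x - oproj S x) \<bullet> oproj S y = 0"
    using oproj_orth[OF S] oproj_in[OF S] by (auto simp: inner_commute)
  then show "oproj S x \<bullet> y = x \<bullet> oproj S y" by (simp add: inner_diff)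
qed

lemma isometry_iff:
  "A\<^sup>\<dagger> \<odot> A = id_blinfun \<longleftrightarrow> (\<forall>x. norm (A x) = norm x)"
proof
  assume "A\<^sup>\<dagger> \<odot> A = id_blinfun"
  then have "A\<^sup>\<dagger> (A x) = x" for x by (metis blinfun_apply_blinfun_compose blinfun_apply_id_blinfun id_apply)
  then have "A x \<bullet> A x = x \<bullet> x" for x by (metis adj_right)
  then show "\<forall>x. norm (A x) = norm x" by (simp add: norm_eq_sqrt_inner)
next
  assume n: "\<forall>x. norm (A x) = norm x"
  have "A x \<bullet> A y = x \<bullet> y" for x y
  proof -
    have "(norm (A (x + y)))\<^sup>2 = (norm (x + y))\<^sup>2" using n by simp
    then show ?thesis unfolding blin_simps power2_norm_add using n by simp
  qed
  then show "A\<^sup>\<dagger> \<odot> A = id_blinfun" by (intro blinfun_inner_eqI) (simp add: adj_left)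
qed


text \<open>A lower bound is the quantitative form of injectivity with closed range. It extends from a
  closed subspace to every finite extension on which the operator remains injective.\<close>

definition bddbelow :: "('a::real_normed_vector \<Rightarrow>\<^sub>L 'b::real_normed_vector) \<Rightarrow> 'a set \<Rightarrow> bool" where
  "bddbelow A S \<longleftrightarrow> (\<exists>c>0. \<forall>x\<in>S. c * norm x \<le> norm (A x))"

lemma bddbelow_closed_image:
  fixes A :: "'a::{real_inner,complete_space} \<Rightarrow>\<^sub>L 'a"
  assumes "closed S" "subspace S" "bddbelow A S"
  shows "closed (A ` S)"
proof -
  obtain c where c: "c > 0" "\<And>x. x \<in> S \<Longrightarrow> c * norm x \<le> norm (A x)"
    using assms(3) unfolding bddbelow_def by blast
  have "complete (A ` S)"
  proof (rule complete_isometric_image[OF c(1) assms(2)])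
    show "bounded_linear (blinfun_apply A)" by (rule blinfun.bounded_linear_right)
    show "\<forall>x\<in>S. norm (A x) \<ge> c * norm x" using c(2) by blast
    show "complete S" using assms(1) by (simp add: complete_eq_closed)
  qed
  then show ?thesis by (simp add: complete_eq_closed)
qed

lemma subspace_blinfun_image: "subspace S \<Longrightarrow> subspace (blinfun_apply A ` S)"
  by (rule linear_subspace_image) (auto intro: bounded_linear.linear blinfun.bounded_linear_right)

text \<open>The left inverse is the inverse on the closed range, composed with the orthogonal projection
  to that range.\<close>

lemma bddbelow_left_inverse:
  fixes A :: "'a::{real_inner,complete_space} \<Rightarrow>\<^sub>L 'a"
  assumes S: "closed S" "subspace S" and A: "bddbelow A S"
  shows "\<exists>G :: 'a \<Rightarrow>\<^sub>L 'a. (\<forall>x\<in>S. G (A x) = x) \<and> (\<forall>y. G y \<in> S)"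
proof -
  obtain c where c: "c > 0" "\<And>x. x \<in> S \<Longrightarrow> c * norm x \<le> norm (A x)"
    using A unfolding bddbelow_def by blast
  let ?R = "blinfun_apply A ` S"
  have R: "closed ?R" "subspace ?R"
    using bddbelow_closed_image[OF S A] subspace_blinfun_image[OF S(2)] by blast+
  have inj: "x = y" if "x \<in> S" "y \<in> S" "A x = A y" for x y
  proof -
    have "c * norm (x - y) \<le> norm (A (x - y))" using that subspace_diff[OF S(2)] c(2) by blast
    then show ?thesis using that c(1) by (simp add: blin_simps mult_le_0_iff)
  qed
  define g where "g = (\<lambda>y. SOME x. x \<in> S \<and> A x = oproj ?R y)"
  have g: "g y \<in> S \<and> A (g y) = oproj ?R y" for y
    unfolding g_def by (rule someI_ex) (use oproj_in[OF R, of y] in force)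
  have "bounded_linear g"
  proof (rule bounded_linear_intro[where K="1/c"])
    show "g (x + y) = g x + g y" for x y
      by (rule inj) (use g subspace_add[OF S(2)] in \<open>auto simp: blin_simps\<close>)
    show "g (r *\<^sub>R x) = r *\<^sub>R g x" for r x
      by (rule inj) (use g subspace_scale[OF S(2)] in \<open>auto simp: blin_simps\<close>)
    show "norm (g x) \<le> norm x * (1 / c)" for x
    proof -
      have "c * norm (g x) \<le> norm (A (g x))" using g c(2) by blast
      also have "\<dots> \<le> norm x" using g norm_oproj_le[OF R, of x] by simp
      finally show ?thesis using c(1) by (simp add: field_simps)
    qed
  qed
  then have G: "blinfun_apply (Blinfun g) = g" by (rule bounded_linear_Blinfun_apply)
  have "g (A x) = x" if "x \<in> S" for x
    by (rule inj) (use g[of "A x"] that oproj_id[OF R] in auto)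
  then show ?thesis using g by (intro exI[of _ "Blinfun g"]) (simp add: G)
qed

text \<open>The range of a bounded-below operator is closed, and its orthogonal complement is the kernel
  of the adjoint.\<close>

lemma bddbelow_invertible:
  fixes A :: "'a::{real_inner,complete_space} \<Rightarrow>\<^sub>L 'a"
  assumes A: "bddbelow A UNIV" and inj: "\<And>y. A\<^sup>\<dagger> y = 0 \<Longrightarrow> y = 0"
  shows "\<exists>G. G \<odot> A = id_blinfun \<and> A \<odot> G = id_blinfun"
proof -
  obtain G :: "'a \<Rightarrow>\<^sub>L 'a" where G: "\<And>x. G (A x) = x"
    using bddbelow_left_inverse[OF closed_UNIV subspace_UNIV A] by blast
  let ?R = "range (blinfun_apply A)"
  have R: "closed ?R" "subspace ?R"
    using bddbelow_closed_image[OF closed_UNIV subspace_UNIV A] subspace_blinfun_image[OF subspace_UNIV] by blast+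
  have "y \<in> ?R" for y
  proof -
    have "A\<^sup>\<dagger> (y - oproj ?R y) \<bullet> x = 0" for x
      using oproj_orth[OF R, of "A x" y] by (simp add: adj_left)
    then have "A\<^sup>\<dagger> (y - oproj ?R y) = 0" by (metis inner_eq_zero_iff)
    then have "y = oproj ?R y" using inj by fastforce
    then show ?thesis using oproj_in[OF R] by metis
  qed
  then have "A (G y) = y" for y using G by (metis rangeE)
  then show ?thesis using G by (intro exI[of _ G] conjI blinfun_eqI) auto
qed

text \<open>Let \<open>w\<close> be the component of \<open>v\<close> orthogonal to \<open>S\<close>. A vector lies in the sum if and only if it
  falls into \<open>S\<close> after its \<open>w\<close>-component has been removed; this is a closed condition.\<close>

lemma closed_add_vector:
  fixes S :: "'a::{real_inner,complete_space} set"
  assumes S: "closed S" "subspace S"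
  shows "closed (span (insert v S))" (is "closed ?T")
proof -
  define w where "w = v - oproj S v"
  have orth: "w \<bullet> y = 0" if "y \<in> S" for y using oproj_orth[OF S that] by (simp add: w_def)
  have eq: "?T = {x. x - ((w \<bullet> x) / (w \<bullet> w)) *\<^sub>R w \<in> S}"
  proof (intro set_eqI)
    fix x
    have "x \<in> ?T \<longleftrightarrow> (\<exists>k. x - k *\<^sub>R v \<in> S)"
      unfolding span_breakdown_eq span_eq_iff[THEN iffD2, OF S(2)] ..
    also have "\<dots> \<longleftrightarrow> (\<exists>k. x - k *\<^sub>R w \<in> S)"
    proof -
      have "x - k *\<^sub>R w = (x - k *\<^sub>R v) + k *\<^sub>R oproj S v" for k by (simp add: w_def algebra_simps)
      moreover have "k *\<^sub>R oproj S v \<in> S" for k using oproj_in[OF S] subspace_scale[OF S(2)] by blast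
      ultimately have "x - k *\<^sub>R w \<in> S \<longleftrightarrow> x - k *\<^sub>R v \<in> S" for k
        by (metis S(2) add_diff_cancel_right' subspace_add subspace_diff)
      then show ?thesis by blast
    qed
    also have "\<dots> \<longleftrightarrow> x - ((w \<bullet> x) / (w \<bullet> w)) *\<^sub>R w \<in> S"
    proof
      assume "\<exists>k. x - k *\<^sub>R w \<in> S"
      then obtain k where k: "x - k *\<^sub>R w \<in> S" by blast
      then have "w \<bullet> x = k * (w \<bullet> w)" using orth[OF k] by (simp add: inner_diff)
      then show "x - ((w \<bullet> x) / (w \<bullet> w)) *\<^sub>R w \<in> S" using k by (cases "w = 0") auto
    qed blast
    finally show "x \<in> ?T \<longleftrightarrow> x \<in> {x. x - ((w \<bullet> x) / (w \<bullet> w)) *\<^sub>R w \<in> S}" by simp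
  qed
  have "continuous_on UNIV (\<lambda>x. x - ((w \<bullet> x) / (w \<bullet> w)) *\<^sub>R w)"
    by (cases "w = 0") (auto intro!: continuous_intros)
  then have "closed ((\<lambda>x. x - ((w \<bullet> x) / (w \<bullet> w)) *\<^sub>R w) -` S)"
    using S(1) by (rule closed_vimage[rotated])
  then show ?thesis unfolding eq vimage_def .
qed

lemma closed_add_finite:
  fixes S :: "'a::{real_inner,complete_space} set"
  assumes "finite F" "closed S" "subspace S"
  shows "closed (span (S \<union> F))"
  using assms(1)
proof induction
  case empty then show ?case using assms(2) by (simp only: Un_empty_right span_eq_iff[THEN iffD2, OF assms(3)])
next
  case (insert v F)
  have "span (S \<union> insert v F) = span (insert v (span (S \<union> F)))"
    by (rule set_eqI) (simp only: Un_insert_right span_breakdown_eq span_span)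
  then show ?case using closed_add_vector[OF insert.IH subspace_span, of v] by (simp only:)
qed

text \<open>The distance of \<open>A v\<close> from the closed image of \<open>S\<close> controls the coefficient of \<open>v\<close>; the lower
  bound on \<open>S\<close> controls the remaining part.\<close>

lemma bddbelow_add_vector:
  fixes A :: "'a::{real_inner,complete_space} \<Rightarrow>\<^sub>L 'a"
  assumes S: "closed S" "subspace S" and A: "bddbelow A S"
    and inj: "\<And>x. x \<in> span (insert v S) \<Longrightarrow> A x = 0 \<Longrightarrow> x = 0"
  shows "bddbelow A (span (insert v S))"
proof (cases "v \<in> S")
  case True
  then show ?thesis using A S(2) by (simp add: insert_absorb span_eq_iff[THEN iffD2])
next
  case False
  obtain c where c: "c > 0" "\<And>x. x \<in> S \<Longrightarrow> c * norm x \<le> norm (A x)"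
    using A unfolding bddbelow_def by blast
  have R: "closed (A ` S)" "subspace (A ` S)"
    using bddbelow_closed_image[OF S A] subspace_blinfun_image[OF S(2)] by blast+
  have "A v \<notin> A ` S"
  proof
    assume "A v \<in> A ` S"
    then obtain s where s: "s \<in> S" "A v = A s" by blast
    have "v - s \<in> span (insert v S)" using s(1) by (intro span_diff span_base) auto
    moreover have "A (v - s) = 0" using s(2) by (simp add: blin_simps)
    ultimately have "v - s = 0" by (rule inj)
    then show False using s(1) False by simp
  qed
  define d where "d = norm (A v - oproj (A ` S) (A v))"
  have d: "d > 0" unfolding d_def using \<open>A v \<notin> A ` S\<close> oproj_in[OF R, of "A v"] by auto
  have far: "d * \<bar>a\<bar> \<le> norm (A (s + a *\<^sub>R v))" if "s \<in> S" for a s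
  proof -
    have "norm (A (s + a *\<^sub>R v) - oproj (A ` S) (A (s + a *\<^sub>R v))) \<le> norm (A (s + a *\<^sub>R v))"
    proof -
      let ?y = "A (s + a *\<^sub>R v)"
      have "(norm ?y)\<^sup>2 = (norm ((?y - oproj (A ` S) ?y) + oproj (A ` S) ?y))\<^sup>2" by simp
      also have "\<dots> = (norm (?y - oproj (A ` S) ?y))\<^sup>2 + (norm (oproj (A ` S) ?y))\<^sup>2"
        unfolding power2_norm_add using oproj_orth[OF R oproj_in[OF R], of ?y ?y] by simp
      finally show ?thesis by (metis le_add_same_cancel1 norm_ge_zero power2_le_imp_le zero_le_power2)
    qed
    moreover have "A (s + a *\<^sub>R v) - oproj (A ` S) (A (s + a *\<^sub>R v)) = a *\<^sub>R (A v - oproj (A ` S) (A v))"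
      using oproj_id[OF R, of "A s"] that by (simp add: blin_simps algebra_simps)
    ultimately show ?thesis by (simp add: d_def mult.commute)
  qed
  define K where "K = 1/c + norm (A v) / (c * d) + norm v / d"
  have K: "K > 0" using c d by (simp add: K_def add_pos_nonneg)
  have "norm x \<le> K * norm (A x)" if x: "x \<in> span (insert v S)" for x
  proof -
    obtain a where a: "x - a *\<^sub>R v \<in> S"
      using x unfolding span_breakdown_eq span_eq_iff[THEN iffD2, OF S(2)] by blast
    define s where "s = x - a *\<^sub>R v"
    have xs: "x = s + a *\<^sub>R v" "s \<in> S" using a by (auto simp: s_def)
    have a_le: "\<bar>a\<bar> \<le> norm (A x) / d" using far[OF xs(2), of a] d xs(1) by (simp add: field_simps)
    have "c * norm s \<le> norm (A s)" using c xs by blast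
    also have "\<dots> = norm (A x - a *\<^sub>R A v)" using xs(1) by (simp add: blin_simps)
    also have "\<dots> \<le> norm (A x) + \<bar>a\<bar> * norm (A v)" by (metis norm_scaleR norm_triangle_ineq4)
    also have "\<dots> \<le> norm (A x) + (norm (A x) / d) * norm (A v)"
      by (intro add_left_mono mult_right_mono a_le) auto
    finally have s_le: "norm s \<le> (norm (A x) + (norm (A x) / d) * norm (A v)) / c"
      using c by (simp add: field_simps)
    have "norm x \<le> norm s + \<bar>a\<bar> * norm v" using xs(1) by (metis norm_scaleR norm_triangle_ineq)
    also have "\<dots> \<le> (norm (A x) + (norm (A x) / d) * norm (A v)) / c + (norm (A x) / d) * norm v"
      by (intro add_mono s_le mult_right_mono a_le) auto
    also have "\<dots> = K * norm (A x)" using c d by (simp add: K_def field_simps)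
    finally show ?thesis .
  qed
  then have "\<forall>x\<in>span (insert v S). (1/K) * norm x \<le> norm (A x)" using K by (simp add: field_simps)
  then show ?thesis unfolding bddbelow_def using K by (intro exI[of _ "1/K"]) simp
qed

lemma bddbelow_add_finite:
  fixes A :: "'a::{real_inner,complete_space} \<Rightarrow>\<^sub>L 'a"
  assumes "finite F" and S: "closed S" "subspace S" and A: "bddbelow A S"
    and inj: "\<And>x. x \<in> span (S \<union> F) \<Longrightarrow> A x = 0 \<Longrightarrow> x = 0"
  shows "bddbelow A (span (S \<union> F))"
  using assms(1) inj
proof induction
  case empty then show ?case using A by (simp only: Un_empty_right span_eq_iff[THEN iffD2, OF S(2)])
next
  case (insert v F)
  have eq: "span (S \<union> insert v F) = span (insert v (span (S \<union> F)))"
    by (rule set_eqI) (simp only: Un_insert_right span_breakdown_eq span_span)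
  have sub: "span (S \<union> F) \<subseteq> span (S \<union> insert v F)" by (rule span_mono) auto
  have bd: "bddbelow A (span (S \<union> F))"
    by (rule insert.IH) (rule insert.prems, erule subsetD[OF sub], assumption)
  show ?case unfolding eq
  proof (rule bddbelow_add_vector[OF closed_add_finite[OF insert.hyps(1) S] subspace_span bd])
    show "x = 0" if "x \<in> span (insert v (span (S \<union> F)))" "A x = 0" for x
      by (rule insert.prems) (use that in \<open>simp_all only: eq\<close>)
  qed
qed


instance chilbert_space \<subseteq> banach ..

section \<open>Square roots of positive operators\<close>

text \<open>With \<open>S = 1 - Y\<close> the equation \<open>S\<^sup>2 = 1 - X\<close> becomes the fixed point equation
  \<open>Y = (X + Y\<^sup>2) / 2\<close>. The iterates starting from \<open>0\<close> are polynomials in \<open>X\<close> with nonnegative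
  coefficients. They are therefore dominated by the same iteration for the number \<open>norm X\<close>, which
  is increasing and bounded by \<open>norm X\<close> if \<open>norm X \<le> 1\<close>.\<close>

fun sqrt_iter :: "('a::{real_inner,complete_space} \<Rightarrow>\<^sub>L 'a) \<Rightarrow> nat \<Rightarrow> 'a \<Rightarrow>\<^sub>L 'a" where
  "sqrt_iter X 0 = 0"
| "sqrt_iter X (Suc n) = (1/2) *\<^sub>R (X + sqrt_iter X n \<odot> sqrt_iter X n)"

fun sqrt_iter_bound :: "real \<Rightarrow> nat \<Rightarrow> real" where
  "sqrt_iter_bound r 0 = 0"
| "sqrt_iter_bound r (Suc n) = (r + (sqrt_iter_bound r n)\<^sup>2) / 2"

lemma sqrt_iter_bound_le:
  assumes "0 \<le> r" "r \<le> 1"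
  shows "0 \<le> sqrt_iter_bound r n \<and> sqrt_iter_bound r n \<le> r"
proof (induction n)
  case (Suc n)
  have "(sqrt_iter_bound r n)\<^sup>2 \<le> r * 1"
    unfolding power2_eq_square using Suc assms by (intro mult_mono) auto
  then show ?case using assms by auto
qed (use assms in auto)

lemma sqrt_iter_bound_mono:
  assumes "0 \<le> r" "r \<le> 1"
  shows "sqrt_iter_bound r n \<le> sqrt_iter_bound r (Suc n)"
proof (induction n)
  case (Suc n)
  then have "(sqrt_iter_bound r n)\<^sup>2 \<le> (sqrt_iter_bound r (Suc n))\<^sup>2"
    using sqrt_iter_bound_le[OF assms] by (intro power_mono) auto
  then show ?case by simp
qed (use assms in auto)

lemma sqrt_iter_commute:
  assumes "T \<odot> X = X \<odot> T" shows "T \<odot> sqrt_iter X n = sqrt_iter X n \<odot> T"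
proof (induction n)
  case (Suc n)
  have "T \<odot> (sqrt_iter X n \<odot> sqrt_iter X n) = sqrt_iter X n \<odot> sqrt_iter X n \<odot> T"
    by (metis Suc bmul_assoc)
  then show ?case using assms by (simp add: bmul_distribs)
qed (simp add: bmul_distribs)

lemma norm_sqrt_iter_le: "norm (sqrt_iter X n) \<le> sqrt_iter_bound (norm X) n"
proof (induction n)
  case (Suc n)
  have "norm (sqrt_iter X n \<odot> sqrt_iter X n) \<le> (sqrt_iter_bound (norm X) n)\<^sup>2"
    unfolding power2_eq_square
    by (intro order_trans[OF norm_blinfun_compose] mult_mono Suc norm_ge_zero order_trans[OF norm_ge_zero Suc])
  then have "norm (X + sqrt_iter X n \<odot> sqrt_iter X n) \<le> norm X + (sqrt_iter_bound (norm X) n)\<^sup>2"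
    by (intro norm_triangle_le) simp
  then show ?case by simp
qed simp

text \<open>The iterates commute, so that the difference of two squares factors for operators just as it
  does for the numerical bounds.\<close>

lemma norm_sqrt_iter_diff_le:
  assumes "norm X \<le> 1"
  shows "norm (sqrt_iter X (Suc n) - sqrt_iter X n)
    \<le> sqrt_iter_bound (norm X) (Suc n) - sqrt_iter_bound (norm X) n"
proof (induction n)
  case (Suc n)
  let ?Y = "sqrt_iter X" and ?y = "sqrt_iter_bound (norm X)"
  have "?Y n \<odot> ?Y (Suc n) = ?Y (Suc n) \<odot> ?Y n"
    by (intro sqrt_iter_commute sqrt_iter_commute[symmetric] refl)
  moreover have "(1/2) *\<^sub>R (X + b \<odot> b) - (1/2) *\<^sub>R (X + a \<odot> a) = (1/2) *\<^sub>R ((b - a) \<odot> (b + a))"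
    if "a \<odot> b = b \<odot> a" for a b :: "'a \<Rightarrow>\<^sub>L 'a"
    using that by (simp add: bmul_distribs scaleR_diff_right[symmetric])
  ultimately have "?Y (Suc (Suc n)) - ?Y (Suc n) = (1/2) *\<^sub>R ((?Y (Suc n) - ?Y n) \<odot> (?Y (Suc n) + ?Y n))"
    by (metis sqrt_iter.simps(2))
  also have "norm \<dots> \<le> 1/2 * ((?y (Suc n) - ?y n) * (?y (Suc n) + ?y n))"
  proof -
    have "norm ((?Y (Suc n) - ?Y n) \<odot> (?Y (Suc n) + ?Y n)) \<le> (?y (Suc n) - ?y n) * (?y (Suc n) + ?y n)"
      using sqrt_iter_bound_mono[OF norm_ge_zero assms, of n]
      by (intro order_trans[OF norm_blinfun_compose] mult_mono Suc norm_triangle_mono norm_sqrt_iter_le) auto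
    then show ?thesis by simp
  qed
  also have "\<dots> = ?y (Suc (Suc n)) - ?y (Suc n)"
    by (simp only: sqrt_iter_bound.simps(2)[of _ "Suc n"] sqrt_iter_bound.simps(2)[of _ n])
       (simp add: power2_eq_square field_simps del: sqrt_iter_bound.simps)
  finally show ?case .
qed simp

text \<open>The last conjunct holds because \<open>S\<close> is a limit of polynomials in \<open>X\<close>. It makes the square
  root inherit complex linearity, commutation with the conjugation, and commutation with a projection.\<close>

lemma operator_square_root:
  fixes X :: "'a::{real_inner,banach} \<Rightarrow>\<^sub>L 'a"
  assumes X: "norm X \<le> 1" "X\<^sup>\<dagger> = X"
  shows "\<exists>S. S \<odot> S = id_blinfun - X \<and> S\<^sup>\<dagger> = S \<and> norm (id_blinfun - S) \<le> norm X \<and>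
    (\<forall>T. T \<odot> X = X \<odot> T \<longrightarrow> T \<odot> S = S \<odot> T)"
proof -
  let ?Y = "sqrt_iter X" and ?y = "sqrt_iter_bound (norm X)"
  have "convergent ?y"
  proof (rule Bseq_mono_convergent)
    show "Bseq ?y"
      by (rule BseqI'[of _ "norm X"]) (use sqrt_iter_bound_le[OF norm_ge_zero X(1)] in auto)
    show "\<forall>m n. m \<le> n \<longrightarrow> ?y m \<le> ?y n"
      using lift_Suc_mono_le[of ?y] sqrt_iter_bound_mono[OF norm_ge_zero X(1)] by blast
  qed
  then obtain l where "?y \<longlonglongrightarrow> l" by (auto simp: convergent_def)
  then have "summable (\<lambda>n. ?y (Suc n) - ?y n)" by (rule telescope_summable)
  then have "summable (\<lambda>n. ?Y (Suc n) - ?Y n)"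
    by (rule summable_comparison_test'[where N=0]) (rule norm_sqrt_iter_diff_le[OF X(1)])
  then have "convergent (\<lambda>n. \<Sum>i<n. ?Y (Suc i) - ?Y i)" by (simp add: summable_iff_convergent)
  then have "convergent ?Y" by (simp only: sum_lessThan_telescope) simp
  then obtain L where L: "?Y \<longlonglongrightarrow> L" by (auto simp: convergent_def)
  have "(\<lambda>n. ?Y (Suc n)) \<longlonglongrightarrow> (1/2) *\<^sub>R (X + L \<odot> L)"
    unfolding sqrt_iter.simps
    by (intro tendsto_intros bounded_bilinear.tendsto[OF bounded_bilinear_blinfun_compose] L)
  then have "L = (1/2) *\<^sub>R (X + L \<odot> L)" using L LIMSEQ_unique LIMSEQ_Suc by blast
  then have LL: "2 *\<^sub>R L = X + L \<odot> L" by (metis (no_types) divide_self_if scaleR_one scaleR_scaleR times_divide_eq_right mult.right_neutral zero_neq_numeral)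
  have comm: "T \<odot> L = L \<odot> T" if "T \<odot> X = X \<odot> T" for T
  proof (rule LIMSEQ_unique)
    show "(\<lambda>n. T \<odot> ?Y n) \<longlonglongrightarrow> T \<odot> L" "(\<lambda>n. T \<odot> ?Y n) \<longlonglongrightarrow> L \<odot> T"
      unfolding sqrt_iter_commute[OF that]
      by (subst sqrt_iter_commute[OF that, symmetric])
         (intro bounded_bilinear.tendsto[OF bounded_bilinear_blinfun_compose] tendsto_const L)+
  qed
  have "norm L \<le> norm X"
    by (rule LIMSEQ_le_const2[OF tendsto_norm[OF L]])
       (use norm_sqrt_iter_le[of X] sqrt_iter_bound_le[OF norm_ge_zero X(1)] order_trans in blast)
  have adjY: "(?Y n)\<^sup>\<dagger> = ?Y n" for n
  proof (induction n)
    case 0 show ?case by (rule adj_unique) simp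
  qed (simp add: adj_simps X)
  have "L\<^sup>\<dagger> = L"
  proof (rule adj_unique)
    fix x y
    have lim: "(\<lambda>n. ?Y n z) \<longlonglongrightarrow> L z" for z
      by (intro bounded_bilinear.tendsto[OF bounded_bilinear_blinfun_apply] tendsto_const L)
    have "(\<lambda>n. ?Y n x \<bullet> y) \<longlonglongrightarrow> L x \<bullet> y" "(\<lambda>n. x \<bullet> ?Y n y) \<longlonglongrightarrow> x \<bullet> L y"
      by (intro tendsto_intros lim)+
    moreover have "?Y n x \<bullet> y = x \<bullet> ?Y n y" for n by (metis adjY adj_left)
    ultimately show "L x \<bullet> y = x \<bullet> L y" using LIMSEQ_unique by auto
  qed
  define S where "S = id_blinfun - L"
  have "S \<odot> S = id_blinfun - 2 *\<^sub>R L + L \<odot> L" by (simp add: S_def bmul_distribs scaleR_2 algebra_simps)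
  then have "S \<odot> S = id_blinfun - X" using LL by simp
  moreover have "S\<^sup>\<dagger> = S" using \<open>L\<^sup>\<dagger> = L\<close> by (simp add: S_def adj_simps)
  moreover have "norm (id_blinfun - S) \<le> norm X" using \<open>norm L \<le> norm X\<close> by (simp add: S_def)
  moreover have "T \<odot> S = S \<odot> T" if "T \<odot> X = X \<odot> T" for T
    using comm[OF that] by (simp add: S_def bmul_distribs)
  ultimately show ?thesis by blast
qed

lemma inner_ge_of_norm_id_diff:
  assumes "norm (id_blinfun - S) \<le> r"
  shows "(1 - r) * (norm x)\<^sup>2 \<le> x \<bullet> blinfun_apply S x"
proof -
  have "x \<bullet> (x - S x) \<le> norm x * norm ((id_blinfun - S) x)"
    using norm_cauchy_schwarz[of x "x - S x"] by (simp add: blin_simps)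
  also have "\<dots> \<le> norm x * (r * norm x)"
    by (intro mult_left_mono order_trans[OF norm_blinfun] mult_right_mono assms) auto
  finally show ?thesis by (simp add: inner_diff power2_norm_eq_inner[symmetric] algebra_simps power2_eq_square)
qed


section \<open>Hilbert--Schmidt operators\<close>

definition orthon :: "'a::real_inner set \<Rightarrow> bool" where
  "orthon F \<longleftrightarrow> (\<forall>x\<in>F. \<forall>y\<in>F. x \<bullet> y = (if x = y then 1 else 0))"

lemma orthonD: "orthon F \<Longrightarrow> x \<in> F \<Longrightarrow> y \<in> F \<Longrightarrow> x \<bullet> y = (if x = y then 1 else 0)"
  by (simp add: orthon_def)

lemma orthon_empty [simp]: "orthon {}" by (simp add: orthon_def)

lemma orthon_insert_normalized:
  assumes "orthon F" "r \<noteq> 0" "\<And>f. f \<in> F \<Longrightarrow> f \<bullet> r = 0"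
  shows "orthon (insert ((1 / norm r) *\<^sub>R r) F)"
proof -
  let ?u = "(1 / norm r) *\<^sub>R r"
  have u: "?u \<bullet> ?u = 1" using assms(2) by (simp add: dot_square_norm power2_eq_square)
  have 0: "f \<bullet> ?u = 0" "?u \<bullet> f = 0" if "f \<in> F" for f using assms(3)[OF that] by (auto simp: inner_commute)
  have "?u \<notin> F" using 0[of ?u] u by auto
  then show ?thesis using assms(1) u 0 unfolding orthon_def by (metis insert_iff)
qed

lemma bessel_residual_orth:
  assumes "finite F" "orthon F" "g \<in> F"
  shows "g \<bullet> (x - (\<Sum>f\<in>F. (f \<bullet> x) *\<^sub>R f)) = 0"
proof -
  have "g \<bullet> (\<Sum>f\<in>F. (f \<bullet> x) *\<^sub>R f) = (\<Sum>f\<in>F. if g = f then f \<bullet> x else 0)"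
    unfolding inner_sum_right by (rule sum.cong) (use orthonD[OF assms(2,3)] in auto)
  then show ?thesis using assms by (simp add: inner_diff)
qed

text \<open>The vector splits orthogonally into its projection to the span of \<open>F\<close> and the residual.\<close>

lemma bessel_identity:
  assumes "finite F" "orthon F"
  shows "(norm x)\<^sup>2 = (\<Sum>f\<in>F. (f \<bullet> x)\<^sup>2) + (norm (x - (\<Sum>f\<in>F. (f \<bullet> x) *\<^sub>R f)))\<^sup>2"
proof -
  let ?p = "\<Sum>f\<in>F. (f \<bullet> x) *\<^sub>R f"
  have orth: "(x - ?p) \<bullet> ?p = 0"
    unfolding inner_sum_right
    by (intro sum.neutral ballI) (simp only: inner_scaleR_right inner_commute[of "x - _"]
        bessel_residual_orth[OF assms] mult_zero_right)
  have "(norm ?p)\<^sup>2 = x \<bullet> ?p" using orth by (simp add: power2_norm_eq_inner inner_diff)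
  also have "\<dots> = (\<Sum>f\<in>F. (f \<bullet> x)\<^sup>2)"
    unfolding inner_sum_right by (simp add: inner_commute power2_eq_square)
  finally have "(norm ?p)\<^sup>2 = (\<Sum>f\<in>F. (f \<bullet> x)\<^sup>2)" .
  then show ?thesis using power2_norm_add[of "x - ?p" ?p] orth by simp
qed

lemma bessel_inequality:
  assumes "finite F" "orthon F"
  shows "(\<Sum>f\<in>F. (f \<bullet> x)\<^sup>2) \<le> (norm x)\<^sup>2"
  using bessel_identity[OF assms, of x] by simp

lemma parseval_in_span:
  assumes "finite F" "orthon F" "x \<in> span F"
  shows "(norm x)\<^sup>2 = (\<Sum>f\<in>F. (f \<bullet> x)\<^sup>2)"
proof -
  let ?r = "x - (\<Sum>f\<in>F. (f \<bullet> x) *\<^sub>R f)"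
  have "?r \<in> span F" by (intro span_diff assms(3) span_sum span_scale span_base)
  moreover have "span F \<subseteq> {y. ?r \<bullet> y = 0}"
    by (rule span_minimal)
       (use bessel_residual_orth[OF assms(1,2), of _ x] in
         \<open>auto simp: subspace_def inner_add_right inner_commute[of _ "x - _"]\<close>)
  ultimately have "?r \<bullet> ?r = 0" by blast
  then show ?thesis using bessel_identity[OF assms(1,2), of x] by simp
qed

lemma finite_orthon_spanning:
  assumes "finite (S :: 'a::real_inner set)"
  shows "\<exists>G. finite G \<and> orthon G \<and> S \<subseteq> span G \<and> G \<subseteq> span S"
  using assms
proof induction
  case empty show ?case by (intro exI[of _ "{}"]) auto
next
  case (insert x S)
  then obtain G where G: "finite G" "orthon G" "S \<subseteq> span G" "G \<subseteq> span S" by blast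
  let ?p = "\<Sum>f\<in>G. (f \<bullet> x) *\<^sub>R f"
  let ?r = "x - ?p"
  have GS: "G \<subseteq> span (insert x S)" using G(4) span_mono[of S "insert x S"] by blast
  show ?case
  proof (cases "?r = 0")
    case True
    then have "x = ?p" by simp
    moreover have "?p \<in> span G" by (intro span_sum span_scale span_base)
    ultimately show ?thesis using G GS by (metis insert_subset)
  next
    case False
    let ?g = "(1 / norm ?r) *\<^sub>R ?r"
    have on: "orthon (insert ?g G)"
      by (rule orthon_insert_normalized[OF G(2) False]) (rule bessel_residual_orth[OF G(1,2)])
    have "x = norm ?r *\<^sub>R ?g + ?p" using False by simp
    moreover have "norm ?r *\<^sub>R ?g + ?p \<in> span (insert ?g G)"
      by (intro span_add[OF span_scale[OF span_base] span_sum[OF span_scale[OF span_base]]]) auto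
    ultimately have "x \<in> span (insert ?g G)" by simp
    moreover have "S \<subseteq> span (insert ?g G)" using G(3) span_mono[of G "insert ?g G"] by blast
    moreover have "?g \<in> span (insert x S)"
      by (intro span_scale span_diff span_sum) (use GS span_base[of x "insert x S"] in auto)
    ultimately show ?thesis using on G(1) GS by (meson finite_insert insert_subset)
  qed
qed

text \<open>The Hilbert--Schmidt norm of the underlying real-linear operator is at most \<open>C\<close>. Testing on
  finite orthonormal sets reduces every estimate to finite sums. A complex-linear operator has a
  real Hilbert--Schmidt norm that is \<open>sqrt 2\<close> times the complex one.\<close>

definition hs_le :: "('a::{real_inner,complete_space} \<Rightarrow>\<^sub>L 'a) \<Rightarrow> real \<Rightarrow> bool" where
  "hs_le A C \<longleftrightarrow> (\<forall>F. finite F \<longrightarrow> orthon F \<longrightarrow> L2_set (\<lambda>x. norm (A x)) F \<le> C)"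

definition is_hs :: "('a::{real_inner,complete_space} \<Rightarrow>\<^sub>L 'a) \<Rightarrow> bool" where
  "is_hs A \<longleftrightarrow> (\<exists>C. hs_le A C)"

lemma hs_leD: "hs_le A C \<Longrightarrow> finite F \<Longrightarrow> orthon F \<Longrightarrow> L2_set (\<lambda>x. norm (blinfun_apply A x)) F \<le> C"
  by (simp add: hs_le_def)

lemma hs_le_nonneg: "hs_le A C \<Longrightarrow> 0 \<le> C"
  using hs_leD[of A C "{}"] by simp

lemma hs_le_mono: "hs_le A C \<Longrightarrow> C \<le> D \<Longrightarrow> hs_le A D"
  unfolding hs_le_def by (meson order_trans)

lemma hs_le_zero: "hs_le 0 0"
  by (simp add: hs_le_def L2_set_def)

lemma hs_le_add:
  assumes "hs_le A C" "hs_le B D" shows "hs_le (A + B) (C + D)"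
  unfolding hs_le_def
proof (intro allI impI)
  fix F :: "'a set" assume F: "finite F" "orthon F"
  have "L2_set (\<lambda>x. norm ((A + B) x)) F \<le> L2_set (\<lambda>x. norm (A x) + norm (B x)) F"
    by (rule L2_set_mono) (auto simp: blin_simps norm_triangle_ineq)
  also have "\<dots> \<le> L2_set (\<lambda>x. norm (A x)) F + L2_set (\<lambda>x. norm (B x)) F" by (rule L2_set_triangle_ineq)
  also have "\<dots> \<le> C + D" by (intro add_mono hs_leD assms F)
  finally show "L2_set (\<lambda>x. norm ((A + B) x)) F \<le> C + D" .
qed

lemma hs_le_minus: "hs_le A C \<Longrightarrow> hs_le (- A) C"
  by (simp add: hs_le_def blin_simps)

lemma hs_le_diff: "hs_le A C \<Longrightarrow> hs_le B D \<Longrightarrow> hs_le (A - B) (C + D)"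
  using hs_le_add[OF _ hs_le_minus, of A C B D] by simp

lemma hs_le_left:
  assumes "hs_le A C" shows "hs_le (B \<odot> A) (norm B * C)"
  unfolding hs_le_def
proof (intro allI impI)
  fix F :: "'a set" assume F: "finite F" "orthon F"
  have "L2_set (\<lambda>x. norm ((B \<odot> A) x)) F \<le> L2_set (\<lambda>x. norm B * norm (A x)) F"
    by (rule L2_set_mono) (auto simp: norm_blinfun)
  also have "\<dots> = norm B * L2_set (\<lambda>x. norm (A x)) F" by (simp add: L2_set_right_distrib)
  also have "\<dots> \<le> norm B * C" by (intro mult_left_mono hs_leD assms F) auto
  finally show "L2_set (\<lambda>x. norm ((B \<odot> A) x)) F \<le> norm B * C" .
qed

lemma hs_le_iff: "hs_le A C \<longleftrightarrow> 0 \<le> C \<and> (\<forall>F. finite F \<longrightarrow> orthon F \<longrightarrow> (\<Sum>x\<in>F. (norm (blinfun_apply A x))\<^sup>2) \<le> C\<^sup>2)"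
proof
  assume h: "hs_le A C"
  show "0 \<le> C \<and> (\<forall>F. finite F \<longrightarrow> orthon F \<longrightarrow> (\<Sum>x\<in>F. (norm (blinfun_apply A x))\<^sup>2) \<le> C\<^sup>2)"
    using hs_leD[OF h] hs_le_nonneg[OF h] unfolding L2_set_def
    by (simp add: sqrt_le_D)
next
  assume "0 \<le> C \<and> (\<forall>F. finite F \<longrightarrow> orthon F \<longrightarrow> (\<Sum>x\<in>F. (norm (blinfun_apply A x))\<^sup>2) \<le> C\<^sup>2)"
  then show "hs_le A C" unfolding hs_le_def L2_set_def by (auto intro: real_le_lsqrt)
qed

text \<open>Expand the finitely many images \<open>A\<^sup>\<dagger> f\<close> in an orthonormal basis \<open>G\<close> of their span and
  exchange the sums; Bessel's inequality bounds the sum over \<open>F\<close>.\<close>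

lemma hs_le_adj:
  assumes "hs_le A C" shows "hs_le (A\<^sup>\<dagger>) C"
  unfolding hs_le_iff
proof (intro conjI allI impI)
  show "0 \<le> C" using hs_le_nonneg assms .
  fix F :: "'a set" assume F: "finite F" "orthon F"
  obtain G where G: "finite G" "orthon G" "blinfun_apply (A\<^sup>\<dagger>) ` F \<subseteq> span G"
    using finite_orthon_spanning[of "blinfun_apply (A\<^sup>\<dagger>) ` F"] F by blast
  have "(\<Sum>f\<in>F. (norm (A\<^sup>\<dagger> f))\<^sup>2) = (\<Sum>f\<in>F. \<Sum>g\<in>G. (g \<bullet> A\<^sup>\<dagger> f)\<^sup>2)"
    by (rule sum.cong[OF refl]) (rule parseval_in_span[OF G(1,2)], use G(3) in blast)
  also have "\<dots> = (\<Sum>g\<in>G. \<Sum>f\<in>F. (f \<bullet> A g)\<^sup>2)"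
    by (subst sum.swap) (simp add: adj_right inner_commute)
  also have "\<dots> \<le> (\<Sum>g\<in>G. (norm (A g))\<^sup>2)" by (intro sum_mono bessel_inequality F)
  also have "\<dots> \<le> C\<^sup>2" using assms G unfolding hs_le_iff by blast
  finally show "(\<Sum>f\<in>F. (norm (A\<^sup>\<dagger> f))\<^sup>2) \<le> C\<^sup>2" .
qed

lemma hs_le_right:
  assumes "hs_le A C" shows "hs_le (A \<odot> B) (norm B * C)"
proof -
  have "hs_le ((B\<^sup>\<dagger> \<odot> A\<^sup>\<dagger>)\<^sup>\<dagger>) (norm (B\<^sup>\<dagger>) * C)" by (intro hs_le_adj hs_le_left assms)
  then show ?thesis by (simp add: adj_compose)
qed

lemma is_hs_zero: "is_hs 0" using hs_le_zero is_hs_def by blast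
lemma is_hs_add: "is_hs A \<Longrightarrow> is_hs B \<Longrightarrow> is_hs (A + B)" using hs_le_add is_hs_def by metis
lemma is_hs_diff: "is_hs A \<Longrightarrow> is_hs B \<Longrightarrow> is_hs (A - B)" using hs_le_diff is_hs_def by metis
lemma is_hs_minus: "is_hs A \<Longrightarrow> is_hs (- A)" using hs_le_minus is_hs_def by metis
lemma is_hs_left: "is_hs A \<Longrightarrow> is_hs (B \<odot> A)" using hs_le_left is_hs_def by metis
lemma is_hs_right: "is_hs A \<Longrightarrow> is_hs (A \<odot> B)" using hs_le_right is_hs_def by metis
lemma is_hs_adj: "is_hs A \<Longrightarrow> is_hs (A\<^sup>\<dagger>)" using hs_le_adj is_hs_def by metis

text \<open>A finite orthonormal set that nearly exhausts the Hilbert--Schmidt norm leaves little for a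
  unit vector orthogonal to it. This is the form in which compactness is used.\<close>

lemma hs_tail:
  assumes "is_hs A" "e > 0"
  shows "\<exists>F. finite F \<and> orthon F \<and> (\<forall>x. (\<forall>f\<in>F. f \<bullet> x = 0) \<longrightarrow> norm (blinfun_apply A x) \<le> e * norm x)"
proof -
  obtain C where C: "hs_le A C" using assms is_hs_def by blast
  let ?s = "\<lambda>F. \<Sum>x\<in>F. (norm (A x))\<^sup>2"
  let ?\<F> = "{F. finite F \<and> orthon F}"
  have bdd: "bdd_above (?s ` ?\<F>)" using C unfolding hs_le_iff by (auto intro: bdd_aboveI2)
  have ne: "?\<F> \<noteq> {}" using orthon_empty by blast
  have "Sup (?s ` ?\<F>) - e\<^sup>2 < Sup (?s ` ?\<F>)" using assms(2) by simp
  then obtain F where F: "finite F" "orthon F" "Sup (?s ` ?\<F>) - e\<^sup>2 < ?s F"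
    using less_cSUP_iff[OF ne bdd] by blast
  have "norm (A x) \<le> e * norm x" if x: "\<forall>f\<in>F. f \<bullet> x = 0" for x
  proof (cases "x = 0")
    case False
    let ?u = "(1 / norm x) *\<^sub>R x"
    have on: "orthon (insert ?u F)" by (rule orthon_insert_normalized[OF F(2) False]) (use x in blast)
    have "?u \<notin> F" using x False by (metis (no_types) inner_scaleR_left inner_eq_zero_iff mult_eq_0_iff divide_eq_0_iff norm_eq_zero zero_neq_one)
    then have "?s (insert ?u F) = (norm (A ?u))\<^sup>2 + ?s F" using F(1) by simp
    moreover have "?s (insert ?u F) \<le> Sup (?s ` ?\<F>)" by (rule cSUP_upper[OF _ bdd]) (use on F in auto)
    ultimately have "(norm (A ?u))\<^sup>2 < e\<^sup>2" using F(3) by linarith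
    then have "norm (A ?u) \<le> e" using assms(2) power2_less_imp_less less_imp_le by fastforce
    moreover have "norm (A ?u) = norm (A x) / norm x" by (simp add: blin_simps)
    ultimately show ?thesis using False by (simp add: field_simps)
  qed (simp add: blin_simps)
  then show ?thesis using F(1,2) by blast
qed

definition rank_one :: "'a::real_inner \<Rightarrow> 'a \<Rightarrow> 'a \<Rightarrow>\<^sub>L 'a" where
  "rank_one a b = Blinfun (\<lambda>x. (a \<bullet> x) *\<^sub>R b)"

lemma rank_one_apply [simp]: "rank_one a b x = (a \<bullet> x) *\<^sub>R b"
proof -
  have "bounded_linear (\<lambda>x. (a \<bullet> x) *\<^sub>R b)"
    by (intro bounded_linear_compose[OF bounded_linear_scaleR_left] bounded_linear_inner_right)
  then show ?thesis by (simp add: rank_one_def bounded_linear_Blinfun_apply)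
qed

lemma hs_le_rank_one: "hs_le (rank_one a b) (norm a * norm b)"
  unfolding hs_le_iff
proof (intro conjI allI impI)
  fix F :: "'a set" assume F: "finite F" "orthon F"
  have "(\<Sum>x\<in>F. (norm (rank_one a b x))\<^sup>2) = (\<Sum>x\<in>F. (x \<bullet> a)\<^sup>2) * (norm b)\<^sup>2"
    by (simp add: power_mult_distrib sum_distrib_right inner_commute)
  also have "\<dots> \<le> (norm a)\<^sup>2 * (norm b)\<^sup>2" by (intro mult_right_mono bessel_inequality F) auto
  finally show "(\<Sum>x\<in>F. (norm (rank_one a b x))\<^sup>2) \<le> (norm a * norm b)\<^sup>2" by (simp add: power_mult_distrib)
qed simp

text \<open>The situation of the two components of an isometry: if \<open>T\<close> is Hilbert--Schmidt, then \<open>A\<close> is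
  isometric up to a compact error. Hence the Fredholm alternative holds: \<open>A\<close> has closed range on
  \<open>S\<close>, its kernel is finite-dimensional, and it is bounded below if it is injective.\<close>

locale complementary_hs =
  fixes S :: "'a::{real_inner,complete_space} set" and A T :: "'a \<Rightarrow>\<^sub>L 'a"
  assumes S: "closed S" "subspace S" and hs: "is_hs T"
    and pyth: "\<And>x. x \<in> S \<Longrightarrow> (norm (A x))\<^sup>2 + (norm (T x))\<^sup>2 = (norm x)\<^sup>2"
begin

text \<open>Off finitely many directions \<open>T\<close> shrinks vectors at least by one half, so that \<open>A\<close> cannot
  shrink them much.\<close>

lemma finite_codim_bddbelow:
  "\<exists>S' F. finite F \<and> closed S' \<and> subspace S' \<and> bddbelow A S' \<and> S = span (S' \<union> F)"
proof -
  obtain F where F: "finite F" "orthon F" "\<And>x. (\<forall>f\<in>F. f \<bullet> x = 0) \<Longrightarrow> norm (T x) \<le> (1/2) * norm x"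
    using hs_tail[OF hs, of "1/2"] by auto
  define G where "G = oproj S ` F"
  obtain H where H: "finite H" "orthon H" "G \<subseteq> span H" "H \<subseteq> span G"
    using finite_orthon_spanning[of G] F(1) by (auto simp: G_def)
  have "span G \<subseteq> S"
    by (rule span_minimal[OF _ S(2)]) (use oproj_in[OF S] in \<open>auto simp: G_def\<close>)
  then have HS: "H \<subseteq> S" using H(4) by blast
  define S' where "S' = {x\<in>S. \<forall>h\<in>H. h \<bullet> x = 0}"
  have S': "closed S'" "subspace S'"
  proof -
    have eq: "S' = S \<inter> (\<Inter>h\<in>H. {x. h \<bullet> x = 0})" by (auto simp: S'_def)
    show "closed S'" unfolding eq
      by (intro closed_Int closed_INT S ballI closed_Collect_eq continuous_intros)
    show "subspace S'" using S(2) by (auto simp: S'_def subspace_def inner_add)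
  qed
  have small: "norm (T x) \<le> (1/2) * norm x" if x: "x \<in> S'" for x
  proof (rule F(3), rule ballI)
    fix f assume "f \<in> F"
    have "span H \<subseteq> {y. y \<bullet> x = 0}"
      by (rule span_minimal) (use x in \<open>auto simp: S'_def subspace_def inner_add\<close>)
    then have "oproj S f \<bullet> x = 0" using H(3) \<open>f \<in> F\<close> by (auto simp: G_def)
    moreover have "(f - oproj S f) \<bullet> x = 0" using oproj_orth[OF S] x by (auto simp: S'_def)
    ultimately show "f \<bullet> x = 0" by (simp add: inner_diff)
  qed
  have "bddbelow A S'"
    unfolding bddbelow_def
  proof (intro exI[of _ "1/2"] conjI ballI)
    fix x assume x: "x \<in> S'"
    have "(norm (T x))\<^sup>2 \<le> ((1/2) * norm x)\<^sup>2" by (intro power_mono small x) auto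
    moreover have "x \<in> S" using x by (simp add: S'_def)
    ultimately have "(norm (A x))\<^sup>2 \<ge> (1 - 1/4) * (norm x)\<^sup>2"
      using pyth[of x] by (simp add: power_mult_distrib power2_eq_square)
    then have "((1/2) * norm x)\<^sup>2 \<le> (norm (A x))\<^sup>2"
      by (simp add: power_mult_distrib power2_eq_square) (smt (verit) zero_le_square)
    then show "(1/2) * norm x \<le> norm (A x)" by (rule power2_le_imp_le) simp
  qed simp
  moreover have "S = span (S' \<union> H)"
  proof
    show "span (S' \<union> H) \<subseteq> S" by (rule span_minimal[OF _ S(2)]) (use HS in \<open>auto simp: S'_def\<close>)
    show "S \<subseteq> span (S' \<union> H)"
    proof
      fix x assume x: "x \<in> S"
      let ?p = "\<Sum>f\<in>H. (f \<bullet> x) *\<^sub>R f"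
      have "?p \<in> S" using HS by (intro subspace_sum[OF S(2)] subspace_scale[OF S(2)]) auto
      then have "x - ?p \<in> S'" using x bessel_residual_orth[OF H(1,2)] subspace_diff[OF S(2)]
        by (auto simp: S'_def)
      moreover have "?p \<in> span (S' \<union> H)" by (intro span_sum span_scale span_base) auto
      ultimately have "(x - ?p) + ?p \<in> span (S' \<union> H)" by (intro span_add) (auto intro: span_base)
      then show "x \<in> span (S' \<union> H)" by simp
    qed
  qed
  ultimately show ?thesis using H(1) S' by blast
qed

lemma closed_image: "closed (A ` S)"
proof -
  obtain S' F where SF: "finite F" "closed S'" "subspace S'" "bddbelow A S'" "S = span (S' \<union> F)"
    using finite_codim_bddbelow by blast
  have "linear (blinfun_apply A)" by (auto intro: bounded_linear.linear blinfun.bounded_linear_right)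
  then have "A ` S = span (A ` S' \<union> A ` F)"
    unfolding SF(5) by (metis image_Un linear_span_image)
  moreover have "closed (span (A ` S' \<union> A ` F))"
    by (intro closed_add_finite bddbelow_closed_image subspace_blinfun_image SF finite_imageI)
  ultimately show ?thesis by simp
qed

lemma bddbelow_if_injective:
  assumes "\<And>x. x \<in> S \<Longrightarrow> A x = 0 \<Longrightarrow> x = 0"
  shows "bddbelow A S"
proof -
  obtain S' F where SF: "finite F" "closed S'" "subspace S'" "bddbelow A S'" "S = span (S' \<union> F)"
    using finite_codim_bddbelow by blast
  show ?thesis unfolding SF(5)
    by (rule bddbelow_add_finite[OF SF(1-4)]) (use assms SF(5) in blast)
qed

text \<open>\<open>T\<close> is isometric on the kernel of \<open>A\<close>, so that each orthonormal vector in the kernel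
  contributes \<open>1\<close> to a sum bounded by the squared Hilbert--Schmidt norm.\<close>

lemma kernel_orthon_card_bound:
  "\<exists>n. \<forall>B. finite B \<longrightarrow> orthon B \<longrightarrow> B \<subseteq> {x\<in>S. A x = 0} \<longrightarrow> card B \<le> (n::nat)"
proof -
  obtain C where C: "hs_le T C" using hs is_hs_def by blast
  have "card B \<le> nat \<lceil>C\<^sup>2\<rceil>" if B: "finite B" "orthon B" "B \<subseteq> {x\<in>S. A x = 0}" for B
  proof -
    have "(norm (T x))\<^sup>2 = 1" if "x \<in> B" for x
      using pyth[of x] B that orthonD[OF B(2) that that] by (auto simp: power2_norm_eq_inner)
    then have "real (card B) = (\<Sum>x\<in>B. (norm (T x))\<^sup>2)" by simp
    also have "\<dots> \<le> C\<^sup>2" using C B unfolding hs_le_iff by blast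
    finally show ?thesis by linarith
  qed
  then show ?thesis by blast
qed

end


section \<open>Complex inner products, dimensions and orthonormal bases\<close>

abbreviation csubspace :: "'a::complex_vector set \<Rightarrow> bool" where
  "csubspace \<equiv> complex_vector.subspace"

abbreviation cindependent :: "'a::complex_vector set \<Rightarrow> bool" where
  "cindependent \<equiv> complex_vector.independent"

interpretation cpair: vector_space_pair
  "scaleC :: complex \<Rightarrow> 'a \<Rightarrow> 'a::complex_vector" "scaleC :: complex \<Rightarrow> 'b \<Rightarrow> 'b::complex_vector"
  by unfold_locales

lemma cinner_add_left: "cinner (x + y) z = cinner x z + cinner y (z :: 'a::complex_inner)"
  by (metis cinner_commute cinner_add_right complex_cnj_add)

lemma cinner_scaleC_left: "cinner (scaleC a x) y = cnj a * cinner x (y :: 'a::complex_inner)"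
  by (metis cinner_commute cinner_scaleC_right complex_cnj_mult)

lemma scaleC_minus1: "scaleC (-1) x = - (x :: 'a::complex_vector)"
  using scaleC_of_real[of "-1" x] by simp

lemma cinner_zero_right [simp]: "cinner x 0 = (0 :: complex)"
  by (metis add_cancel_right_right cinner_add_right)

lemma cinner_zero_left [simp]: "cinner 0 x = (0 :: complex)"
  by (metis cinner_commute cinner_zero_right complex_cnj_zero)

lemma cinner_minus_right: "cinner x (- y) = - cinner x (y :: 'a::complex_inner)"
  by (metis add.right_inverse add_eq_0_iff cinner_add_right cinner_zero_right)

lemma cinner_minus_left: "cinner (- x) y = - cinner x (y :: 'a::complex_inner)"
  by (metis cinner_commute cinner_minus_right complex_cnj_minus)

lemma cinner_diff_right: "cinner x (y - z) = cinner x y - cinner x (z :: 'a::complex_inner)"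
  by (metis cinner_add_right cinner_minus_right diff_conv_add_uminus)

lemma cinner_diff_left: "cinner (x - y) z = cinner x z - cinner y (z :: 'a::complex_inner)"
  by (metis cinner_add_left cinner_minus_left diff_conv_add_uminus)

lemma cinner_sum_right: "cinner x (sum f A) = (\<Sum>i\<in>A. cinner x (f i :: 'a::complex_inner))"
  by (induction A rule: infinite_finite_induct) (auto simp: cinner_add_right)

lemmas cinner_simps = cinner_add_left cinner_add_right cinner_diff_left cinner_diff_right
  cinner_minus_left cinner_minus_right cinner_scaleC_left cinner_scaleC_right

lemma Im_cinner: "Im (cinner x y) = - (x \<bullet> scaleC \<i> (y :: 'a::complex_inner))"
  by (simp add: Re_cinner[symmetric] cinner_scaleC_right)

lemma cinner_self: "cinner x x = complex_of_real ((norm (x :: 'a::complex_inner))\<^sup>2)"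
proof (rule complex_eqI)
  show "Re (cinner x x) = Re (complex_of_real ((norm x)\<^sup>2))" by (simp add: Re_cinner power2_norm_eq_inner)
  have "Im (cinner x x) = - Im (cinner x x)" by (metis cinner_commute cnj.simps(2))
  then show "Im (cinner x x) = Im (complex_of_real ((norm x)\<^sup>2))" by simp
qed

lemma cinner_eq_zero_iff [simp]: "cinner x x = 0 \<longleftrightarrow> (x :: 'a::complex_inner) = 0"
  by (simp add: cinner_self)

lemma norm_scaleC: "norm (scaleC a x) = cmod a * norm (x :: 'a::complex_inner)"
proof -
  have "complex_of_real ((norm (scaleC a x))\<^sup>2) = complex_of_real ((cmod a * norm x)\<^sup>2)"
    unfolding cinner_self[symmetric] cinner_simps power_mult_distrib of_real_mult
    by (simp only: complex_norm_square) (simp add: mult_ac)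
  then have "(norm (scaleC a x))\<^sup>2 = (cmod a * norm x)\<^sup>2" using of_real_eq_iff by blast
  then show ?thesis by (simp add: power2_eq_iff_nonneg)
qed

lemma cinner_eqI: "(\<And>y. cinner u y = cinner v y) \<Longrightarrow> u = (v :: 'a::complex_inner)"
  by (metis cinner_diff_left cinner_eq_zero_iff eq_iff_diff_eq_0)

lemma bounded_linear_scaleC: "bounded_linear (scaleC a :: 'a::complex_inner \<Rightarrow> 'a)"
proof (rule bounded_linear_intro[where K = "cmod a"])
  show "scaleC a (r *\<^sub>R x) = r *\<^sub>R scaleC a x" for r and x :: 'a
    by (simp add: scaleC_of_real[symmetric] scaleC_scaleC mult.commute)
qed (auto simp: scaleC_add_right norm_scaleC)

definition scaleC_op :: "complex \<Rightarrow> 'a::complex_inner \<Rightarrow>\<^sub>L 'a" where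
  "scaleC_op a = Blinfun (scaleC a)"

lemma scaleC_op_apply [simp]: "scaleC_op a x = scaleC a x"
  by (simp add: scaleC_op_def bounded_linear_scaleC bounded_linear_Blinfun_apply)

lemma clinear_opD: "clinear_op A \<Longrightarrow> A (scaleC a x) = scaleC a (blinfun_apply A x)"
  by (simp add: clinear_op_def)

lemma cinner_adj_left:
  assumes "clinear_op A" shows "cinner (A\<^sup>\<dagger> x) y = cinner x (blinfun_apply A y)"
proof (rule complex_eqI)
  show "Re (cinner (A\<^sup>\<dagger> x) y) = Re (cinner x (A y))" by (simp add: Re_cinner adj_left)
  show "Im (cinner (A\<^sup>\<dagger> x) y) = Im (cinner x (A y))"
    by (simp add: Im_cinner adj_left clinear_opD[OF assms])
qed

lemma cinner_adj_right:
  assumes "clinear_op A" shows "cinner x (A\<^sup>\<dagger> y) = cinner (blinfun_apply A x) y"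
  by (metis assms cinner_adj_left cinner_commute)

lemma cadjoint_eq_adj:
  assumes "clinear_op A" shows "cadjoint A = A\<^sup>\<dagger>"
  unfolding cadjoint_def
proof (rule the_equality)
  show "\<forall>x y. cinner (A\<^sup>\<dagger> x) y = cinner x (A y)" using cinner_adj_left[OF assms] by blast
  fix B :: "'a \<Rightarrow>\<^sub>L 'a" assume "\<forall>x y. cinner (B x) y = cinner x (A y)"
  then have "B x \<bullet> y = x \<bullet> A y" for x y by (metis Re_cinner)
  then show "B = A\<^sup>\<dagger>" using adj_unique by metis
qed

lemma clinear_op_adj: "clinear_op A \<Longrightarrow> clinear_op (A\<^sup>\<dagger>)"
  unfolding clinear_op_def[of "A\<^sup>\<dagger>"]
  by (intro allI cinner_eqI) (simp add: cinner_adj_left cinner_scaleC_left)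

lemma csubspace_imp_subspace: "csubspace S \<Longrightarrow> subspace (S :: 'a::complex_vector set)"
  unfolding complex_vector.subspace_def real_vector.subspace_def
  by (metis scaleC_of_real)

text \<open>On a complex subspace real orthogonality implies complex orthogonality, because the subspace
  contains \<open>\<i> y\<close> along with \<open>y\<close>.\<close>

lemma cinner_zeroI:
  assumes "csubspace S" "\<And>y. y \<in> S \<Longrightarrow> x \<bullet> y = 0" "y \<in> S"
  shows "cinner x (y :: 'a::complex_inner) = 0"
proof (rule complex_eqI)
  show "Re (cinner x y) = Re 0" using assms by (simp add: Re_cinner)
  have "scaleC \<i> y \<in> S" using assms complex_vector.subspace_scale by blast
  then show "Im (cinner x y) = Im 0" using assms by (simp add: Im_cinner)
qed

lemma oproj_corth:
  assumes "closed S" "csubspace S" "y \<in> S"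
  shows "cinner (x - oproj S x) (y :: 'a::chilbert_space) = 0"
  by (rule cinner_zeroI[OF assms(2) _ assms(3)])
     (rule oproj_orth[OF assms(1) csubspace_imp_subspace[OF assms(2)]])

lemma oproj_corth':
  assumes "closed S" "csubspace S" "y \<in> S"
  shows "cinner y (x - oproj S x :: 'a::chilbert_space) = 0"
  by (metis assms cinner_commute complex_cnj_zero oproj_corth)

lemma oproj_cunique:
  assumes "closed S" "csubspace S" "p \<in> S" "\<And>y. y \<in> S \<Longrightarrow> cinner (x - p) y = 0"
  shows "oproj S x = (p :: 'a::chilbert_space)"
  by (rule oproj_unique[OF assms(1) csubspace_imp_subspace[OF assms(2)] assms(3)])
     (metis assms(4) Re_cinner zero_complex.simps(1))

lemma clinear_op_oproj:
  assumes "closed S" "csubspace (S :: 'a::chilbert_space set)"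
  shows "clinear_op (oproj S)"
  unfolding clinear_op_def
proof (intro allI oproj_cunique[OF assms])
  fix a x show "scaleC a (oproj S x) \<in> S"
    using oproj_in[OF assms(1) csubspace_imp_subspace[OF assms(2)]] assms(2) complex_vector.subspace_scale by blast
  fix y assume "y \<in> S"
  then have "cinner (scaleC a (x - oproj S x)) y = 0"
    by (simp only: cinner_scaleC_left oproj_corth[OF assms] mult_zero_right)
  then show "cinner (scaleC a x - scaleC a (oproj S x)) y = 0"
    by (simp add: complex_vector.scale_right_diff_distrib)
qed

lemma csubspace_closure:
  assumes "csubspace (S :: 'a::complex_inner set)" shows "csubspace (closure S)"
  unfolding complex_vector.subspace_def
proof (intro conjI ballI allI)
  show "0 \<in> closure S" using complex_vector.subspace_0[OF assms] closure_subset by blast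
  show "x + y \<in> closure S" if xy: "x \<in> closure S" "y \<in> closure S" for x y
  proof -
    obtain f where "\<forall>n. f n \<in> S" "f \<longlonglongrightarrow> x" using xy(1) unfolding closure_sequential by blast
    moreover obtain g where "\<forall>n. g n \<in> S" "g \<longlonglongrightarrow> y" using xy(2) unfolding closure_sequential by blast
    ultimately show ?thesis unfolding closure_sequential using complex_vector.subspace_add[OF assms]
      by (intro exI[of _ "\<lambda>n. f n + g n"]) (auto intro: tendsto_add)
  qed
  show "scaleC c x \<in> closure S" if "x \<in> closure S" for c x
  proof -
    have "scaleC c ` closure S \<subseteq> closure (scaleC c ` S)"
      by (rule closure_bounded_linear_image_subset[OF bounded_linear_scaleC])
    also have "\<dots> \<subseteq> closure S"
      by (rule closure_mono) (use assms complex_vector.subspace_scale in blast)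
    finally show ?thesis using that by blast
  qed
qed

lemma corth_closure_span:
  assumes "\<And>b. b \<in> B \<Longrightarrow> cinner x b = 0" "y \<in> closure (cspan B)"
  shows "cinner x (y :: 'a::complex_inner) = 0"
proof -
  let ?S = "{y. x \<bullet> y = 0 \<and> x \<bullet> scaleC \<i> y = 0}"
  have eq: "?S = {y. cinner x y = 0}" by (auto simp: complex_eq_iff Re_cinner Im_cinner)
  have "continuous_on UNIV (scaleC \<i> :: 'a \<Rightarrow> 'a)"
    by (rule linear_continuous_on[OF bounded_linear_scaleC])
  then have "closed ?S" by (intro closed_Collect_conj closed_Collect_eq continuous_intros) auto
  moreover have "cspan B \<subseteq> ?S"
    unfolding eq
    by (rule complex_vector.span_minimal) (use assms(1) in \<open>auto simp: complex_vector.subspace_def cinner_simps\<close>)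
  ultimately have "closure (cspan B) \<subseteq> ?S" by (metis closure_minimal)
  then show ?thesis using assms(2) eq by blast
qed

definition corthon :: "'a::complex_inner set \<Rightarrow> bool" where
  "corthon E \<longleftrightarrow> (\<forall>x\<in>E. \<forall>y\<in>E. cinner x y = (if x = y then 1 else 0))"

lemma corthonD: "corthon E \<Longrightarrow> x \<in> E \<Longrightarrow> y \<in> E \<Longrightarrow> cinner x y = (if x = y then 1 else 0)"
  by (simp add: corthon_def)

lemma corthon_subset: "corthon E \<Longrightarrow> F \<subseteq> E \<Longrightarrow> corthon F" unfolding corthon_def by blast

lemma corthon_imp_orthon: "corthon E \<Longrightarrow> orthon E"
  unfolding corthon_def orthon_def by (metis Re_cinner one_complex.simps(1) zero_complex.simps(1))

lemma corthon_norm: "corthon E \<Longrightarrow> x \<in> E \<Longrightarrow> norm x = 1"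
  using orthonD[OF corthon_imp_orthon, of E x x] by (simp add: norm_eq_sqrt_inner)

lemma corthon_insert_normalized:
  assumes "corthon F" "r \<noteq> 0" "\<And>f. f \<in> F \<Longrightarrow> cinner f r = 0"
  shows "corthon (insert ((1 / norm r) *\<^sub>R r) F)" "(1 / norm r) *\<^sub>R r \<notin> F"
proof -
  let ?u = "(1 / norm r) *\<^sub>R r"
  have eq: "?u = scaleC (complex_of_real (1 / norm r)) r" by (simp only: scaleC_of_real)
  have u: "cinner ?u ?u = 1" unfolding cinner_self using assms(2) by simp
  have 0: "cinner f ?u = 0" "cinner ?u f = 0" if "f \<in> F" for f
    using assms(3)[OF that] unfolding eq
    by (auto simp: cinner_simps) (metis cinner_commute complex_cnj_zero)
  show nin: "?u \<notin> F" using 0[of ?u] u by auto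
  show "corthon (insert ?u F)" using assms(1) u 0 unfolding corthon_def by (metis insert_iff)
qed

lemma corthon_residual:
  assumes "finite F" "corthon F" "g \<in> F"
  shows "cinner g (x - (\<Sum>f\<in>F. scaleC (cinner f x) f)) = 0"
proof -
  have "cinner g (\<Sum>f\<in>F. scaleC (cinner f x) f) = (\<Sum>f\<in>F. if g = f then cinner f x else 0)"
    unfolding cinner_sum_right by (rule sum.cong) (use corthonD[OF assms(2,3)] in \<open>auto simp: cinner_simps\<close>)
  then show ?thesis using assms by (simp add: cinner_simps)
qed

lemma corthon_expansion_in: "(\<Sum>f\<in>F. scaleC (cinner f x) f) \<in> cspan F"
  by (intro complex_vector.span_sum complex_vector.span_scale complex_vector.span_base)

lemma cspan_corth:
  assumes "\<And>b. b \<in> B \<Longrightarrow> cinner b r = 0" "y \<in> cspan B"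
  shows "cinner r (y :: 'a::complex_inner) = 0"
proof (rule corth_closure_span[of B])
  show "cinner r b = 0" if "b \<in> B" for b using assms(1)[OF that] by (metis cinner_commute complex_cnj_zero)
  show "y \<in> closure (cspan B)" using assms(2) closure_subset by blast
qed

lemma corthon_expansion:
  assumes "finite F" "corthon F" "x \<in> cspan F"
  shows "(\<Sum>f\<in>F. scaleC (cinner f x) f) = x"
proof -
  let ?r = "x - (\<Sum>f\<in>F. scaleC (cinner f x) f)"
  have "?r \<in> cspan F" by (intro complex_vector.span_diff assms(3) corthon_expansion_in)
  then have "cinner ?r ?r = 0" by (rule cspan_corth[rotated]) (rule corthon_residual[OF assms(1,2)])
  then show ?thesis by simp
qed

lemma corthon_norm_expansion:
  assumes "finite F" "corthon F"
  shows "(norm x)\<^sup>2 = (\<Sum>f\<in>F. (cmod (cinner f x))\<^sup>2) + (norm (x - (\<Sum>f\<in>F. scaleC (cinner f x) f)))\<^sup>2"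
proof -
  let ?p = "\<Sum>f\<in>F. scaleC (cinner f x) f"
  have o: "cinner (x - ?p) ?p = 0"
    by (rule cspan_corth[of F]) (use corthon_residual[OF assms] corthon_expansion_in in auto)
  then have re: "(x - ?p) \<bullet> ?p = 0" by (metis Re_cinner zero_complex.simps(1))
  have "complex_of_real ((norm ?p)\<^sup>2) = cinner ?p ?p" by (simp only: cinner_self)
  also have "\<dots> = cinner x ?p" using o by (simp add: cinner_diff_left)
  also have "\<dots> = (\<Sum>f\<in>F. cinner f x * cinner x f)" by (simp add: cinner_sum_right cinner_simps)
  also have "\<dots> = (\<Sum>f\<in>F. complex_of_real ((cmod (cinner f x))\<^sup>2))"
    by (rule sum.cong[OF refl]) (simp only: complex_norm_square cinner_commute[of x])
  finally have "complex_of_real ((norm ?p)\<^sup>2) = complex_of_real (\<Sum>f\<in>F. (cmod (cinner f x))\<^sup>2)"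
    by (simp only: of_real_sum)
  then have "(norm ?p)\<^sup>2 = (\<Sum>f\<in>F. (cmod (cinner f x))\<^sup>2)" by (simp only: of_real_eq_iff)
  then show ?thesis using power2_norm_add[of "x - ?p" ?p] re by simp
qed

lemma corthon_independent:
  assumes "corthon E" shows "cindependent (E :: 'a::complex_inner set)"
  unfolding complex_vector.independent_explicit_module
proof (intro allI impI)
  fix F c x assume F: "finite F" "F \<subseteq> E" "(\<Sum>x\<in>F. scaleC (c x) x) = 0" "x \<in> F"
  have oF: "corthon F" by (rule corthon_subset[OF assms F(2)])
  have "0 = cinner x (\<Sum>x\<in>F. scaleC (c x) x)" using F(3) by simp
  also have "\<dots> = (\<Sum>y\<in>F. if x = y then c y else 0)"
    unfolding cinner_sum_right
    by (rule sum.cong) (use corthonD[OF oF F(4)] in \<open>auto simp: cinner_scaleC_right\<close>)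
  also have "\<dots> = c x" using F by simp
  finally show "c x = 0" by simp
qed

lemma closed_cspan_corthon:
  assumes "finite F" "corthon F" shows "closed (cspan (F :: 'a::complex_inner set))"
proof -
  have "cspan F = {x. (\<Sum>f\<in>F. scaleC (cinner f x) f) = x}"
  proof (intro set_eqI iffI CollectI)
    fix x assume "x \<in> {x. (\<Sum>f\<in>F. scaleC (cinner f x) f) = x}"
    then show "x \<in> cspan F" using corthon_expansion_in[of x F] by simp
  qed (rule corthon_expansion[OF assms])
  moreover have "bounded_linear (\<lambda>x. scaleC (cinner f x) f)" for f :: 'a
  proof (rule bounded_linear_intro[where K = "2 * norm f * norm f"])
    show "scaleC (cinner f (x + y)) f = scaleC (cinner f x) f + scaleC (cinner f y) f" for x y
      by (simp add: cinner_simps scaleC_add_left)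
    show "scaleC (cinner f (r *\<^sub>R x)) f = r *\<^sub>R scaleC (cinner f x) f" for r x
      by (simp add: scaleC_of_real[symmetric] cinner_simps scaleC_scaleC)
    show "norm (scaleC (cinner f x) f) \<le> norm x * (2 * norm f * norm f)" for x
    proof -
      have "cmod (cinner f x) \<le> \<bar>f \<bullet> x\<bar> + \<bar>f \<bullet> scaleC \<i> x\<bar>"
        using cmod_le[of "cinner f x"] by (simp add: Re_cinner Im_cinner)
      also have "\<dots> \<le> norm f * norm x + norm f * norm x"
        using Cauchy_Schwarz_ineq2[of f x] Cauchy_Schwarz_ineq2[of f "scaleC \<i> x"]
        by (simp add: norm_scaleC)
      finally have "cmod (cinner f x) * norm f \<le> (2 * norm f * norm x) * norm f"
        by (intro mult_right_mono) auto
      then show ?thesis by (simp add: norm_scaleC mult_ac)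
    qed
  qed
  then have "continuous_on UNIV (\<lambda>x::'a. \<Sum>f\<in>F. scaleC (cinner f x) f)"
    by (intro continuous_on_sum linear_continuous_on)
  ultimately show ?thesis by (simp add: closed_Collect_eq)
qed

text \<open>Comparing possibly infinite dimensions thus reduces to transporting finite independent sets.\<close>

lemma enat_le_ecdim_iff:
  "enat n \<le> ecdim S \<longleftrightarrow> (\<exists>B\<subseteq>S. finite B \<and> cindependent B \<and> card B = n)"
proof -
  obtain B0 where B0: "B0 \<subseteq> S" "cindependent B0" "S \<subseteq> cspan B0" "card B0 = cdim S"
    using complex_vector.basis_exists by blast
  have sub: "\<exists>B\<subseteq>S. finite B \<and> cindependent B \<and> card B = n" if "infinite B0 \<or> n \<le> card B0"
  proof -
    have "\<exists>B\<subseteq>B0. finite B \<and> card B = n"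
    proof (cases "finite B0")
      case True
      then show ?thesis using that obtain_subset_with_card_n[of n B0] by blast
    next
      case False
      then show ?thesis using infinite_arbitrarily_large[of B0 n] by blast
    qed
    then obtain B where B: "B \<subseteq> B0" "finite B" "card B = n" by blast
    then show ?thesis using B0(1) complex_vector.independent_mono[OF B0(2) B(1)]
      by (intro exI[of _ B]) auto
  qed
  show ?thesis
  proof (cases "\<exists>B. finite B \<and> S \<subseteq> cspan B")
    case True
    then obtain B1 where B1: "finite B1" "S \<subseteq> cspan B1" by blast
    then have "finite B0"
      using complex_vector.independent_span_bound[OF B1(1) B0(2)] B0(1) by blast
    have le: "card B \<le> card B0" if "B \<subseteq> S" "cindependent B" for B
      using complex_vector.independent_span_bound[OF \<open>finite B0\<close> that(2)] that(1) B0(3) by blast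
    have "ecdim S = enat (card B0)" using True B0(4) by (simp add: ecdim_def)
    then show ?thesis using sub le by auto
  next
    case False
    then have "infinite B0" "ecdim S = \<infinity>" using B0(3) by (auto simp: ecdim_def)
    then show ?thesis using sub by simp
  qed
qed

lemma enat_le_iff_all: "(\<And>n. enat n \<le> a \<Longrightarrow> enat n \<le> b) \<Longrightarrow> a \<le> (b::enat)"
proof (cases b)
  case (enat m)
  assume h: "\<And>n. enat n \<le> a \<Longrightarrow> enat n \<le> b"
  have "\<not> enat (Suc m) \<le> a" using h[of "Suc m"] enat by auto
  then show ?thesis using enat by (cases a) auto
qed simp

lemma ecdim_le_injective:
  assumes S: "csubspace (S :: 'a::complex_vector set)" and f: "\<And>x y. f (x + y) = f x + f y" "\<And>a x. f (scaleC a x) = scaleC a (f x)"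
    and into: "\<And>x. x \<in> S \<Longrightarrow> f x \<in> (T :: 'b::complex_vector set)" and inj: "\<And>x. x \<in> S \<Longrightarrow> f x = 0 \<Longrightarrow> x = 0"
  shows "ecdim S \<le> ecdim T"
proof (rule enat_le_iff_all)
  fix n assume "enat n \<le> ecdim S"
  then obtain B where B: "B \<subseteq> S" "finite B" "cindependent B" "card B = n"
    unfolding enat_le_ecdim_iff by blast
  have lin: "Vector_Spaces.linear scaleC scaleC f" by unfold_locales (use f in auto)
  interpret f: Vector_Spaces.linear scaleC scaleC f by (rule lin)
  have injS: "inj_on f S"
  proof (rule inj_onI)
    fix x y assume "x \<in> S" "y \<in> S" "f x = f y"
    then show "x = y" using inj[of "x - y"] complex_vector.subspace_diff[OF S] f.diff by auto
  qed
  moreover have "cspan B \<subseteq> S" by (rule complex_vector.span_minimal[OF B(1) S])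
  ultimately have "inj_on f (cspan B)" by (rule inj_on_subset)
  then have "cindependent (f ` B)" using f.independent_injective_image[OF B(3)] by (simp add: cspan_def)
  moreover have "card (f ` B) = n" using B injS by (metis card_image inj_on_subset)
  ultimately show "enat n \<le> ecdim T" unfolding enat_le_ecdim_iff
    by (intro exI[of _ "f ` B"]) (use B into in auto)
qed

lemma ecdim_zero_iff:
  assumes "csubspace S" shows "ecdim S = 0 \<longleftrightarrow> S = {0 :: 'a::complex_vector}"
proof
  assume "ecdim S = 0"
  then have n: "\<not> enat 1 \<le> ecdim S" by (simp add: zero_enat_def)
  have "x = 0" if "x \<in> S" for x
  proof (rule ccontr)
    assume "x \<noteq> 0"
    then have "cindependent {x}" by simp
    then have "enat 1 \<le> ecdim S" unfolding enat_le_ecdim_iff using that by (intro exI[of _ "{x}"]) auto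
    then show False using n by simp
  qed
  then show "S = {0}" using complex_vector.subspace_0[OF assms] by blast
next
  assume S: "S = {0}"
  have "\<not> enat 1 \<le> ecdim S"
    unfolding enat_le_ecdim_iff S
  proof
    assume "\<exists>B\<subseteq>{0::'a}. finite B \<and> cindependent B \<and> card B = 1"
    then obtain B :: "'a set" where "B \<subseteq> {0}" "cindependent B" "card B = 1" by blast
    then have "B = {0}" by (metis card.empty subset_singletonD zero_neq_one)
    then show False using \<open>cindependent B\<close> complex_vector.dependent_zero[of B] by blast
  qed
  then show "ecdim S = 0" by (cases "ecdim S") (auto simp: zero_enat_def)
qed

text \<open>An orthonormal subset of maximal size spans, since otherwise it could be enlarged by a
  normalized residual.\<close>

lemma corthon_basis_if_bounded:
  assumes S: "csubspace (S :: 'a::complex_inner set)"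
    and bd: "\<And>B. finite B \<Longrightarrow> corthon B \<Longrightarrow> B \<subseteq> S \<Longrightarrow> card B \<le> n"
  shows "\<exists>B\<subseteq>S. finite B \<and> corthon B \<and> cspan B = S"
proof -
  define Q where "Q k \<longleftrightarrow> (\<exists>B\<subseteq>S. finite B \<and> corthon B \<and> card B = k)" for k
  have "Q 0" unfolding Q_def by (intro exI[of _ "{}"]) (auto simp: corthon_def)
  moreover have "\<forall>k. Q k \<longrightarrow> k \<le> n" using bd unfolding Q_def by blast
  ultimately have "\<exists>k. Q k \<and> (\<forall>j. Q j \<longrightarrow> j \<le> k)" by (rule Nat.ex_has_greatest_nat)
  then obtain k where k: "Q k" "\<forall>j. Q j \<longrightarrow> j \<le> k" by blast
  then obtain B where B: "B \<subseteq> S" "finite B" "corthon B" "card B = k" unfolding Q_def by blast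
  have "x \<in> cspan B" if x: "x \<in> S" for x
  proof (rule ccontr)
    assume nx: "x \<notin> cspan B"
    let ?r = "x - (\<Sum>f\<in>B. scaleC (cinner f x) f)"
    have "?r \<noteq> 0" using nx corthon_expansion_in by (metis eq_iff_diff_eq_0)
    have rS: "?r \<in> S"
      using x B(1) complex_vector.span_minimal[OF B(1) S] corthon_expansion_in
      by (intro complex_vector.subspace_diff[OF S]) auto
    let ?u = "(1 / norm ?r) *\<^sub>R ?r"
    have "corthon (insert ?u B)" "?u \<notin> B"
      using corthon_insert_normalized[OF B(3) \<open>?r \<noteq> 0\<close> corthon_residual[OF B(2,3)]] by auto
    moreover have "?u \<in> S" using rS csubspace_imp_subspace[OF S] subspace_scale by blast
    ultimately have "Q (Suc k)" unfolding Q_def using B by (intro exI[of _ "insert ?u B"]) auto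
    then have "Suc k \<le> k" using k(2)[rule_format, of "Suc k"] by blast
    then show False by simp
  qed
  then show ?thesis using B complex_vector.span_minimal[OF B(1) S] by (intro exI[of _ B]) auto
qed

lemma ecdim_cspan_corthon:
  assumes "finite B" "corthon B" "cspan B = (S :: 'a::complex_inner set)"
  shows "ecdim S = enat (card B)" "cdim S = card B"
proof -
  show "cdim S = card B"
    using complex_vector.dim_eq_card[of B S] corthon_independent[OF assms(2)] assms(3)
    by (metis complex_vector.span_span)
  then show "ecdim S = enat (card B)" using assms by (auto simp: ecdim_def)
qed

lemma is_onb_iff: "is_onb S E \<longleftrightarrow> E \<subseteq> S \<and> S \<subseteq> closure (cspan E) \<and> corthon E"
  by (simp add: is_onb_def corthon_def)

text \<open>A maximal orthonormal subset is total: a vector outside the closure of its span would have a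
  nonzero component orthogonal to it.\<close>

lemma onb_exists:
  fixes S :: "'a::chilbert_space set"
  assumes S: "closed S" "csubspace S"
  shows "\<exists>E. is_onb S E"
proof -
  let ?\<E> = "{E. E \<subseteq> S \<and> corthon E}"
  have "\<exists>M\<in>?\<E>. \<forall>X\<in>?\<E>. M \<subseteq> X \<longrightarrow> X = M"
  proof (rule subset_Zorn)
    fix C assume C: "subset.chain ?\<E> C"
    have "\<Union>C \<in> ?\<E>"
    proof (intro CollectI conjI)
      show "\<Union>C \<subseteq> S" using C by (auto simp: subset.chain_def)
      show "corthon (\<Union>C)" unfolding corthon_def
      proof (intro ballI)
        fix x y assume "x \<in> \<Union>C" "y \<in> \<Union>C"
        then obtain X Y where XY: "X \<in> C" "Y \<in> C" "x \<in> X" "y \<in> Y" by blast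
        have "X \<subseteq> Y \<or> Y \<subseteq> X" using C XY by (auto simp: subset_chain_def)
        then obtain Z where "Z \<in> C" "x \<in> Z" "y \<in> Z" using XY by blast
        moreover have "corthon Z" using C \<open>Z \<in> C\<close> by (auto simp: subset_chain_def)
        ultimately show "cinner x y = (if x = y then 1 else 0)" using corthonD by blast
      qed
    qed
    then show "\<exists>U\<in>?\<E>. \<forall>X\<in>C. X \<subseteq> U" by blast
  qed
  then obtain E where E': "E \<in> ?\<E>" "\<forall>X\<in>?\<E>. E \<subseteq> X \<longrightarrow> X = E" by (elim bexE)
  have E: "E \<subseteq> S" "corthon E" using E'(1) by simp_all
  have max: "X = E" if "X \<subseteq> S" "corthon X" "E \<subseteq> X" for X
    using E'(2)[rule_format, of X] that by simp
  let ?T = "closure (cspan E)"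
  have T: "closed ?T" "csubspace ?T" by (auto intro: csubspace_closure)
  have "x \<in> ?T" if x: "x \<in> S" for x
  proof (rule ccontr)
    assume nx: "x \<notin> ?T"
    let ?r = "x - oproj ?T x"
    have in_T: "oproj ?T x \<in> ?T" by (rule oproj_in[OF T(1) csubspace_imp_subspace[OF T(2)]])
    have "?r \<noteq> 0" using nx in_T by auto
    have "?T \<subseteq> S" using E(1) S by (intro closure_minimal complex_vector.span_minimal) auto
    then have "?r \<in> S" using x in_T complex_vector.subspace_diff[OF S(2)] by blast
    let ?u = "(1 / norm ?r) *\<^sub>R ?r"
    have "e \<in> ?T" if "e \<in> E" for e using that complex_vector.span_base closure_subset by blast
    then have "corthon (insert ?u E)" "?u \<notin> E"
      using corthon_insert_normalized[OF E(2) \<open>?r \<noteq> 0\<close>] oproj_corth'[OF T] by auto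
    moreover have "?u \<in> S" using \<open>?r \<in> S\<close> csubspace_imp_subspace[OF S(2)] subspace_scale by blast
    ultimately show False using max[of "insert ?u E"] E(1) by blast
  qed
  then show ?thesis using E by (auto simp: is_onb_iff)
qed

lemma ecdim_onb:
  assumes "is_onb S E" "csubspace (S :: 'a::complex_inner set)"
  shows "ecdim S = (if finite E then enat (card E) else \<infinity>)"
proof (cases "finite E")
  case True
  have E: "E \<subseteq> S" "S \<subseteq> closure (cspan E)" "corthon E" using assms(1) by (auto simp: is_onb_iff)
  then have "S \<subseteq> cspan E" using closed_cspan_corthon[OF True E(3)] by simp
  then have "cspan E = S" using complex_vector.span_minimal[OF E(1) assms(2)] by blast
  then show ?thesis using ecdim_cspan_corthon[OF True E(3)] True by simp
next
  case False
  have "enat n \<le> ecdim S" for n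
  proof -
    obtain B where "B \<subseteq> E" "finite B" "card B = n" using False by (metis infinite_arbitrarily_large)
    then show ?thesis unfolding enat_le_ecdim_iff
      using assms(1) corthon_independent[OF corthon_subset, of E B]
      by (intro exI[of _ B]) (auto simp: is_onb_iff)
  qed
  then have "\<infinity> \<le> ecdim S" by (rule enat_le_iff_all)
  then show ?thesis using False by simp
qed

text \<open>Orthonormal vectors have distance \<open>sqrt 2\<close> from each other, so that points of a countable
  dense set within distance \<open>1/2\<close> of them are distinct.\<close>

lemma countable_corthon:
  assumes "separable_space (euclidean :: 'a::chilbert_space topology)" "corthon (E :: 'a set)"
  shows "countable E"
proof -
  obtain D :: "'a set" where D: "countable D" "closure D = UNIV"
    using assms(1) by (auto simp: separable_space_def)
  have "\<exists>d\<in>D. dist d x < 1/2" for x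
    using D(2) closure_approachable[of x D] by (metis UNIV_I half_gt_zero zero_less_one)
  then obtain d where d: "\<And>x. d x \<in> D" "\<And>x. dist (d x) x < 1/2" by metis
  have "inj_on d E"
  proof (rule inj_onI, rule ccontr)
    fix x y assume xy: "x \<in> E" "y \<in> E" "d x = d y" "x \<noteq> y"
    have "x \<bullet> y = 0" using orthonD[OF corthon_imp_orthon[OF assms(2)] xy(1,2)] xy(4) by simp
    then have "(norm (x - y))\<^sup>2 = 2"
      using corthon_norm[OF assms(2)] xy by (simp add: power2_norm_diff)
    moreover have "norm (x - y) < 1"
      using dist_triangle_half_l[of x "d x" 1 y] d(2)[of x] d(2)[of y] xy(3)
      by (simp add: dist_commute dist_norm)
    ultimately show False using power_le_one[of "norm (x - y)" 2] by simp
  qed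
  then show ?thesis using D(1) d(1) by (meson countable_image_inj_on countable_subset image_subsetI)
qed

text \<open>By Parseval's identity the linear extension of \<open>g\<close> to the span of \<open>E\<close> is isometric. It extends
  by uniform continuity to \<open>S\<close>, and then to the whole space by composition with the projection
  to \<open>S\<close>.\<close>

lemma isometric_extension:
  fixes S :: "'a::chilbert_space set"
  assumes S: "closed S" "csubspace S" and E: "is_onb S E"
    and g: "corthon (g ` E)" "inj_on g E"
  shows "\<exists>T. clinear_op T \<and> (\<forall>e\<in>E. T e = g e) \<and> (\<forall>x\<in>S. norm (T x) = norm x)"
proof -
  have ES: "E \<subseteq> S" "S \<subseteq> closure (cspan E)" "corthon E" using E by (auto simp: is_onb_iff)
  have clS: "closure (cspan E) = S"
    using ES S by (intro antisym closure_minimal complex_vector.span_minimal) auto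
  define f where "f = cpair.construct E g"
  have indE: "cindependent E" by (rule corthon_independent[OF ES(3)])
  have f: "Vector_Spaces.linear scaleC scaleC f" "\<And>e. e \<in> E \<Longrightarrow> f e = g e"
    unfolding f_def using cpair.linear_construct[OF indE] cpair.construct_basis[OF indE] by blast+
  interpret f: Vector_Spaces.linear scaleC scaleC f by (rule f(1))
  have iso: "norm (f x) = norm x" if xE: "x \<in> cspan E" for x
  proof -
    obtain t r where t: "finite t" "t \<subseteq> E" "x = (\<Sum>a\<in>t. scaleC (r a) a)"
      using xE unfolding complex_vector.span_explicit by blast
    have xt: "x \<in> cspan t" unfolding t(3)
      by (intro complex_vector.span_sum complex_vector.span_scale complex_vector.span_base)
    have ct: "corthon t" by (rule corthon_subset[OF ES(3) t(2)])
    have cg: "corthon (g ` t)" "inj_on g t" using g t(2) by (auto intro: corthon_subset inj_on_subset)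
    have fx: "f x = (\<Sum>a\<in>t. scaleC (cinner a x) (g a))"
      using arg_cong[OF corthon_expansion[OF t(1) ct xt], of f] t(2)
      by (simp add: f.sum f.scale f(2) subset_iff)
    have cf: "cinner (g b) (f x) = cinner b x" if "b \<in> t" for b
    proof -
      have "cinner (g b) (f x) = (\<Sum>a\<in>t. if b = a then cinner a x else 0)"
        unfolding fx cinner_sum_right
        by (rule sum.cong) (use corthonD[OF cg(1), of "g b"] that inj_on_eq_iff[OF cg(2)] in \<open>auto simp: cinner_simps\<close>)
      then show ?thesis using that t(1) by simp
    qed
    have fin: "finite (g ` t)" using t(1) by simp
    have "f x \<in> cspan (g ` t)" unfolding fx
      by (intro complex_vector.span_sum complex_vector.span_scale complex_vector.span_base) auto
    then have "(norm (f x))\<^sup>2 = (\<Sum>h\<in>g`t. (cmod (cinner h (f x)))\<^sup>2)"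
      using corthon_norm_expansion[OF fin cg(1), of "f x"] corthon_expansion[OF fin cg(1), of "f x"] by simp
    also have "\<dots> = (\<Sum>b\<in>t. (cmod (cinner b x))\<^sup>2)"
      using cf by (simp add: sum.reindex[OF cg(2)])
    also have "\<dots> = (norm x)\<^sup>2"
      using corthon_norm_expansion[OF t(1) ct, of x] corthon_expansion[OF t(1) ct xt] by simp
    finally show ?thesis by (simp add: power2_eq_iff_nonneg)
  qed
  have "uniformly_continuous_on (cspan E) f"
    unfolding uniformly_continuous_on_def
  proof (intro allI impI)
    fix e :: real assume "e > 0"
    have "dist (f x') (f x) = dist x' x" if "x \<in> cspan E" "x' \<in> cspan E" for x x'
      using iso[OF complex_vector.span_diff[OF that(2,1)]] by (simp add: dist_norm f.diff)
    then show "\<exists>d>0. \<forall>x\<in>cspan E. \<forall>x'\<in>cspan E. dist x' x < d \<longrightarrow> dist (f x') (f x) < e"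
      using \<open>e > 0\<close> by (intro exI[of _ e]) auto
  qed
  then obtain h where h: "uniformly_continuous_on (closure (cspan E)) h" "\<And>x. x \<in> cspan E \<Longrightarrow> f x = h x"
    by (rule uniformly_continuous_on_extension_on_closure) blast
  have contS: "continuous_on S h" using h(1) clS uniformly_continuous_imp_continuous by auto
  have cont_seq: "(\<lambda>n. h (Z n)) \<longlonglongrightarrow> h a" if "\<And>n. Z n \<in> S" "Z \<longlonglongrightarrow> a" "a \<in> S" for Z a
    using contS[unfolded continuous_on_sequentially, rule_format, of a Z] that by (simp add: comp_def)
  have lim: "\<exists>X. (\<forall>n. X n \<in> cspan E) \<and> X \<longlonglongrightarrow> x \<and> (\<lambda>n. f (X n)) \<longlonglongrightarrow> h x" if xS: "x \<in> S" for x
  proof -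
    obtain X where X: "\<forall>n. X n \<in> cspan E" "X \<longlonglongrightarrow> x" using xS clS closure_sequential by blast
    have "X n \<in> S" for n using X(1) clS closure_subset by blast
    then have "(\<lambda>n. h (X n)) \<longlonglongrightarrow> h x"
      by (rule cont_seq[OF _ X(2) xS])
    then show ?thesis using X h(2) by auto
  qed
  have isoh: "norm (h x) = norm x" if xS: "x \<in> S" for x
  proof -
    obtain X where X: "\<And>n. X n \<in> cspan E" "X \<longlonglongrightarrow> x" "(\<lambda>n. f (X n)) \<longlonglongrightarrow> h x"
      using lim[OF xS] by blast
    then have "(\<lambda>n. norm (X n)) \<longlonglongrightarrow> norm (h x)" using tendsto_norm[OF X(3)] iso X(1) by simp
    then show ?thesis using tendsto_norm[OF X(2)] LIMSEQ_unique by blast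
  qed
  have addh: "h (x + y) = h x + h y" if xy: "x \<in> S" "y \<in> S" for x y
  proof -
    obtain X where X: "\<And>n. X n \<in> cspan E" "X \<longlonglongrightarrow> x" "(\<lambda>n. f (X n)) \<longlonglongrightarrow> h x" using lim[OF xy(1)] by blast
    obtain Y where Y: "\<And>n. Y n \<in> cspan E" "Y \<longlonglongrightarrow> y" "(\<lambda>n. f (Y n)) \<longlonglongrightarrow> h y" using lim[OF xy(2)] by blast
    have Z: "X n + Y n \<in> cspan E" for n using X Y complex_vector.span_add by blast
    then have ZS: "X n + Y n \<in> S" for n using clS closure_subset by blast
    have xyS: "x + y \<in> S" using xy complex_vector.subspace_add[OF S(2)] by blast
    have "(\<lambda>n. X n + Y n) \<longlonglongrightarrow> x + y" by (intro tendsto_add X Y)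
    then have "(\<lambda>n. h (X n + Y n)) \<longlonglongrightarrow> h (x + y)"
      by (rule cont_seq[OF ZS _ xyS])
    moreover have "h (X n + Y n) = f (X n) + f (Y n)" for n using h(2)[OF Z] f.add by metis
    ultimately show ?thesis using tendsto_add[OF X(3) Y(3)] LIMSEQ_unique by simp
  qed
  have sch: "h (scaleC a x) = scaleC a (h x)" if x: "x \<in> S" for a x
  proof -
    obtain X where X: "\<And>n. X n \<in> cspan E" "X \<longlonglongrightarrow> x" "(\<lambda>n. f (X n)) \<longlonglongrightarrow> h x" using lim[OF x] by blast
    have Z: "scaleC a (X n) \<in> cspan E" for n using X complex_vector.span_scale by blast
    then have ZS: "scaleC a (X n) \<in> S" for n using clS closure_subset by blast
    have xS: "scaleC a x \<in> S" using x complex_vector.subspace_scale[OF S(2)] by blast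
    have "(\<lambda>n. scaleC a (X n)) \<longlonglongrightarrow> scaleC a x" by (rule bounded_linear.tendsto[OF bounded_linear_scaleC X(2)])
    then have "(\<lambda>n. h (scaleC a (X n))) \<longlonglongrightarrow> h (scaleC a x)"
      by (rule cont_seq[OF ZS _ xS])
    moreover have "h (scaleC a (X n)) = scaleC a (f (X n))" for n using h(2)[OF Z] f.scale by metis
    ultimately show ?thesis
      using bounded_linear.tendsto[OF bounded_linear_scaleC X(3), of a] LIMSEQ_unique by simp
  qed
  have rS: "subspace S" by (rule csubspace_imp_subspace[OF S(2)])
  have pS: "oproj S x \<in> S" for x by (rule oproj_in[OF S(1) rS])
  have "bounded_linear (\<lambda>x. h (oproj S x))"
  proof (rule bounded_linear_intro[where K=1])
    show "h (oproj S (x + y)) = h (oproj S x) + h (oproj S y)" for x y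
      by (simp add: blin_simps addh pS)
    show "h (oproj S (r *\<^sub>R x)) = r *\<^sub>R h (oproj S x)" for r x
      using sch[OF pS, of "complex_of_real r" x] by (simp add: blin_simps scaleC_of_real)
    show "norm (h (oproj S x)) \<le> norm x * 1" for x
      using isoh[OF pS] norm_oproj_le[OF S(1) rS] by simp
  qed
  then have T: "Blinfun (\<lambda>x. h (oproj S x)) x = h (oproj S x)" for x by (simp add: bounded_linear_Blinfun_apply)
  show ?thesis
  proof (intro exI[of _ "Blinfun (\<lambda>x. h (oproj S x))"] conjI ballI)
    show "clinear_op (Blinfun (\<lambda>x. h (oproj S x)))"
      unfolding clinear_op_def T clinear_opD[OF clinear_op_oproj[OF S]] using sch pS by blast
    show "Blinfun (\<lambda>x. h (oproj S x)) e = g e" if "e \<in> E" for e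
    proof -
      have "oproj S e = e" using oproj_id[OF S(1) rS] ES(1) that by blast
      moreover have "e \<in> cspan E" using that by (rule complex_vector.span_base)
      ultimately show ?thesis unfolding T using h(2) f(2)[OF that] by metis
    qed
    show "norm (Blinfun (\<lambda>x. h (oproj S x)) x) = norm x" if "x \<in> S" for x
      unfolding T using oproj_id[OF S(1) rS that] isoh[OF that] by simp
  qed
qed


text \<open>Sums over a complex orthonormal basis of \<open>S\<close> and the bounds \<open>hs_le\<close> determine each other up
  to the factor \<open>sqrt 2\<close>: a complex orthonormal set is orthonormal for the real inner product,
  whereas a complex basis vector \<open>e\<close> stands for the real pair \<open>e\<close>, \<open>\<i> e\<close>. In particular the
  choice of the basis does not matter for summability.\<close>

lemma hs_le_onb_sum:
  fixes S :: "'a::chilbert_space set"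
  assumes S: "closed S" "csubspace S" and A: "hs_le (A \<odot> oproj S) C" and E: "is_onb S E"
  shows "(\<lambda>e. (norm (A e))\<^sup>2) summable_on E" "(\<Sum>\<^sub>\<infinity>e\<in>E. (norm (A e))\<^sup>2) \<le> C\<^sup>2"
proof -
  have bd: "(\<Sum>e\<in>F. (norm (A e))\<^sup>2) \<le> C\<^sup>2" if F: "finite F" "F \<subseteq> E" for F
  proof -
    have "corthon F" using E F by (auto simp: is_onb_iff intro: corthon_subset)
    then have "(\<Sum>e\<in>F. (norm ((A \<odot> oproj S) e))\<^sup>2) \<le> C\<^sup>2"
      using A F(1) corthon_imp_orthon unfolding hs_le_iff by blast
    moreover have "(A \<odot> oproj S) e = A e" if "e \<in> F" for e
      using oproj_id[OF S(1) csubspace_imp_subspace[OF S(2)], of e] that F E by (auto simp: is_onb_iff)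
    ultimately show ?thesis by simp
  qed
  show sm: "(\<lambda>e. (norm (A e))\<^sup>2) summable_on E"
    by (rule nonneg_bounded_partial_sums_imp_summable_on[where C="C\<^sup>2"])
       (auto intro: eventually_finite_subsets_at_top_weakI bd)
  show "(\<Sum>\<^sub>\<infinity>e\<in>E. (norm (A e))\<^sup>2) \<le> C\<^sup>2" using infsum_le_finite_sums[OF sm bd] by blast
qed

lemma chosen_onb:
  fixes S :: "'a::chilbert_space set"
  assumes "closed S" "csubspace S"
  shows "is_onb S (SOME E. is_onb S E)"
  using onb_exists[OF assms] by (rule someI_ex)

lemma hs_norm_on_nonneg: "0 \<le> hs_norm_on S A"
  unfolding hs_norm_on_def by (intro real_sqrt_ge_zero infsum_nonneg) auto

lemma hs_norm_on_le:
  fixes S :: "'a::chilbert_space set"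
  assumes S: "closed S" "csubspace S" and A: "hs_le (A \<odot> oproj S) C"
  shows "hs_norm_on S A \<le> C"
  unfolding hs_norm_on_def
  using hs_le_onb_sum(2)[OF S A chosen_onb[OF S]] hs_le_nonneg[OF A]
  by (intro real_le_lsqrt infsum_nonneg) auto

text \<open>An approximate Parseval identity that persists for all larger finite subsets of \<open>E\<close>, and can
  therefore be used for several vectors \<open>y\<close> with one finite subset.\<close>

lemma corthon_dense_norm_approx:
  assumes E: "corthon E" and y: "y \<in> closure (cspan E)" and d: "d > 0"
  shows "\<exists>E0\<subseteq>E. finite E0 \<and> (\<forall>E'. finite E' \<longrightarrow> E0 \<subseteq> E' \<longrightarrow> E' \<subseteq> E \<longrightarrow>
    (norm y)\<^sup>2 \<le> (\<Sum>e\<in>E'. (cmod (cinner e y))\<^sup>2) + d)"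
proof -
  obtain z where z: "z \<in> cspan E" "dist z y < sqrt d"
    using y d closure_approachable by (metis real_sqrt_gt_0_iff)
  obtain E0 r where E0: "finite E0" "E0 \<subseteq> E" "z = (\<Sum>a\<in>E0. scaleC (r a) a)"
    using z(1) unfolding complex_vector.span_explicit by blast
  have "(norm y)\<^sup>2 \<le> (\<Sum>e\<in>E'. (cmod (cinner e y))\<^sup>2) + d" if E': "finite E'" "E0 \<subseteq> E'" "E' \<subseteq> E" for E'
  proof -
    have c: "corthon E'" by (rule corthon_subset[OF E E'(3)])
    let ?p = "\<Sum>e\<in>E'. scaleC (cinner e y) e"
    have zE: "z \<in> cspan E'" unfolding E0(3)
      by (intro complex_vector.span_sum complex_vector.span_scale complex_vector.span_base) (use E' in auto)
    have "cinner (y - ?p) (?p - z) = 0"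
      by (rule cspan_corth[of E'])
         (use corthon_residual[OF E'(1) c] complex_vector.span_diff[OF corthon_expansion_in zE] in auto)
    then have "(y - ?p) \<bullet> (?p - z) = 0" by (metis Re_cinner zero_complex.simps(1))
    then have "(norm (y - z))\<^sup>2 = (norm (y - ?p))\<^sup>2 + (norm (?p - z))\<^sup>2"
      using power2_norm_add[of "y - ?p" "?p - z"] by simp
    moreover have "(norm (y - z))\<^sup>2 \<le> (sqrt d)\<^sup>2"
      using z(2) by (intro power_mono) (auto simp: dist_norm norm_minus_commute)
    ultimately have "(norm (y - ?p))\<^sup>2 \<le> d" using d zero_le_power2[of "norm (?p - z)"] real_sqrt_pow2[of d] by linarith
    then show ?thesis using corthon_norm_expansion[OF E'(1) c, of y] by simp
  qed
  then show ?thesis using E0 by blast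
qed

text \<open>The adjoint is estimated first. Its values lie in \<open>S\<close> and are tested against finitely many
  basis vectors \<open>e\<close>; for each of them Bessel's inequality bounds the sum over the real orthonormal
  set \<open>F\<close> by \<open>2 * (norm (A e))\<^sup>2\<close>.\<close>

lemma hs_le_if_summable:
  fixes S :: "'a::chilbert_space set"
  assumes S: "closed S" "csubspace S" and A: "clinear_op A" and E: "is_onb S E"
    and sm: "(\<lambda>e. (norm (A e))\<^sup>2) summable_on E"
  shows "hs_le (A \<odot> oproj S) (sqrt 2 * sqrt (\<Sum>\<^sub>\<infinity>e\<in>E. (norm (A e))\<^sup>2))"
proof -
  let ?s = "\<Sum>\<^sub>\<infinity>e\<in>E. (norm (A e))\<^sup>2"
  let ?M = "A \<odot> oproj S"
  have rS: "subspace S" by (rule csubspace_imp_subspace[OF S(2)])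
  have ES: "E \<subseteq> S" "S \<subseteq> closure (cspan E)" "corthon E" using E by (auto simp: is_onb_iff)
  have s0: "?s \<ge> 0" by (rule infsum_nonneg) auto
  have fin: "(\<Sum>e\<in>E'. (norm (A e))\<^sup>2) \<le> ?s" if "finite E'" "E' \<subseteq> E" for E'
    by (rule finite_sum_le_infsum[OF sm that]) auto
  have "hs_le (?M\<^sup>\<dagger>) (sqrt 2 * sqrt ?s)"
    unfolding hs_le_iff
  proof (intro conjI allI impI)
    show "0 \<le> sqrt 2 * sqrt ?s" using s0 by simp
    fix F :: "'a set" assume F: "finite F" "orthon F"
    have adjM: "?M\<^sup>\<dagger> f = oproj S (A\<^sup>\<dagger> f)" for f by (simp add: adj_compose adj_oproj[OF S(1) rS])
    have bound: "(\<Sum>f\<in>F. (norm (?M\<^sup>\<dagger> f))\<^sup>2) \<le> 2 * ?s + real (card F) * d" if d: "d > 0" for d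
    proof -
      have "?M\<^sup>\<dagger> f \<in> closure (cspan E)" for f unfolding adjM using oproj_in[OF S(1) rS] ES(2) by blast
      then have "\<forall>f. \<exists>E0\<subseteq>E. finite E0 \<and> (\<forall>E'. finite E' \<longrightarrow> E0 \<subseteq> E' \<longrightarrow> E' \<subseteq> E \<longrightarrow>
        (norm (?M\<^sup>\<dagger> f))\<^sup>2 \<le> (\<Sum>e\<in>E'. (cmod (cinner e (?M\<^sup>\<dagger> f)))\<^sup>2) + d)"
        using corthon_dense_norm_approx[OF ES(3) _ d] by blast
      then obtain E0 where E0: "\<And>f. E0 f \<subseteq> E" "\<And>f. finite (E0 f)"
        "\<And>f E'. finite E' \<Longrightarrow> E0 f \<subseteq> E' \<Longrightarrow> E' \<subseteq> E \<Longrightarrow>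
          (norm (?M\<^sup>\<dagger> f))\<^sup>2 \<le> (\<Sum>e\<in>E'. (cmod (cinner e (?M\<^sup>\<dagger> f)))\<^sup>2) + d"
        by metis
      define E' where "E' = (\<Union>f\<in>F. E0 f)"
      have E': "finite E'" "E' \<subseteq> E" using F E0 by (auto simp: E'_def)
      have cf: "(cmod (cinner e (?M\<^sup>\<dagger> f)))\<^sup>2 = (f \<bullet> A e)\<^sup>2 + (f \<bullet> scaleC \<i> (A e))\<^sup>2" if "e \<in> E'" for e f
      proof -
        have "cinner e (A\<^sup>\<dagger> f - oproj S (A\<^sup>\<dagger> f)) = 0" using oproj_corth'[OF S] that E' ES(1) by blast
        then have "cinner e (?M\<^sup>\<dagger> f) = cinner (A e) f"
          unfolding adjM using cinner_adj_right[OF A] by (simp add: cinner_simps)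
        also have "cmod \<dots> = cmod (cinner f (A e))" by (metis cinner_commute complex_mod_cnj)
        finally show ?thesis by (simp add: cmod_power2 Re_cinner Im_cinner)
      qed
      have "(\<Sum>f\<in>F. (norm (?M\<^sup>\<dagger> f))\<^sup>2) \<le> (\<Sum>f\<in>F. (\<Sum>e\<in>E'. (cmod (cinner e (?M\<^sup>\<dagger> f)))\<^sup>2) + d)"
        by (intro sum_mono E0(3) E') (auto simp: E'_def)
      also have "\<dots> = (\<Sum>e\<in>E'. (\<Sum>f\<in>F. (f \<bullet> A e)\<^sup>2) + (\<Sum>f\<in>F. (f \<bullet> scaleC \<i> (A e))\<^sup>2)) + real (card F) * d"
        by (simp add: sum.distrib cf sum.swap[of _ E' F])
      also have "\<dots> \<le> (\<Sum>e\<in>E'. (norm (A e))\<^sup>2 + (norm (scaleC \<i> (A e)))\<^sup>2) + real (card F) * d"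
        by (intro add_right_mono sum_mono add_mono bessel_inequality F)
      also have "\<dots> = 2 * (\<Sum>e\<in>E'. (norm (A e))\<^sup>2) + real (card F) * d"
        by (simp add: norm_scaleC sum_distrib_left)
      also have "\<dots> \<le> 2 * ?s + real (card F) * d" using fin[OF E'] by simp
      finally show ?thesis .
    qed
    have "(\<Sum>f\<in>F. (norm (?M\<^sup>\<dagger> f))\<^sup>2) \<le> 2 * ?s"
    proof (rule field_le_epsilon)
      fix e :: real assume "e > 0"
      have "real (card F) * (e / (real (card F) + 1)) \<le> e" using \<open>e > 0\<close> by (simp add: field_simps)
      then show "(\<Sum>f\<in>F. (norm (?M\<^sup>\<dagger> f))\<^sup>2) \<le> 2 * ?s + e"
        using bound[of "e / (real (card F) + 1)"] \<open>e > 0\<close> by (simp add: add_pos_pos)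
    qed
    then show "(\<Sum>f\<in>F. (norm (?M\<^sup>\<dagger> f))\<^sup>2) \<le> (sqrt 2 * sqrt ?s)\<^sup>2"
      using s0 by (simp add: power_mult_distrib)
  qed
  then show ?thesis using hs_le_adj by fastforce
qed

lemma hilbert_schmidt_on_iff:
  fixes S :: "'a::chilbert_space set"
  assumes S: "closed S" "csubspace S" and A: "clinear_op A"
  shows "hilbert_schmidt_on S A \<longleftrightarrow> is_hs (A \<odot> oproj S)"
  using hs_le_if_summable[OF S A] hs_le_onb_sum(1)[OF S] onb_exists[OF S]
  unfolding is_hs_def hilbert_schmidt_on_def by blast

lemma hs_le_hs_norm_on:
  fixes S :: "'a::chilbert_space set"
  assumes S: "closed S" "csubspace S" and A: "clinear_op A" and hs: "is_hs (A \<odot> oproj S)"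
  shows "hs_le (A \<odot> oproj S) (sqrt 2 * hs_norm_on S A)"
  using hs hs_le_onb_sum(1)[OF S _ chosen_onb[OF S]]
  unfolding hs_norm_on_def is_hs_def by (blast intro: hs_le_if_summable[OF S A chosen_onb[OF S]])

lemma hs_norm_on_triangle:
  fixes S :: "'a::chilbert_space set"
  assumes S: "closed S" "csubspace S" and hs: "is_hs (A \<odot> oproj S)" "is_hs (B \<odot> oproj S)"
  shows "hs_norm_on S (A + B) \<le> hs_norm_on S A + hs_norm_on S B"
proof -
  let ?E = "SOME E. is_onb S E"
  have sm: "(\<lambda>e. (norm (C e))\<^sup>2) summable_on ?E" if "is_hs (C \<odot> oproj S)" for C :: "'a \<Rightarrow>\<^sub>L 'a"
    using that hs_le_onb_sum(1)[OF S _ chosen_onb[OF S]] unfolding is_hs_def by blast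
  have fin: "L2_set (\<lambda>e. norm (C e)) F \<le> hs_norm_on S C"
    if "is_hs (C \<odot> oproj S)" "finite F" "F \<subseteq> ?E" for C :: "'a \<Rightarrow>\<^sub>L 'a" and F
    unfolding L2_set_def hs_norm_on_def
    by (rule real_sqrt_le_mono) (rule finite_sum_le_infsum[OF sm[OF that(1)] that(2,3)], auto)
  have hsAB: "is_hs ((A + B) \<odot> oproj S)" using is_hs_add[OF hs] by (simp add: bmul_distribs)
  have "(\<Sum>e\<in>F. (norm ((A + B) e))\<^sup>2) \<le> (hs_norm_on S A + hs_norm_on S B)\<^sup>2"
    if F: "finite F" "F \<subseteq> ?E" for F
  proof -
    have "L2_set (\<lambda>e. norm ((A + B) e)) F \<le> L2_set (\<lambda>e. norm (A e) + norm (B e)) F"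
      by (rule L2_set_mono) (auto simp: blin_simps norm_triangle_ineq)
    also have "\<dots> \<le> L2_set (\<lambda>e. norm (A e)) F + L2_set (\<lambda>e. norm (B e)) F" by (rule L2_set_triangle_ineq)
    also have "\<dots> \<le> hs_norm_on S A + hs_norm_on S B" by (intro add_mono fin hs F)
    finally show ?thesis unfolding L2_set_def by (rule sqrt_le_D)
  qed
  then have "(\<Sum>\<^sub>\<infinity>e\<in>?E. (norm ((A + B) e))\<^sup>2) \<le> (hs_norm_on S A + hs_norm_on S B)\<^sup>2"
    by (rule infsum_le_finite_sums[OF sm[OF hsAB]])
  then show ?thesis unfolding hs_norm_on_def[of S "A + B"]
    by (intro real_le_lsqrt infsum_nonneg add_nonneg_nonneg hs_norm_on_nonneg) auto
qed

lemma hs_norm_on_minus: "hs_norm_on S (- A) = hs_norm_on S A"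
  by (simp add: hs_norm_on_def blin_simps)


section \<open>Bogoliubov operators and their metric\<close>

locale basis_projection_setting =
  fixes J :: "'a::chilbert_space \<Rightarrow> 'a" and P :: "'a \<Rightarrow>\<^sub>L 'a"
  assumes conj: "conjugation J" and bp: "basis_projection J P"
begin

lemma J_add: "J (x + y) = J x + J y" and J_scaleC: "J (scaleC a x) = scaleC (cnj a) (J x)"
  and cinner_J_J: "cinner (J x) (J y) = cnj (cinner x y)" and J_J [simp]: "J (J x) = x"
  using conj by (auto simp: conjugation_def)

lemma J_scaleR: "J (r *\<^sub>R x) = r *\<^sub>R J x"
  by (metis J_scaleC complex_cnj_complex_of_real scaleC_of_real)

lemma J_zero [simp]: "J 0 = 0" using J_scaleR[of 0 0] by simp

lemma J_minus: "J (- x) = - J x" using J_scaleR[of "-1" x] by simp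

lemma J_diff: "J (x - y) = J x - J y" by (metis J_add J_minus diff_conv_add_uminus)

lemma inner_J_J: "J x \<bullet> J y = x \<bullet> y"
  by (simp add: Re_cinner[symmetric] cinner_J_J)

lemma inner_J_left: "J x \<bullet> y = x \<bullet> J y" by (metis J_J inner_J_J)

lemma norm_J [simp]: "norm (J x) = norm x" by (simp add: norm_eq_sqrt_inner inner_J_J)

lemma J_eq_zero_iff [simp]: "J x = 0 \<longleftrightarrow> x = 0" by (metis norm_J norm_eq_zero)

lemma cinner_J_sym: "cinner (J x) y = cinner (J y) x"
  by (metis J_J cinner_J_J cinner_commute)

lemma bounded_linear_J: "bounded_linear J"
  by (rule bounded_linear_intro[where K=1]) (auto simp: J_add J_scaleR)

definition Jop :: "'a \<Rightarrow>\<^sub>L 'a" where "Jop = Blinfun J"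

lemma Jop_apply [simp]: "Jop x = J x"
  by (simp add: Jop_def bounded_linear_J bounded_linear_Blinfun_apply)

lemma norm_Jop_le: "norm Jop \<le> 1"
  by (rule norm_blinfun_bound) auto

text \<open>The complex-linear operators that commute with the conjugation are the complexifications of
  operators on the real Hilbert space of fixed points of \<open>J\<close>. They form a real algebra that is
  closed under adjoints and inverses, and Bogoliubov operators are its isometries.\<close>

definition rop :: "('a \<Rightarrow>\<^sub>L 'a) \<Rightarrow> bool" where
  "rop A \<longleftrightarrow> clinear_op A \<and> (\<forall>x. A (J x) = J (A x))"

lemma rop_J: "rop A \<Longrightarrow> A (J x) = J (blinfun_apply A x)" by (simp add: rop_def)
lemma rop_clinear: "rop A \<Longrightarrow> clinear_op A" by (simp add: rop_def)

lemma ropI: "(\<And>a x. blinfun_apply A (scaleC a x) = scaleC a (blinfun_apply A x)) \<Longrightarrow>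
    (\<And>x. blinfun_apply A (J x) = J (blinfun_apply A x)) \<Longrightarrow> rop A"
  by (simp add: rop_def clinear_op_def)

lemma rop_scaleC: "rop A \<Longrightarrow> A (scaleC a x) = scaleC a (blinfun_apply A x)"
  by (simp add: rop_def clinear_op_def)

lemma conj_op_eq_iff: "conj_op J A = A \<longleftrightarrow> (\<forall>x. A (J x) = J (blinfun_apply A x))"
proof
  assume "conj_op J A = A"
  then have "J (A (J (J x))) = A (J x)" for x by (metis conj_op_apply[OF conj])
  then show "\<forall>x. A (J x) = J (A x)" by simp
next
  assume "\<forall>x. A (J x) = J (A x)"
  then show "conj_op J A = A" by (intro blinfun_eqI) (simp add: conj_op_apply[OF conj])
qed

text \<open>In this form the property passes to a square root by way of \<open>operator_square_root\<close>.\<close>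

lemma rop_commute_iff:
  "rop A \<longleftrightarrow> (\<forall>a. A \<odot> scaleC_op a = scaleC_op a \<odot> A) \<and> A \<odot> Jop = Jop \<odot> A"
proof
  assume "rop A"
  then show "(\<forall>a. A \<odot> scaleC_op a = scaleC_op a \<odot> A) \<and> A \<odot> Jop = Jop \<odot> A"
    by (auto intro!: blinfun_eqI simp: rop_J rop_scaleC)
next
  assume h: "(\<forall>a. A \<odot> scaleC_op a = scaleC_op a \<odot> A) \<and> A \<odot> Jop = Jop \<odot> A"
  show "rop A"
  proof (rule ropI)
    show "A (scaleC a x) = scaleC a (A x)" for a x
      using h by (metis blinfun_apply_blinfun_compose scaleC_op_apply)
    show "A (J x) = J (A x)" for x using h by (metis blinfun_apply_blinfun_compose Jop_apply)
  qed
qed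

lemma rop_id: "rop id_blinfun" by (rule ropI) auto
lemma rop_zero: "rop 0" by (rule ropI) auto
lemma rop_add: "rop A \<Longrightarrow> rop B \<Longrightarrow> rop (A + B)"
  by (rule ropI) (auto simp: blin_simps rop_J rop_scaleC J_add scaleC_add_right)
lemma rop_minus: "rop A \<Longrightarrow> rop (- A)"
  by (rule ropI) (auto simp: blin_simps rop_J rop_scaleC J_minus)
lemma rop_diff: "rop A \<Longrightarrow> rop B \<Longrightarrow> rop (A - B)"
  using rop_add[of A "- B"] rop_minus[of B] by simp
lemma rop_compose: "rop A \<Longrightarrow> rop B \<Longrightarrow> rop (A \<odot> B)"
  by (rule ropI) (auto simp: rop_J rop_scaleC)
lemma rop_scaleR: "rop A \<Longrightarrow> rop (r *\<^sub>R A)"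
  by (rule ropI, simp add: blin_simps rop_scaleC scaleC_of_real[symmetric] scaleC_scaleC mult.commute,
      simp add: blin_simps rop_J J_scaleR)

lemma rop_adj:
  assumes "rop A" shows "rop (A\<^sup>\<dagger>)"
  unfolding rop_def
proof (intro conjI allI)
  show "clinear_op (A\<^sup>\<dagger>)" using assms by (intro clinear_op_adj rop_clinear)
  fix x
  have "A\<^sup>\<dagger> (J x) \<bullet> y = J (A\<^sup>\<dagger> x) \<bullet> y" for y
    by (simp add: adj_left inner_J_left rop_J[OF assms, symmetric])
  then show "A\<^sup>\<dagger> (J x) = J (A\<^sup>\<dagger> x)" using vector_eq_rdot[of "A\<^sup>\<dagger> (J x)" "J (A\<^sup>\<dagger> x)"] by blast
qed

lemma rop_inverse:
  assumes "rop A" "G \<odot> A = id_blinfun" "A \<odot> G = id_blinfun"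
  shows "rop G"
proof -
  have GA: "G (A x) = x" "A (G x) = x" for x
    using assms(2,3) by (metis blinfun_apply_blinfun_compose blinfun_apply_id_blinfun id_apply)+
  show ?thesis
    by (rule ropI) (metis GA rop_scaleC[OF assms(1)], metis GA rop_J[OF assms(1)])
qed

lemmas rop_intros = rop_id rop_zero rop_add rop_minus rop_diff rop_compose rop_scaleR rop_adj

abbreviation Q :: "'a \<Rightarrow>\<^sub>L 'a" where "Q \<equiv> id_blinfun - P"

lemma clinear_P: "clinear_op P" using bp by (simp add: basis_projection_def)

lemma P_scaleC: "P (scaleC a x) = scaleC a (P x)" using clinear_P by (simp add: clinear_op_def)

lemma PP [simp]: "P (P x) = P x"
  using bp by (metis basis_projection_def blinfun_apply_blinfun_compose)

lemma adj_P [simp]: "P\<^sup>\<dagger> = P"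
  using bp cadjoint_eq_adj[OF clinear_P] by (simp add: basis_projection_def)

lemma P_J_P: "P x + J (P (J x)) = x"
proof -
  have "(P + conj_op J P) x = x" using bp by (simp add: basis_projection_def)
  then show ?thesis by (simp add: blin_simps conj_op_apply[OF conj])
qed

lemma P_J: "P (J x) = J (Q x)"
proof -
  have "Q x = J (P (J x))" using P_J_P[of x] by (simp add: blin_simps algebra_simps)
  then show ?thesis by simp
qed

lemma J_P: "J (P x) = Q (J x)"
  using P_J[of "J x"] by simp

lemma Q_J: "Q (J x) = J (P x)" by (simp only: J_P)

lemma PQ [simp]: "P (x - P x) = 0" by (simp add: blin_simps)

lemma QQ: "Q (Q x) = Q x" "P (Q x) = 0" "Q (P x) = 0" by (simp_all add: blin_simps)

lemma adj_Q [simp]: "Q\<^sup>\<dagger> = Q" by (simp add: adj_simps)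

lemma clinear_Q: "clinear_op Q"
  by (simp add: clinear_op_def blin_simps P_scaleC complex_vector.scale_right_diff_distrib)

lemma inner_P: "P x \<bullet> y = x \<bullet> P y" using adj_left[of P x y] by simp
lemma cinner_P: "cinner (P x) y = cinner x (P y)" using cinner_adj_left[OF clinear_P, of x y] by simp
lemma norm_PQ: "(norm x)\<^sup>2 = (norm (P x))\<^sup>2 + (norm (Q x))\<^sup>2"
proof -
  have "P x \<bullet> Q x = 0" by (simp add: inner_P blin_simps)
  then show ?thesis using power2_norm_add[of "P x" "Q x"] by (simp add: blin_simps)
qed

lemma norm_P_apply_le: "norm (P x) \<le> norm x"
  using norm_PQ[of x] by (metis le_add_same_cancel1 norm_ge_zero power2_le_imp_le zero_le_power2)

lemma norm_P_le: "norm P \<le> 1" by (rule norm_blinfun_bound) (auto simp: norm_P_apply_le)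
lemma in_range_P: "x \<in> range (blinfun_apply P) \<longleftrightarrow> P x = x" by (metis PP rangeE rangeI)
lemma in_range_Q: "x \<in> range (blinfun_apply Q) \<longleftrightarrow> Q x = x" by (metis QQ(1) rangeE rangeI)

abbreviation S1 :: "'a set" where "S1 \<equiv> range (blinfun_apply P)"
abbreviation S2 :: "'a set" where "S2 \<equiv> range (blinfun_apply Q)"

lemma S1: "closed S1" "csubspace S1"
proof -
  have eq: "S1 = {x. P x = x}" using in_range_P by auto
  show "closed S1" unfolding eq by (intro closed_Collect_eq continuous_intros)
  show "csubspace S1" unfolding eq
    by (auto simp: complex_vector.subspace_def blin_simps P_scaleC)
qed

lemma S2: "closed S2" "csubspace S2"
proof -
  have eq: "S2 = {x. Q x = x}" using in_range_Q by auto
  show "closed S2" unfolding eq by (intro closed_Collect_eq continuous_intros)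
  show "csubspace S2" unfolding eq
    by (auto simp: complex_vector.subspace_def blin_simps P_scaleC)
qed

lemma oproj_S2: "oproj S2 = Q"
proof (rule blinfun_eqI, rule oproj_unique[OF S2(1) csubspace_imp_subspace[OF S2(2)]])
  fix x y assume "y \<in> S2"
  then have "P y = 0" using in_range_Q QQ(2) by metis
  then show "(x - Q x) \<bullet> y = 0" using inner_P[of x y] by (simp add: blin_simps)
qed simp

lemma J_S1: "P x = x \<Longrightarrow> P (J x) = 0" by (simp add: P_J blin_simps)
lemma J_S2: "P x = 0 \<Longrightarrow> P (J x) = J x" by (simp add: P_J blin_simps)

text \<open>The two off-diagonal blocks of \<open>A\<close> are, up to sign, the off-diagonal blocks of the commutator
  with \<open>P\<close>, and for a real operator they are exchanged by \<open>J\<close>. Since the commutator is a derivation,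
  bounds on it are easily followed through products and inverses.\<close>

definition pcomm :: "('a \<Rightarrow>\<^sub>L 'a) \<Rightarrow> ('a \<Rightarrow>\<^sub>L 'a)" where
  "pcomm A = A \<odot> P - P \<odot> A"

lemma pcomm_apply: "pcomm A x = A (P x) - P (A x)" by (simp add: pcomm_def blin_simps)

lemma pcomm_add: "pcomm (A + B) = pcomm A + pcomm B"
  by (rule blinfun_eqI) (simp add: pcomm_apply blin_simps)

lemma pcomm_diff: "pcomm (A - B) = pcomm A - pcomm B"
  by (rule blinfun_eqI) (simp add: pcomm_apply blin_simps)

lemma pcomm_compose: "pcomm (A \<odot> B) = pcomm A \<odot> B + A \<odot> pcomm B"
  by (rule blinfun_eqI) (simp add: pcomm_apply blin_simps)

lemma pcomm_id [simp]: "pcomm id_blinfun = 0"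
  by (rule blinfun_eqI) (simp add: pcomm_apply)

lemma pcomm_zero_iff: "pcomm A = 0 \<longleftrightarrow> (\<forall>x. A (P x) = P (A x))"
  by (metis blinfun_eqI eq_iff_diff_eq_0 pcomm_apply zero_blinfun.rep_eq)

lemma pcomm_adj: "pcomm (A\<^sup>\<dagger>) = - (pcomm A)\<^sup>\<dagger>"
  by (simp add: pcomm_def adj_simps)

lemma pcomm_scaleR: "pcomm (r *\<^sub>R A) = r *\<^sub>R pcomm A"
  by (rule blinfun_eqI) (simp add: pcomm_apply blin_simps algebra_simps)

lemma hs_le_compose_contraction:
  fixes A B B' :: "'a \<Rightarrow>\<^sub>L 'a"
  assumes "hs_le A C" "norm B \<le> 1" "norm B' \<le> 1" shows "hs_le (B \<odot> A \<odot> B') C"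
proof -
  have "hs_le (B \<odot> A \<odot> B') (norm B' * (norm B * C))" by (rule hs_le_right[OF hs_le_left[OF assms(1)]])
  moreover have "norm B' * (norm B * C) \<le> 1 * (1 * C)"
    using hs_le_nonneg[OF assms(1)] assms(2,3) by (intro mult_mono mult_nonneg_nonneg) auto
  ultimately show ?thesis using hs_le_mono by fastforce
qed

text \<open>Conjugation by \<open>J\<close> turns the block \<open>P A Q\<close> into the block \<open>Q A P\<close>.\<close>

lemma hs_le_pcomm:
  assumes "rop A" "hs_le (P \<odot> A \<odot> Q) C" shows "hs_le (pcomm A) (2 * C)"
proof -
  have "Jop \<odot> (P \<odot> A \<odot> Q) \<odot> Jop = Q \<odot> A \<odot> P"
    by (rule blinfun_eqI) (simp only: blinfun_apply_blinfun_compose Jop_apply P_J Q_J rop_J[OF assms(1)] J_J)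
  then have "hs_le (Q \<odot> A \<odot> P) C"
    using hs_le_compose_contraction[OF assms(2) norm_Jop_le norm_Jop_le] by simp
  then have "hs_le (Q \<odot> A \<odot> P - P \<odot> A \<odot> Q) (C + C)" by (intro hs_le_diff assms)
  moreover have "Q \<odot> A \<odot> P - P \<odot> A \<odot> Q = pcomm A"
    by (rule blinfun_eqI) (simp add: pcomm_apply blin_simps)
  ultimately show ?thesis by simp
qed

lemma hs_le_block12:
  assumes "hs_le (pcomm A) C" shows "hs_le (P \<odot> A \<odot> Q) C"
proof -
  have "P \<odot> (- pcomm A) \<odot> id_blinfun = P \<odot> A \<odot> Q"
    by (rule blinfun_eqI) (simp add: pcomm_apply blin_simps)
  then show ?thesis
    using hs_le_compose_contraction[OF hs_le_minus[OF assms] norm_P_le, of id_blinfun] norm_blinfun_id_le by simp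
qed

lemma is_hs_block12_iff: "rop A \<Longrightarrow> is_hs (P \<odot> A \<odot> Q) \<longleftrightarrow> is_hs (pcomm A)"
  using hs_le_pcomm hs_le_block12 unfolding is_hs_def by blast

lemma is_hs_block21:
  assumes "is_hs (pcomm A)" shows "is_hs (Q \<odot> A \<odot> P)"
proof -
  have "Q \<odot> pcomm A = Q \<odot> A \<odot> P" by (rule blinfun_eqI) (simp add: pcomm_apply blin_simps)
  then show ?thesis using is_hs_left[OF assms, of Q] by simp
qed

lemma bog_iff: "V \<in> bog J \<longleftrightarrow> rop V \<and> V\<^sup>\<dagger> \<odot> V = id_blinfun"
  unfolding bog_def mem_Collect_eq rop_def conj_op_eq_iff using cadjoint_eq_adj by metis

lemma clinear_block12: "clinear_op A \<Longrightarrow> clinear_op (block12 P A)"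
  using clinear_P clinear_Q by (simp add: clinear_op_def block12_def blin_simps)

lemma block12_Q: "block12 P A \<odot> Q = P \<odot> A \<odot> Q"
  by (rule blinfun_eqI) (simp add: block12_def blin_simps)

lemma bog_HS_iff: "V \<in> bog_HS J P \<longleftrightarrow> rop V \<and> V\<^sup>\<dagger> \<odot> V = id_blinfun \<and> is_hs (pcomm V)"
proof (cases "V \<in> bog J")
  case True
  then have r: "rop V" using bog_iff by blast
  have "hilbert_schmidt_on S2 (block12 P V) \<longleftrightarrow> is_hs (pcomm V)"
    using hilbert_schmidt_on_iff[OF S2 clinear_block12[OF rop_clinear[OF r]]]
    by (simp add: oproj_S2 block12_Q is_hs_block12_iff[OF r])
  then show ?thesis using True by (auto simp: bog_HS_def bog_iff)
next
  case False then show ?thesis by (auto simp: bog_HS_def bog_iff)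
qed

lemma bog_HSI: "rop V \<Longrightarrow> (\<And>x. norm (V x) = norm x) \<Longrightarrow> is_hs (pcomm V) \<Longrightarrow> V \<in> bog_HS J P"
  unfolding bog_HS_iff isometry_iff by blast

lemma
  assumes "V \<in> bog_HS J P"
  shows bog_HS_rop: "rop V" and bog_HS_adj_left: "V\<^sup>\<dagger> (V x) = x" and bog_HS_norm: "norm (V x) = norm x"
    and bog_HS_hs: "is_hs (pcomm V)" and bog_HS_isometry: "V\<^sup>\<dagger> \<odot> V = id_blinfun"
proof -
  show "rop V" "is_hs (pcomm V)" and i: "V\<^sup>\<dagger> \<odot> V = id_blinfun" using assms bog_HS_iff by auto
  show "V\<^sup>\<dagger> (V x) = x" using i by (metis blinfun_apply_blinfun_compose blinfun_apply_id_blinfun id_apply)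
  show "norm (V x) = norm x" using i isometry_iff by blast
qed

lemma bog_HS_cinner:
  assumes "V \<in> bog_HS J P" shows "cinner (V x) (V y) = cinner x y"
  by (metis assms bog_HS_adj_left bog_HS_rop cinner_adj_right rop_clinear)

lemma bog_HS_compose:
  assumes "V \<in> bog_HS J P" "W \<in> bog_HS J P" shows "V \<odot> W \<in> bog_HS J P"
proof (rule bog_HSI)
  show "rop (V \<odot> W)" by (intro rop_compose bog_HS_rop assms)
  show "norm ((V \<odot> W) x) = norm x" for x by (simp add: bog_HS_norm assms)
  show "is_hs (pcomm (V \<odot> W))"
    unfolding pcomm_compose using assms bog_HS_hs by (blast intro: is_hs_add is_hs_left is_hs_right)
qed

lemma block12_diff: "block12 P V - block12 P W = block12 P (V - W)"
  by (rule blinfun_eqI) (simp add: block12_def blin_simps)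

text \<open>Together with \<open>hs_le_bog_dist\<close> this says that the metric is equivalent to the one that measures
  the whole commutator with \<open>P\<close> in the real Hilbert--Schmidt norm.\<close>

lemma bog_dist_le:
  assumes "hs_le (pcomm (V - W)) C" shows "bog_dist P V W \<le> norm (V - W) + C"
proof -
  have "hs_norm_on S2 (block12 P V - block12 P W) \<le> C"
    unfolding block12_diff by (rule hs_norm_on_le[OF S2]) (simp add: oproj_S2 block12_Q hs_le_block12 assms)
  then show ?thesis by (simp add: bog_dist_def)
qed

lemma hs_le_bog_dist:
  assumes "V \<in> bog_HS J P" "W \<in> bog_HS J P"
  shows "hs_le (pcomm (V - W)) (4 * bog_dist P V W)"
proof -
  have r: "rop (V - W)" using assms by (intro rop_diff bog_HS_rop)
  have "is_hs (pcomm (V - W))" unfolding pcomm_diff using assms by (intro is_hs_diff bog_HS_hs)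
  then have "is_hs (block12 P (V - W) \<odot> oproj S2)" by (simp add: oproj_S2 block12_Q is_hs_block12_iff[OF r])
  then have "hs_le (block12 P (V - W) \<odot> oproj S2) (sqrt 2 * hs_norm_on S2 (block12 P (V - W)))"
    by (rule hs_le_hs_norm_on[OF S2 clinear_block12[OF rop_clinear[OF r]]])
  then have "hs_le (pcomm (V - W)) (2 * (sqrt 2 * hs_norm_on S2 (block12 P (V - W))))"
    by (simp add: oproj_S2 block12_Q hs_le_pcomm[OF r])
  moreover have "2 * (sqrt 2 * hs_norm_on S2 (block12 P (V - W))) \<le> 4 * bog_dist P V W"
  proof -
    have "sqrt 2 \<le> 2" by (rule real_le_lsqrt) auto
    then have "sqrt 2 * hs_norm_on S2 (block12 P (V - W)) \<le> 2 * hs_norm_on S2 (block12 P (V - W))"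
      by (intro mult_right_mono hs_norm_on_nonneg)
    then have "2 * (sqrt 2 * hs_norm_on S2 (block12 P (V - W))) \<le> 2 * (2 * hs_norm_on S2 (block12 P (V - W)))"
      by (rule mult_left_mono) simp
    also have "\<dots> \<le> 4 * bog_dist P V W" by (simp add: bog_dist_def block12_diff)
    finally show ?thesis .
  qed
  ultimately show ?thesis by (rule hs_le_mono)
qed

lemma norm_diff_le_bog_dist: "norm (V - W) \<le> bog_dist P V W"
  by (simp add: bog_dist_def hs_norm_on_nonneg)

lemma bog_metric: "Metric_space (bog_HS J P) (bog_dist P)"
proof
  fix V W X :: "'a \<Rightarrow>\<^sub>L 'a"
  show "0 \<le> bog_dist P V W" by (simp add: bog_dist_def hs_norm_on_nonneg)
  show "bog_dist P V W = bog_dist P W V"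
    unfolding bog_dist_def using hs_norm_on_minus[of S2 "block12 P V - block12 P W"] by (simp add: norm_minus_commute)
  show "bog_dist P V W = 0 \<longleftrightarrow> V = W" if "V \<in> bog_HS J P" "W \<in> bog_HS J P"
  proof
    assume "bog_dist P V W = 0"
    then show "V = W" using norm_diff_le_bog_dist[of V W] by simp
  next
    assume "V = W"
    then show "bog_dist P V W = 0" by (simp add: bog_dist_def hs_norm_on_def)
  qed
  show "bog_dist P V X \<le> bog_dist P V W + bog_dist P W X"
    if v: "V \<in> bog_HS J P" "W \<in> bog_HS J P" "X \<in> bog_HS J P"
  proof -
    have hs: "is_hs (block12 P (A - B) \<odot> oproj S2)" if "A \<in> bog_HS J P" "B \<in> bog_HS J P" for A B
    proof -
      have "is_hs (pcomm (A - B))" unfolding pcomm_diff using that by (intro is_hs_diff bog_HS_hs)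
      moreover have "rop (A - B)" using that by (intro rop_diff bog_HS_rop)
      ultimately show ?thesis by (simp add: oproj_S2 block12_Q is_hs_block12_iff)
    qed
    have "block12 P (V - X) = block12 P (V - W) + block12 P (W - X)"
      by (simp add: block12_diff[symmetric])
    then have "hs_norm_on S2 (block12 P (V - X)) \<le> hs_norm_on S2 (block12 P (V - W)) + hs_norm_on S2 (block12 P (W - X))"
      using hs_norm_on_triangle[OF S2 hs[OF v(1,2)] hs[OF v(2,3)]] by simp
    moreover have "norm (V - X) \<le> norm (V - W) + norm (W - X)" by (metis diff_add_cancel add_diff_eq norm_triangle_ineq)
    ultimately show ?thesis by (simp add: bog_dist_def block12_diff)
  qed
qed

sublocale bogm: Metric_space "bog_HS J P" "bog_dist P"
  by (rule bog_metric)

lemma topspace_bog [simp]: "topspace (bog_topology J P) = bog_HS J P"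
  by (simp add: bog_topology_def)

definition linked :: "('a \<Rightarrow>\<^sub>L 'a) \<Rightarrow> ('a \<Rightarrow>\<^sub>L 'a) \<Rightarrow> bool" where
  "linked V W \<longleftrightarrow> connected_component_of (bog_topology J P) V W"

lemma linked_refl: "V \<in> bog_HS J P \<Longrightarrow> linked V V"
  by (simp add: linked_def connected_component_of_refl)

lemma linked_sym: "linked V W \<Longrightarrow> linked W V"
  by (simp add: linked_def connected_component_of_sym)

lemma linked_trans [trans]: "linked V W \<Longrightarrow> linked W X \<Longrightarrow> linked V X"
  unfolding linked_def by (rule connected_component_of_trans)

lemma linked_path:
  fixes f :: "real \<Rightarrow> 'a \<Rightarrow>\<^sub>L 'a"
  assumes mem: "\<And>s. s \<in> {a..b} \<Longrightarrow> f s \<in> bog_HS J P" and ab: "a \<le> b"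
    and lip: "\<And>s t. s \<in> {a..b} \<Longrightarrow> t \<in> {a..b} \<Longrightarrow> bog_dist P (f s) (f t) \<le> K * \<bar>s - t\<bar>"
  shows "linked (f a) (f b)"
proof -
  have "continuous_map (top_of_set {a..b}) bogm.mtopology f"
    unfolding bogm.continuous_map_to_metric
  proof (intro ballI allI impI)
    fix s e assume s: "s \<in> topspace (top_of_set {a..b})" and e: "(e::real) > 0"
    let ?U = "{a..b} \<inter> ball s (e / (\<bar>K\<bar> + 1))"
    have "f t \<in> bogm.mball (f s) e" if t: "t \<in> ?U" for t
    proof -
      have st: "s \<in> {a..b}" "t \<in> {a..b}" using s t by auto
      have "bog_dist P (f s) (f t) \<le> K * \<bar>s - t\<bar>" by (rule lip[OF st])
      also have "\<dots> \<le> \<bar>K\<bar> * \<bar>s - t\<bar>" by (intro mult_right_mono) auto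
      also have "\<dots> \<le> (\<bar>K\<bar> + 1) * \<bar>s - t\<bar>" by (intro mult_right_mono) auto
      also have "\<dots> < e" using t by (auto simp: dist_real_def field_simps add_pos_nonneg)
      finally show ?thesis using mem st by simp
    qed
    moreover have "openin (top_of_set {a..b}) ?U" by (auto simp: openin_open)
    moreover have "s \<in> ?U" using s e by (auto intro!: divide_pos_pos add_nonneg_pos)
    ultimately show "\<exists>U. openin (top_of_set {a..b}) U \<and> s \<in> U \<and> (\<forall>y\<in>U. f y \<in> bogm.mball (f s) e)"
      by blast
  qed
  moreover have "connectedin (top_of_set {a..b}) {a..b}" by (simp add: connectedin_subtopology connected_Icc)
  ultimately have "connectedin bogm.mtopology (f ` {a..b})" by (rule connectedin_continuous_map_image)
  then show ?thesis unfolding linked_def connected_component_of_def bog_topology_def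
    using ab by (intro exI[of _ "f ` {a..b}"]) auto
qed

lemma linked_lipschitz_map:
  assumes mem: "\<And>V. V \<in> bog_HS J P \<Longrightarrow> h V \<in> bog_HS J P"
    and lip: "\<And>V W. V \<in> bog_HS J P \<Longrightarrow> W \<in> bog_HS J P \<Longrightarrow> bog_dist P (h V) (h W) \<le> K * bog_dist P V W"
    and VW: "linked V W"
  shows "linked (h V) (h W)"
proof -
  have "continuous_map bogm.mtopology bogm.mtopology h"
    unfolding bogm.metric_continuous_map[OF bog_metric]
  proof (intro conjI ballI allI impI)
    show "h ` bog_HS J P \<subseteq> bog_HS J P" using mem by blast
    fix V e assume V: "V \<in> bog_HS J P" and e: "(e::real) > 0"
    have "bog_dist P (h V) (h W) < e" if W: "W \<in> bog_HS J P" "bog_dist P V W < e / (\<bar>K\<bar> + 1)" for W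
    proof -
      have "bog_dist P (h V) (h W) \<le> K * bog_dist P V W" by (rule lip[OF V W(1)])
      also have "\<dots> \<le> (\<bar>K\<bar> + 1) * bog_dist P V W" by (intro mult_right_mono) auto
      also have "\<dots> < e" using W(2) by (simp add: field_simps add_pos_nonneg)
      finally show ?thesis .
    qed
    then show "\<exists>\<delta>>0. \<forall>x. x \<in> bog_HS J P \<and> bog_dist P V x < \<delta> \<longrightarrow> bog_dist P (h V) (h x) < e"
      using e by (intro exI[of _ "e / (\<bar>K\<bar> + 1)"]) (auto intro!: divide_pos_pos add_nonneg_pos)
  qed
  moreover obtain T where "connectedin bogm.mtopology T" "V \<in> T" "W \<in> T"
    using VW unfolding linked_def connected_component_of_def bog_topology_def by blast
  ultimately have "connectedin bogm.mtopology (h ` T)" "h V \<in> h ` T" "h W \<in> h ` T"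
    by (auto intro: connectedin_continuous_map_image)
  then show ?thesis unfolding linked_def connected_component_of_def bog_topology_def by blast
qed

lemma linked_left:
  assumes T: "T \<in> bog_HS J P" and VW: "linked V W"
  shows "linked (T \<odot> V) (T \<odot> W)"
proof -
  obtain C where C: "hs_le (pcomm T) C" using bog_HS_hs[OF T] is_hs_def by blast
  show ?thesis
  proof (rule linked_lipschitz_map[OF _ _ VW])
    show "T \<odot> X \<in> bog_HS J P" if "X \<in> bog_HS J P" for X by (rule bog_HS_compose[OF T that])
    fix X Y assume XY: "X \<in> bog_HS J P" "Y \<in> bog_HS J P"
    let ?d = "bog_dist P X Y"
    have n: "norm (X - Y) \<le> ?d" by (rule norm_diff_le_bog_dist)
    have "hs_le (pcomm T \<odot> (X - Y) + T \<odot> pcomm (X - Y)) (norm (X - Y) * C + norm T * (4 * ?d))"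
      by (intro hs_le_add hs_le_right hs_le_left C hs_le_bog_dist XY)
    moreover have "T \<odot> X - T \<odot> Y = T \<odot> (X - Y)" by (simp add: bmul_distribs)
    ultimately have "hs_le (pcomm (T \<odot> X - T \<odot> Y)) (norm (X - Y) * C + norm T * (4 * ?d))"
      by (simp only: pcomm_compose)
    then have "bog_dist P (T \<odot> X) (T \<odot> Y) \<le> norm (T \<odot> X - T \<odot> Y) + (norm (X - Y) * C + norm T * (4 * ?d))"
      by (rule bog_dist_le)
    also have "norm (T \<odot> X - T \<odot> Y) \<le> norm T * norm (X - Y)"
      using norm_blinfun_compose[of T "X - Y"] by (simp add: bmul_distribs)
    also have "\<dots> \<le> norm T * ?d" using n by (intro mult_left_mono) auto
    also have "norm (X - Y) * C \<le> ?d * C" using n hs_le_nonneg[OF C] by (intro mult_right_mono)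
    finally show "bog_dist P (T \<odot> X) (T \<odot> Y) \<le> (5 * norm T + C) * ?d" by (simp add: algebra_simps)
  qed
qed

lemma linked_right:
  assumes T: "T \<in> bog_HS J P" and VW: "linked V W"
  shows "linked (V \<odot> T) (W \<odot> T)"
proof -
  obtain C where C: "hs_le (pcomm T) C" using bog_HS_hs[OF T] is_hs_def by blast
  show ?thesis
  proof (rule linked_lipschitz_map[OF _ _ VW])
    show "X \<odot> T \<in> bog_HS J P" if "X \<in> bog_HS J P" for X by (rule bog_HS_compose[OF that T])
    fix X Y assume XY: "X \<in> bog_HS J P" "Y \<in> bog_HS J P"
    let ?d = "bog_dist P X Y"
    have n: "norm (X - Y) \<le> ?d" by (rule norm_diff_le_bog_dist)
    have "hs_le (pcomm (X - Y) \<odot> T + (X - Y) \<odot> pcomm T) (norm T * (4 * ?d) + norm (X - Y) * C)"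
      by (intro hs_le_add hs_le_right hs_le_left C hs_le_bog_dist XY)
    moreover have "X \<odot> T - Y \<odot> T = (X - Y) \<odot> T" by (simp add: bmul_distribs)
    ultimately have "hs_le (pcomm (X \<odot> T - Y \<odot> T)) (norm T * (4 * ?d) + norm (X - Y) * C)"
      by (simp only: pcomm_compose)
    then have "bog_dist P (X \<odot> T) (Y \<odot> T) \<le> norm (X \<odot> T - Y \<odot> T) + (norm T * (4 * ?d) + norm (X - Y) * C)"
      by (rule bog_dist_le)
    also have "norm (X \<odot> T - Y \<odot> T) \<le> norm (X - Y) * norm T"
      using norm_blinfun_compose[of "X - Y" T] by (simp add: bmul_distribs)
    also have "\<dots> \<le> ?d * norm T" using n by (intro mult_right_mono) auto
    also have "norm (X - Y) * C \<le> ?d * C" using n hs_le_nonneg[OF C] by (intro mult_right_mono)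
    finally show "bog_dist P (X \<odot> T) (Y \<odot> T) \<le> (5 * norm T + C) * ?d" by (simp add: algebra_simps)
  qed
qed

end


section \<open>Connectedness in the group of surjective Bogoliubov operators\<close>

lemma blinfun_commute_apply: "A \<odot> B = B \<odot> A \<Longrightarrow> A (B x) = blinfun_apply B (blinfun_apply A x)"
  by (metis blinfun_apply_blinfun_compose)

text \<open>A subspace that is invariant under an operator and its adjoint reduces the operator.\<close>

lemma oproj_commute:
  fixes T :: "'a::{real_inner,complete_space} \<Rightarrow>\<^sub>L 'a"
  assumes N: "closed N" "subspace N" and T: "\<And>x. x \<in> N \<Longrightarrow> T x \<in> N" "\<And>x. x \<in> N \<Longrightarrow> T\<^sup>\<dagger> x \<in> N"
  shows "T \<odot> oproj N = oproj N \<odot> T"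
proof (rule blinfun_eqI)
  fix x
  have "oproj N (T x) = T (oproj N x)"
  proof (rule oproj_unique[OF N])
    show "T (oproj N x) \<in> N" by (intro T oproj_in N)
    fix y assume "y \<in> N"
    then have "(x - oproj N x) \<bullet> T\<^sup>\<dagger> y = 0" by (intro oproj_orth N T)
    then show "(T x - T (oproj N x)) \<bullet> y = 0" by (simp add: adj_right blin_simps)
  qed
  then show "(T \<odot> oproj N) x = (oproj N \<odot> T) x" by simp
qed

context basis_projection_setting
begin

text \<open>The group of Bogoliubov operators of index zero (\<open>bogU_iff_neg_ind\<close>).\<close>

definition bogU :: "('a \<Rightarrow>\<^sub>L 'a) set" where
  "bogU = {U \<in> bog_HS J P. U \<odot> U\<^sup>\<dagger> = id_blinfun}"

lemma bogU_HS: "U \<in> bogU \<Longrightarrow> U \<in> bog_HS J P" by (simp add: bogU_def)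

lemma bogU_adj_right: "U \<in> bogU \<Longrightarrow> U (U\<^sup>\<dagger> x) = x"
  unfolding bogU_def using blinfun_apply_blinfun_compose[of U "U\<^sup>\<dagger>" x] by simp

lemma bogUI:
  assumes "V \<in> bog_HS J P" "\<And>y. V\<^sup>\<dagger> y = 0 \<Longrightarrow> y = 0" shows "V \<in> bogU"
proof -
  have "V\<^sup>\<dagger> (y - V (V\<^sup>\<dagger> y)) = 0" for y by (simp add: blin_simps bog_HS_adj_left[OF assms(1)])
  then have "y - V (V\<^sup>\<dagger> y) = 0" for y using assms(2) by blast
  then have "V \<odot> V\<^sup>\<dagger> = id_blinfun" by (intro blinfun_eqI) simp
  then show ?thesis using assms(1) by (simp add: bogU_def)
qed

lemma id_bogU: "id_blinfun \<in> bogU"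
  unfolding bogU_def by (simp add: bog_HS_iff rop_id is_hs_zero)

lemma bogU_compose: "U \<in> bogU \<Longrightarrow> V \<in> bogU \<Longrightarrow> U \<odot> V \<in> bogU"
proof (rule bogUI)
  assume U: "U \<in> bogU" and V: "V \<in> bogU"
  show "U \<odot> V \<in> bog_HS J P" by (intro bog_HS_compose bogU_HS U V)
  fix y assume "(U \<odot> V)\<^sup>\<dagger> y = 0"
  then have "U (V (V\<^sup>\<dagger> (U\<^sup>\<dagger> y))) = 0" by (simp add: adj_compose blin_simps)
  then show "y = 0" by (simp add: bogU_adj_right[OF U] bogU_adj_right[OF V])
qed

lemma bogU_adj: "U \<in> bogU \<Longrightarrow> U\<^sup>\<dagger> \<in> bogU"
proof (intro bogUI bog_HSI)
  assume U: "U \<in> bogU"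
  show "rop (U\<^sup>\<dagger>)" using U by (intro rop_adj bog_HS_rop bogU_HS)
  show "norm (U\<^sup>\<dagger> x) = norm x" for x using bog_HS_norm[OF bogU_HS[OF U], of "U\<^sup>\<dagger> x"] bogU_adj_right[OF U] by simp
  show "is_hs (pcomm (U\<^sup>\<dagger>))" unfolding pcomm_adj using U by (intro is_hs_minus is_hs_adj bog_HS_hs bogU_HS)
  show "y = 0" if "U\<^sup>\<dagger>\<^sup>\<dagger> y = 0" for y using that bog_HS_adj_left[OF bogU_HS[OF U], of y] by simp
qed

text \<open>The product rule for commutators involves the norms of the factors, so that both bounds have to
  be carried along; together they control the metric (\<open>pbd_bog_dist\<close>).\<close>

definition pbd :: "('a \<Rightarrow>\<^sub>L 'a) \<Rightarrow> real \<Rightarrow> real \<Rightarrow> bool" where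
  "pbd A a c \<longleftrightarrow> norm A \<le> a \<and> hs_le (pcomm A) c"

lemma pbd_nonneg: "pbd A a c \<Longrightarrow> 0 \<le> a \<and> 0 \<le> c"
  unfolding pbd_def using hs_le_nonneg norm_ge_zero order_trans by blast

lemma pbd_compose:
  assumes "pbd A a c" "pbd B b d" shows "pbd (A \<odot> B) (a * b) (c * b + a * d)"
proof -
  have A: "norm A \<le> a" "hs_le (pcomm A) c" and B: "norm B \<le> b" "hs_le (pcomm B) d"
    using assms by (auto simp: pbd_def)
  have "hs_le (pcomm A \<odot> B) (norm B * c)" by (rule hs_le_right[OF A(2)])
  moreover have "norm B * c \<le> c * b"
    unfolding mult.commute[of c b] by (rule mult_right_mono[OF B(1) hs_le_nonneg[OF A(2)]])
  moreover have "hs_le (A \<odot> pcomm B) (norm A * d)" by (rule hs_le_left[OF B(2)])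
  moreover have "norm A * d \<le> a * d" using A(1) hs_le_nonneg[OF B(2)] by (rule mult_right_mono)
  ultimately have "hs_le (pcomm (A \<odot> B)) (c * b + a * d)"
    unfolding pcomm_compose by (intro hs_le_add) (auto intro: hs_le_mono)
  moreover have "norm (A \<odot> B) \<le> a * b"
    using norm_blinfun_compose[of A B] mult_mono[OF A(1) B(1)] A(1) norm_ge_zero order_trans by (smt (verit))
  ultimately show ?thesis by (simp add: pbd_def)
qed

lemma pbd_add: "pbd A a c \<Longrightarrow> pbd B b d \<Longrightarrow> pbd (A + B) (a + b) (c + d)"
  unfolding pbd_def pcomm_add by (auto intro: hs_le_add norm_triangle_mono)

lemma pbd_scaleR: "pbd A a c \<Longrightarrow> pbd (r *\<^sub>R A) (\<bar>r\<bar> * a) (\<bar>r\<bar> * c)"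
proof -
  assume h: "pbd A a c"
  have "hs_le ((r *\<^sub>R id_blinfun) \<odot> pcomm A) (norm (r *\<^sub>R id_blinfun :: 'a \<Rightarrow>\<^sub>L 'a) * c)"
    using h by (intro hs_le_left) (simp add: pbd_def)
  moreover have "norm (r *\<^sub>R id_blinfun :: 'a \<Rightarrow>\<^sub>L 'a) \<le> \<bar>r\<bar>"
    using mult_left_mono[OF norm_blinfun_id_le, of "\<bar>r\<bar>"] by simp
  ultimately have "hs_le (pcomm (r *\<^sub>R A)) (\<bar>r\<bar> * c)"
    unfolding pcomm_scaleR using hs_le_mono mult_right_mono pbd_nonneg[OF h] by (fastforce simp: bmul_distribs)
  then show ?thesis using h by (simp add: pbd_def mult_left_mono)
qed

lemma pbd_diff: "pbd A a c \<Longrightarrow> pbd B b d \<Longrightarrow> pbd (A - B) (a + b) (c + d)"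
  using pbd_add[OF _ pbd_scaleR, of A a c B b d "-1"] by simp

lemma pbd_id: "pbd id_blinfun 1 0"
  by (simp add: pbd_def hs_le_zero norm_blinfun_id_le)

text \<open>The derivation property applied to \<open>G M = 1\<close> expresses the commutator of the inverse \<open>G\<close> by
  that of \<open>M\<close>.\<close>

lemma pbd_inverse:
  assumes "G \<odot> M = id_blinfun" "M \<odot> G = id_blinfun" "hs_le (pcomm M) c" "norm G \<le> k"
  shows "pbd G k (k * c * k)"
proof -
  have "pcomm G \<odot> M + G \<odot> pcomm M = 0" using assms(1) pcomm_compose[of G M] by simp
  then have "(pcomm G \<odot> M + G \<odot> pcomm M) \<odot> G = 0" by simp
  then have "pcomm G + G \<odot> pcomm M \<odot> G = 0" by (simp add: bmul_distribs bmul_assoc[of _ M G] assms(2))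
  then have eq: "pcomm G = - (G \<odot> pcomm M \<odot> G)" by (simp add: eq_neg_iff_add_eq_0)
  have "hs_le (- (G \<odot> pcomm M \<odot> G)) (norm G * (norm G * c))"
    by (intro hs_le_minus hs_le_right[OF hs_le_left[OF assms(3)]])
  moreover have "norm G * (norm G * c) \<le> k * (k * c)"
    using assms(4) hs_le_nonneg[OF assms(3)] order_trans[OF norm_ge_zero assms(4)]
    by (intro mult_mono mult_nonneg_nonneg) auto
  ultimately show ?thesis unfolding pbd_def eq using assms(4) hs_le_mono by (simp add: mult_ac)
qed

lemma pbd_bog_dist: "pbd (V - W) a c \<Longrightarrow> bog_dist P V W \<le> a + c"
  unfolding pbd_def using bog_dist_le[of V W c] by linarith

text \<open>If \<open>z\<close> on the unit circle stays away from \<open>-1\<close>, then \<open>1 + s z\<close> stays away from \<open>0\<close> for all \<open>s\<close>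
  between \<open>0\<close> and \<open>1\<close>; the lemma is the operator form of this.\<close>

lemma norm_id_add_scaled_isometry_ge:
  fixes W :: "'a \<Rightarrow>\<^sub>L 'a"
  assumes iso: "\<And>x. norm (W x) = norm x" and e: "norm (W - id_blinfun) \<le> 2 - e" "0 \<le> e" "e \<le> 2"
    and s: "0 \<le> s" "s \<le> 1"
  shows "e / 4 * norm x \<le> norm (x + s *\<^sub>R W x)"
proof -
  have "2 * norm x = norm (2 *\<^sub>R x)" by simp
  also have "\<dots> = norm ((x + W x) - (W - id_blinfun) x)" by (simp add: blin_simps scaleR_2)
  also have "\<dots> \<le> norm (x + W x) + norm ((W - id_blinfun) x)" by (rule norm_triangle_ineq4)
  also have "norm ((W - id_blinfun) x) \<le> (2 - e) * norm x"
    by (rule order_trans[OF norm_blinfun]) (intro mult_right_mono e, simp)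
  finally have "e * norm x \<le> norm (x + W x)" by (simp add: algebra_simps)
  then have "(e * norm x)\<^sup>2 \<le> (norm (x + W x))\<^sup>2" using e by (intro power_mono) auto
  then have "e\<^sup>2 * (norm x)\<^sup>2 \<le> 2 * (norm x)\<^sup>2 + 2 * (x \<bullet> W x)"
    unfolding power2_norm_add by (simp add: iso power_mult_distrib)
  then have "s * (e\<^sup>2 * (norm x)\<^sup>2) \<le> s * (2 * (norm x)\<^sup>2 + 2 * (x \<bullet> W x))" by (rule mult_left_mono[OF _ s(1)])
  then have ge: "((1 - s)\<^sup>2 + s * e\<^sup>2) * (norm x)\<^sup>2 \<le> (norm (x + s *\<^sub>R W x))\<^sup>2"
    unfolding power2_norm_add by (simp add: iso power_mult_distrib power2_eq_square algebra_simps)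
  \<comment> \<open>the first summand suffices for \<open>s \<le> 1/2\<close>, because \<open>e \<le> 2\<close>; the second one for \<open>s > 1/2\<close>\<close>
  have "(e / 4)\<^sup>2 \<le> (1 - s)\<^sup>2 + s * e\<^sup>2"
  proof (cases "s \<le> 1/2")
    case True
    have "e\<^sup>2 \<le> 2\<^sup>2" using e by (intro power_mono) auto
    moreover have "(1/2)\<^sup>2 \<le> (1 - s)\<^sup>2" using True by (intro power_mono) auto
    moreover have "0 \<le> s * e\<^sup>2" using s by simp
    ultimately show ?thesis by (simp add: power2_eq_square)
  next
    case False
    then have "1/2 * e\<^sup>2 \<le> s * e\<^sup>2" by (intro mult_right_mono) auto
    moreover have "0 \<le> (1 - s)\<^sup>2" "0 \<le> e\<^sup>2" by auto
    moreover have "(e / 4)\<^sup>2 = e\<^sup>2 / 16" by (simp add: power_divide)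
    ultimately show ?thesis by linarith
  qed
  then have "(e / 4)\<^sup>2 * (norm x)\<^sup>2 \<le> ((1 - s)\<^sup>2 + s * e\<^sup>2) * (norm x)\<^sup>2" by (intro mult_right_mono) auto
  then have "(e / 4 * norm x)\<^sup>2 \<le> (norm (x + s *\<^sub>R W x))\<^sup>2" using ge unfolding power_mult_distrib by linarith
  then show ?thesis by (rule power2_le_imp_le) simp
qed

text \<open>The path \<open>f s = (s + W) (1 + s W)\<^sup>-\<^sup>1\<close> runs from \<open>W\<close> at \<open>s = 0\<close> to the identity at \<open>s = 1\<close>. It
  consists of isometries because \<open>\<bar>s + z\<bar> = \<bar>1 + s z\<bar>\<close> on the unit circle, and its commutator with
  \<open>P\<close> is a sum of products that contain the commutator of \<open>W\<close> as a factor. The hypothesis on the norm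
  makes \<open>1 + s W\<close> invertible, uniformly in \<open>s\<close>.\<close>

lemma linked_id_near:
  assumes W: "W \<in> bogU" and near: "norm (W - id_blinfun) < 2"
  shows "linked W id_blinfun"
proof -
  define e where "e = 2 - norm (W - id_blinfun)"
  have e: "0 < e" "e \<le> 2" "norm (W - id_blinfun) \<le> 2 - e" using near by (auto simp: e_def)
  have WHS: "W \<in> bog_HS J P" by (rule bogU_HS[OF W])
  have isoW: "norm (W x) = norm x" for x by (rule bog_HS_norm[OF WHS])
  have isoW': "norm (W\<^sup>\<dagger> x) = norm x" for x by (rule bog_HS_norm[OF bogU_HS[OF bogU_adj[OF W]]])
  have near': "norm (W\<^sup>\<dagger> - id_blinfun) \<le> 2 - e"
    using e(3) norm_adj[of "W - id_blinfun"] by (simp add: adj_simps)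
  define M where "M s = id_blinfun + s *\<^sub>R W" for s
  have M_apply: "M s x = x + s *\<^sub>R W x" for s x by (simp add: M_def blin_simps)
  have Mge: "e / 4 * norm x \<le> norm (M s x)" if "s \<in> {0..1}" for s x
    unfolding M_apply using norm_id_add_scaled_isometry_ge[OF isoW e(3)] e that by auto
  have "\<exists>G. G \<odot> M s = id_blinfun \<and> M s \<odot> G = id_blinfun" if s: "s \<in> {0..1}" for s
  proof (rule bddbelow_invertible)
    show "bddbelow (M s) UNIV" unfolding bddbelow_def using Mge[OF s] e(1) by (intro exI[of _ "e/4"]) simp
    fix y assume y: "(M s)\<^sup>\<dagger> y = 0"
    have "e / 4 * norm y \<le> norm (y + s *\<^sub>R W\<^sup>\<dagger> y)"
      using norm_id_add_scaled_isometry_ge[OF isoW' near'] e s by auto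
    also have "y + s *\<^sub>R W\<^sup>\<dagger> y = 0" using y by (simp add: M_def adj_simps blin_simps)
    finally show "y = 0" using e(1) by (simp add: mult_le_0_iff)
  qed
  then obtain G where G: "\<And>s. s \<in> {0..1} \<Longrightarrow> G s \<odot> M s = id_blinfun" "\<And>s. s \<in> {0..1} \<Longrightarrow> M s \<odot> G s = id_blinfun"
    by metis
  define k where "k = 4 / e"
  have MG: "M s (G s x) = x" if "s \<in> {0..1}" for s x
    using G(2)[OF that] by (metis blinfun_apply_blinfun_compose blinfun_apply_id_blinfun id_apply)
  have nG: "norm (G s) \<le> k" if "s \<in> {0..1}" for s
  proof (rule norm_blinfun_bound)
    show "norm (G s x) \<le> k * norm x" for x
      using Mge[OF that, of "G s x"] MG[OF that] e(1) by (simp add: k_def field_simps)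
  qed (use e in \<open>simp add: k_def\<close>)
  obtain C where C: "hs_le (pcomm W) C" using bog_HS_hs[OF WHS] is_hs_def by blast
  have bW: "pbd W 1 C" using C norm_blinfun_bound[of 1 W] isoW by (simp add: pbd_def)
  have bM: "pbd (M s) 2 C" if "s \<in> {0..1}" for s
  proof -
    have "pbd (M s) (1 + \<bar>s\<bar> * 1) (0 + \<bar>s\<bar> * C)" unfolding M_def by (intro pbd_add pbd_id pbd_scaleR bW)
    moreover have "\<bar>s\<bar> * C \<le> 1 * C" using that hs_le_nonneg[OF C] by (intro mult_right_mono) auto
    ultimately show ?thesis using that hs_le_mono unfolding pbd_def by fastforce
  qed
  have bG: "pbd (G s) k (k * C * k)" if "s \<in> {0..1}" for s
    by (rule pbd_inverse[OF G(1)[OF that] G(2)[OF that] _ nG[OF that]])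
       (use bM[OF that] in \<open>simp add: pbd_def\<close>)
  define f where "f s = (s *\<^sub>R id_blinfun + W) \<odot> G s" for s
  have bF: "pbd (s *\<^sub>R id_blinfun + W) 2 C" if "s \<in> {0..1}" for s
  proof -
    have "pbd (s *\<^sub>R id_blinfun + W) (\<bar>s\<bar> * 1 + 1) (\<bar>s\<bar> * 0 + C)" by (intro pbd_add pbd_id pbd_scaleR bW)
    then show ?thesis using that unfolding pbd_def by auto
  qed
  have mem: "f s \<in> bog_HS J P" if s: "s \<in> {0..1}" for s
  proof (rule bog_HSI)
    have rW: "rop W" by (rule bog_HS_rop[OF WHS])
    then have "rop (M s)" unfolding M_def by (intro rop_intros)
    then have "rop (G s)" using G[OF s] by (rule rop_inverse)
    then show "rop (f s)" unfolding f_def using rW by (intro rop_intros)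
    have "norm (s *\<^sub>R y + W y) = norm (y + s *\<^sub>R W y)" for y
    proof -
      have "(norm (s *\<^sub>R y + W y))\<^sup>2 = (norm (y + s *\<^sub>R W y))\<^sup>2"
        unfolding power2_norm_add by (simp add: isoW power_mult_distrib)
      then show ?thesis by (simp add: power2_eq_iff_nonneg)
    qed
    then show "norm (f s x) = norm x" for x
      using MG[OF s, of x] by (simp add: f_def blin_simps M_apply)
    show "is_hs (pcomm (f s))" unfolding f_def is_hs_def
      using pbd_compose[OF bF[OF s] bG[OF s]] unfolding pbd_def by blast
  qed
  obtain K where K: "\<And>s t. s \<in> {0..1} \<Longrightarrow> t \<in> {0..1} \<Longrightarrow>
      \<exists>a c. pbd (G s - (t *\<^sub>R id_blinfun + W) \<odot> (G s \<odot> W \<odot> G t)) a c \<and> a + c = K"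
    using pbd_diff[OF bG pbd_compose[OF bF pbd_compose[OF pbd_compose[OF bG bW] bG]]] by metis
  have lip: "bog_dist P (f s) (f t) \<le> K * \<bar>s - t\<bar>" if st: "s \<in> {0..1}" "t \<in> {0..1}" for s t
  proof -
    let ?E = "G s - (t *\<^sub>R id_blinfun + W) \<odot> (G s \<odot> W \<odot> G t)"
    have "G s - G t = G s \<odot> (M t - M s) \<odot> G t"
      using G(1)[OF st(1)] G(2)[OF st(2)] by (simp add: bmul_distribs bmul_assoc)
    also have "M t - M s = (t - s) *\<^sub>R W" by (simp add: M_def scaleR_diff_left)
    finally have Gd: "G s - G t = (t - s) *\<^sub>R (G s \<odot> W \<odot> G t)" by (simp add: bmul_distribs)
    have "f s - f t = (s - t) *\<^sub>R G s + (t *\<^sub>R id_blinfun + W) \<odot> (G s - G t)"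
      by (simp add: f_def bmul_distribs scaleR_diff_left)
    also have "\<dots> = (s - t) *\<^sub>R ?E"
      unfolding Gd by (simp add: bmul_distribs scaleR_diff_right scaleR_diff_left)
    finally have fd: "f s - f t = (s - t) *\<^sub>R ?E" .
    obtain a c where ac: "pbd ?E a c" "a + c = K" using K[OF st] by blast
    have "pbd (f s - f t) (\<bar>s - t\<bar> * a) (\<bar>s - t\<bar> * c)" unfolding fd by (rule pbd_scaleR[OF ac(1)])
    then have "bog_dist P (f s) (f t) \<le> \<bar>s - t\<bar> * a + \<bar>s - t\<bar> * c" by (rule pbd_bog_dist)
    then show ?thesis by (simp add: ac(2)[symmetric] algebra_simps)
  qed
  have "linked (f 0) (f 1)" by (rule linked_path[OF mem _ lip]) auto
  moreover have "G 0 = id_blinfun" using G(2)[of 0] by (simp add: M_def)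
  then have "f 0 = W" by (simp add: f_def)
  moreover have "f 1 = id_blinfun" using G(2)[of 1] by (simp add: f_def M_def)
  ultimately show ?thesis by simp
qed

lemma linked_near:
  assumes U: "U \<in> bogU" and V: "V \<in> bogU" and near: "norm (U - V) < 2"
  shows "linked U V"
proof -
  have "U\<^sup>\<dagger> \<odot> V - id_blinfun = U\<^sup>\<dagger> \<odot> (V - U)"
    using bog_HS_isometry[OF bogU_HS[OF U]] by (simp add: bmul_distribs)
  then have "norm (U\<^sup>\<dagger> \<odot> V - id_blinfun) \<le> norm U * norm (V - U)"
    using norm_blinfun_compose[of "U\<^sup>\<dagger>" "V - U"] by simp
  also have "\<dots> \<le> 1 * norm (V - U)"
    using norm_blinfun_bound[of 1 U] bog_HS_norm[OF bogU_HS[OF U]] by (intro mult_right_mono) auto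
  finally have "linked (U\<^sup>\<dagger> \<odot> V) id_blinfun"
    using near by (intro linked_id_near bogU_compose bogU_adj U V) (simp add: norm_minus_commute)
  then have "linked (U \<odot> (U\<^sup>\<dagger> \<odot> V)) (U \<odot> id_blinfun)" by (rule linked_left[OF bogU_HS[OF U]])
  moreover have "U \<odot> (U\<^sup>\<dagger> \<odot> V) = V" by (rule blinfun_eqI) (simp add: bogU_adj_right[OF U])
  ultimately show ?thesis by (simp add: linked_sym)
qed

text \<open>Two isometries whose values form an angle of at most a right angle have distance at most
  \<open>sqrt 2\<close>.\<close>

lemma linked_inner_nonneg:
  assumes U: "U \<in> bogU" and V: "V \<in> bogU" and nn: "\<And>x. 0 \<le> U x \<bullet> V x"
  shows "linked U V"
proof (rule linked_near[OF U V])
  have "norm (U - V) \<le> sqrt 2"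
  proof (rule norm_blinfun_bound)
    fix x
    have "(norm (U x - V x))\<^sup>2 \<le> 2 * (norm x)\<^sup>2"
      unfolding power2_norm_diff using nn[of x] bog_HS_norm[OF bogU_HS[OF U]] bog_HS_norm[OF bogU_HS[OF V]] by simp
    then have "norm (U x - V x) \<le> sqrt (2 * (norm x)\<^sup>2)" by (rule real_le_rsqrt)
    then show "norm ((U - V) x) \<le> sqrt 2 * norm x" by (simp add: blin_simps real_sqrt_mult)
  qed simp
  also have "sqrt 2 < 2" by (rule real_less_lsqrt) auto
  finally show "norm (U - V) < 2" .
qed

text \<open>\<open>Lam\<close> is the complex structure \<open>\<i> (P - Q)\<close>. Unlike multiplication by \<open>\<i>\<close> it commutes with \<open>J\<close>, so
  that it plays the role of the imaginary unit among the real operators that commute with \<open>P\<close>.\<close>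

definition Lam :: "'a \<Rightarrow>\<^sub>L 'a" where "Lam = scaleC_op \<i> \<odot> (P - Q)"

lemma Lam_apply: "Lam x = scaleC \<i> (P x - Q x)" by (simp add: Lam_def blinfun.diff_left)

lemma rop_Lam: "rop Lam"
proof (rule ropI)
  show "Lam (scaleC a x) = scaleC a (Lam x)" for a x
    by (simp add: Lam_apply blin_simps P_scaleC scaleC_scaleC mult.commute
        complex_vector.scale_right_diff_distrib)
  have "P (J x) - Q (J x) = - J (P x - Q x)" for x by (simp add: P_J Q_J J_diff del: blin_simps)
  then show "Lam (J x) = J (Lam x)" for x
    by (simp add: Lam_apply J_scaleC)
qed

lemma Lam_Lam: "Lam (Lam x) = - x"
  by (simp add: Lam_apply blin_simps P_scaleC scaleC_scaleC scaleC_minus1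
      complex_vector.scale_right_diff_distrib)

lemma adj_Lam: "Lam\<^sup>\<dagger> = - Lam"
proof (rule adj_unique)
  fix x y
  have "scaleC \<i> u \<bullet> v = - (u \<bullet> scaleC \<i> v)" for u v :: 'a
    by (simp add: Re_cinner[symmetric] cinner_simps)
  then show "(- Lam) x \<bullet> y = x \<bullet> Lam y"
    by (simp add: Lam_apply blin_simps inner_diff inner_P P_scaleC complex_vector.scale_right_diff_distrib)
qed

lemma Lam_P: "Lam (P x) = P (Lam x)"
  by (simp add: Lam_apply blin_simps P_scaleC complex_vector.scale_right_diff_distrib)

lemma Lam_commute:
  assumes "clinear_op A" "\<And>x. A (P x) = P (blinfun_apply A x)" shows "Lam (A x) = A (Lam x)"
  by (simp add: Lam_apply blin_simps assms(2) clinear_opD[OF assms(1)] complex_vector.scale_right_diff_distrib)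

text \<open>Write \<open>D = c + Lam s\<close> with commuting self-adjoint \<open>c\<close>, \<open>s\<close> and \<open>c\<^sup>2 + s\<^sup>2 = 1\<close>, and let \<open>\<sigma>\<close> be a
  symmetry, commuting with \<open>D\<close>, \<open>P\<close> and \<open>J\<close>, such that \<open>\<sigma> s\<close> is positive. Then \<open>w = Lam \<sigma>\<close> is a
  unitary at distance at most \<open>sqrt 2\<close> from both the identity and \<open>D\<close>: on the unit circle \<open>w\<close> is
  \<open>\<plusminus> \<i>\<close>, with the sign of the imaginary part of \<open>D\<close>. The symmetry comes from the square root \<open>r\<close> of
  \<open>s\<^sup>2 = 1 - c\<^sup>2\<close>: the kernel of \<open>r - s\<close> contains the range of \<open>r + s\<close>, so that \<open>s\<close> agrees with \<open>r\<close> on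
  this kernel and with \<open>- r\<close> on its orthogonal complement.\<close>

lemma linked_diagonal:
  assumes D: "D \<in> bogU" and DP: "pcomm D = 0"
  shows "linked D id_blinfun"
proof -
  have DHS: "D \<in> bog_HS J P" by (rule bogU_HS[OF D])
  have rD: "rop D" and rD': "rop (D\<^sup>\<dagger>)" using DHS by (auto intro: rop_adj bog_HS_rop)
  have P: "D (P x) = P (D x)" "D\<^sup>\<dagger> (P x) = P (D\<^sup>\<dagger> x)" for x
    using DP pcomm_adj[of D] by (auto simp: pcomm_zero_iff adj_minus[symmetric] intro: adj_unique)
      (metis DP adj_unique blinfun.zero_left inner_zero_left inner_zero_right neg_equal_0_iff_equal pcomm_zero_iff)
  have L: "Lam (D x) = D (Lam x)" "Lam (D\<^sup>\<dagger> x) = D\<^sup>\<dagger> (Lam x)" for x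
    using P by (auto intro: Lam_commute rop_clinear rD rD')
  have DD: "D\<^sup>\<dagger> (D x) = x" "D (D\<^sup>\<dagger> x) = x" for x
    using bog_HS_adj_left[OF DHS] bogU_adj_right[OF D] by auto
  define s where "s = (-1/2) *\<^sub>R (Lam \<odot> (D - D\<^sup>\<dagger>))"
  define c where "c = (1/2) *\<^sub>R (D + D\<^sup>\<dagger>)"
  have s_apply: "s x = (-1/2) *\<^sub>R Lam (D x - D\<^sup>\<dagger> x)" for x by (simp add: s_def blin_simps)
  have c_apply: "c x = (1/2) *\<^sub>R (D x + D\<^sup>\<dagger> x)" for x by (simp add: c_def blin_simps)
  have adj_s: "s\<^sup>\<dagger> = s"
    by (rule blinfun_eqI) (simp add: s_def adj_simps adj_Lam blin_simps L)
  have adj_c: "c\<^sup>\<dagger> = c" by (simp add: c_def adj_simps add.commute)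
  have sc: "s (s x) + c (c x) = x" for x
    by (simp add: s_apply c_apply blin_simps L[symmetric] Lam_Lam DD scaleR_add_right[symmetric])
       (simp add: scaleR_2[symmetric] algebra_simps)
  have "norm c \<le> 1"
  proof (rule norm_blinfun_bound)
    fix x
    have "norm (D x + D\<^sup>\<dagger> x) \<le> norm x + norm x"
      using norm_triangle_ineq[of "D x" "D\<^sup>\<dagger> x"] bog_HS_norm[OF DHS] bog_HS_norm[OF bogU_HS[OF bogU_adj[OF D]]] by simp
    then show "norm (c x) \<le> 1 * norm x" by (simp add: c_apply)
  qed simp
  define X where "X = c \<odot> c"
  have "norm X \<le> 1"
    using norm_blinfun_compose[of c c] \<open>norm c \<le> 1\<close> mult_le_one[of "norm c" "norm c"] by (simp add: X_def)
  moreover have "X\<^sup>\<dagger> = X" by (simp add: X_def adj_compose adj_c)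
  ultimately obtain r where r: "r \<odot> r = id_blinfun - X" "r\<^sup>\<dagger> = r" "norm (id_blinfun - r) \<le> norm X"
    "\<And>T. T \<odot> X = X \<odot> T \<Longrightarrow> T \<odot> r = r \<odot> T"
    using operator_square_root by metis
  have r_pos: "0 \<le> x \<bullet> r x" for x
  proof -
    have "norm (id_blinfun - r) \<le> 1" using r(3) \<open>norm X \<le> 1\<close> by simp
    from inner_ge_of_norm_id_diff[OF this, of x] show ?thesis by simp
  qed
  have rr: "r (r x) = s (s x)" for x
  proof -
    have "r (r x) = x - c (c x)" using arg_cong[OF r(1), of "\<lambda>A. A x"] by (simp add: X_def blin_simps)
    also have "\<dots> = s (s x)" using sc[of x] by (metis add_diff_cancel_right')
    finally show ?thesis .
  qed
  have comm_r: "T (r x) = r (T x)" if "\<And>x. T (c x) = c (T x)" for T :: "'a \<Rightarrow>\<^sub>L 'a" and x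
  proof -
    have "T \<odot> X = X \<odot> T" by (rule blinfun_eqI) (simp add: X_def that)
    from r(4)[OF this] show ?thesis by (rule blinfun_commute_apply)
  qed
  have s_c: "s (c x) = c (s x)" for x
    by (simp add: s_apply c_apply blin_simps L[symmetric] DD algebra_simps)
  have sr: "s (r x) = r (s x)" for x by (rule comm_r) (rule s_c)
  define N where "N = {x. r x = s x}"
  have N: "closed N" "subspace N"
    unfolding N_def by (intro closed_Collect_eq continuous_intros) (auto simp: subspace_def blin_simps)
  define p where "p = oproj N"
  have comm_p: "T (p x) = p (T x)"
    if "\<And>x. T (c x) = c (T x)" "\<And>x. T (s x) = s (T x)" "\<And>x. T\<^sup>\<dagger> (c x) = c (T\<^sup>\<dagger> x)" "\<And>x. T\<^sup>\<dagger> (s x) = s (T\<^sup>\<dagger> x)"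
    for T :: "'a \<Rightarrow>\<^sub>L 'a" and x
  proof -
    have "T \<odot> p = p \<odot> T"
      unfolding p_def
    proof (rule oproj_commute[OF N])
      show "T y \<in> N" if "y \<in> N" for y
        using that comm_r[OF \<open>\<And>x. T (c x) = c (T x)\<close>, of y] \<open>\<And>x. T (s x) = s (T x)\<close> by (simp add: N_def)
      show "T\<^sup>\<dagger> y \<in> N" if "y \<in> N" for y
        using that comm_r[OF \<open>\<And>x. T\<^sup>\<dagger> (c x) = c (T\<^sup>\<dagger> x)\<close>, of y] \<open>\<And>x. T\<^sup>\<dagger> (s x) = s (T\<^sup>\<dagger> x)\<close> by (simp add: N_def)
    qed
    then show ?thesis by (rule blinfun_commute_apply)
  qed
  have rs: "rop s" and rc: "rop c" unfolding s_def c_def by (intro rop_intros rop_Lam rD)+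
  have adj_scale: "(scaleC_op a)\<^sup>\<dagger> = scaleC_op (cnj a)" for a :: complex
    by (rule adj_unique) (simp add: Re_cinner[symmetric] cinner_simps)
  have adj_J: "Jop\<^sup>\<dagger> = Jop" by (rule adj_unique) (simp add: inner_J_left)
  have rp: "rop p"
  proof (rule ropI)
    show "p (scaleC a x) = scaleC a (p x)" for a x
      using comm_p[of "scaleC_op a" x] by (simp add: adj_scale rop_scaleC[OF rs] rop_scaleC[OF rc])
    show "p (J x) = J (p x)" for x
      using comm_p[of Jop x] by (simp add: adj_J rop_J[OF rs] rop_J[OF rc])
  qed
  have sP: "P (s x) = s (P x)" and cP: "P (c x) = c (P x)" for x
    by (simp_all add: s_apply c_apply blin_simps P Lam_P[symmetric])
  have pP: "p (P x) = P (p x)" for x using comm_p[of P x] by (simp add: sP cP)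
  have sD: "D (s x) = s (D x)" "D\<^sup>\<dagger> (s x) = s (D\<^sup>\<dagger> x)" and cD: "D (c x) = c (D x)" "D\<^sup>\<dagger> (c x) = c (D\<^sup>\<dagger> x)" for x
    by (simp_all add: s_apply c_apply blin_simps DD L)
  have pD: "p (D x) = D (p x)" "p (D\<^sup>\<dagger> x) = D\<^sup>\<dagger> (p x)" for x
    using comm_p[of D x] comm_p[of "D\<^sup>\<dagger>" x] by (simp_all add: sD cD)
  define \<sigma> where "\<sigma> = 2 *\<^sub>R p - id_blinfun"
  have sig_apply: "\<sigma> x = 2 *\<^sub>R p x - x" for x by (simp add: \<sigma>_def blin_simps)
  have pp: "p (p x) = p x" for x unfolding p_def by (intro oproj_id N oproj_in)
  have adj_sig: "\<sigma>\<^sup>\<dagger> = \<sigma>" by (simp add: \<sigma>_def adj_simps p_def adj_oproj[OF N])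
  have sigsig: "\<sigma> (\<sigma> x) = x" for x by (simp add: sig_apply blin_simps pp scaleR_2)
  have sigs: "\<sigma> (s x) = r x" for x
  proof -
    have pN: "p y \<in> N" for y unfolding p_def by (rule oproj_in[OF N])
    have "r (p x) = s (p x)" using pN[of x] by (simp add: N_def)
    have "r y + s y = 0" if y: "p y = 0" for y
    proof -
      have "(r y + s y) \<bullet> z = 0" for z
      proof -
        have "r z + s z \<in> N" by (simp add: N_def blin_simps rr sr)
        then have "(y - p y) \<bullet> (r z + s z) = 0" unfolding p_def by (rule oproj_orth[OF N])
        then have "y \<bullet> r z + y \<bullet> s z = 0" using y by (simp add: inner_add)
        moreover have "r y \<bullet> z = y \<bullet> r z" "s y \<bullet> z = y \<bullet> s z" using r(2) adj_s by (metis adj_left)+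
        ultimately show ?thesis by (simp add: inner_add)
      qed
      then show ?thesis by (metis inner_eq_zero_iff)
    qed
    from this[of "x - p x"] have "r (x - p x) + s (x - p x) = 0" by (simp add: blin_simps pp)
    moreover have "s (p x) = p (s x)" by (rule comm_p) (simp_all add: adj_s s_c)
    ultimately show ?thesis using \<open>r (p x) = s (p x)\<close> by (simp add: sig_apply blin_simps scaleR_2 algebra_simps)
  qed
  define w where "w = Lam \<odot> \<sigma>"
  have rsig: "rop \<sigma>" unfolding \<sigma>_def by (intro rop_intros rp)
  have sigP: "\<sigma> (P x) = P (\<sigma> x)" for x by (simp add: sig_apply blin_simps pP)
  have Lsig: "Lam (\<sigma> x) = \<sigma> (Lam x)" for x by (rule Lam_commute[OF rop_clinear[OF rsig] sigP])
  have w_apply: "w x = Lam (\<sigma> x)" for x by (simp add: w_def)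
  have adj_w: "w\<^sup>\<dagger> x = - w x" for x by (simp add: w_def adj_compose adj_sig adj_Lam blin_simps Lsig)
  have ww: "w (w x) = - x" for x by (simp add: w_apply Lsig sigsig Lam_Lam)
  have "w \<in> bogU"
  proof (rule bogUI[OF bog_HSI])
    show "rop w" unfolding w_def by (intro rop_intros rop_Lam rsig)
    show "norm (w x) = norm x" for x
    proof -
      have "w x \<bullet> w x = x \<bullet> x" using adj_left[of w "w x" x] by (simp add: adj_w ww)
      then show ?thesis by (simp add: norm_eq_sqrt_inner)
    qed
    have "pcomm w = 0" by (simp add: pcomm_zero_iff w_apply sigP Lam_P)
    then show "is_hs (pcomm w)" by (simp add: is_hs_zero)
    show "y = 0" if "w\<^sup>\<dagger> y = 0" for y using that ww[of y] by (simp add: adj_w blin_simps)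
  qed
  have w0: "w x \<bullet> x = 0" for x
  proof -
    have "w x \<bullet> x = - (w x \<bullet> x)" using adj_left[of w x x] by (simp add: adj_w inner_commute)
    then show ?thesis by simp
  qed
  have "linked w id_blinfun" by (rule linked_inner_nonneg[OF \<open>w \<in> bogU\<close> id_bogU]) (simp add: w0)
  moreover have "linked D w"
  proof (rule linked_inner_nonneg[OF D \<open>w \<in> bogU\<close>])
    fix x
    have a: "D x \<bullet> w x = - (w (D x) \<bullet> x)" using adj_left[of w "D x" x] by (simp add: adj_w)
    have "w (D\<^sup>\<dagger> x) \<bullet> x = - (D\<^sup>\<dagger> x \<bullet> w x)" using adj_left[of w "D\<^sup>\<dagger> x" x] by (simp add: adj_w)
    also have "\<dots> = - (x \<bullet> D (w x))" by (simp add: adj_left)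
    also have "D (w x) = w (D x)" by (simp add: w_apply sig_apply blin_simps L pD)
    finally have b: "w (D\<^sup>\<dagger> x) \<bullet> x = - (w (D x) \<bullet> x)" by (simp add: inner_commute)
    have "r x = (-1/2) *\<^sub>R (w (D x) - w (D\<^sup>\<dagger> x))"
      unfolding sigs[symmetric] by (simp add: s_apply w_apply blin_simps Lsig)
    then have "x \<bullet> r x = (-1/2) * (w (D x) \<bullet> x - w (D\<^sup>\<dagger> x) \<bullet> x)"
      by (simp add: inner_diff inner_commute)
    then show "0 \<le> D x \<bullet> w x" using r_pos[of x] a b by simp
  qed
  ultimately show ?thesis by (rule linked_trans[rotated])
qed

definition ker11 :: "('a \<Rightarrow>\<^sub>L 'a) \<Rightarrow> 'a set" where
  "ker11 V = {x. P x = x \<and> P (V x) = 0}"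

lemma ker11_eq_ker: "ker_on S1 (block11 P V) = ker11 V"
  by (auto simp: ker_on_def ker11_def block11_def in_range_P)

lemma fredholm:
  assumes "V \<in> bog_HS J P" shows "complementary_hs S1 (P \<odot> V) (Q \<odot> V \<odot> P)"
proof
  show "closed S1" "subspace S1" using S1 csubspace_imp_subspace by auto
  show "is_hs (Q \<odot> V \<odot> P)" using assms by (intro is_hs_block21 bog_HS_hs)
  show "(norm ((P \<odot> V) x))\<^sup>2 + (norm ((Q \<odot> V \<odot> P) x))\<^sup>2 = (norm x)\<^sup>2" if "x \<in> S1" for x
    using norm_PQ[of "V x"] bog_HS_norm[OF assms, of x] that in_range_P by auto
qed

lemma block11_bddbelow:
  assumes V: "V \<in> bog_HS J P" and inj: "ker11 V = {0}"
  shows "\<exists>c>0. \<forall>x. P x = x \<longrightarrow> c * norm x \<le> norm (P (V x))"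
proof -
  interpret complementary_hs S1 "P \<odot> V" "Q \<odot> V \<odot> P" by (rule fredholm[OF V])
  have "bddbelow (P \<odot> V) S1"
    by (rule bddbelow_if_injective) (use inj in_range_P in \<open>auto simp: ker11_def\<close>)
  then show ?thesis unfolding bddbelow_def using in_range_P by (metis blinfun_apply_blinfun_compose)
qed

text \<open>\<open>J U\<^sup>\<dagger>\<close> carries the cokernel of the first diagonal block of \<open>U\<close> into its kernel.\<close>

lemma ker11_adj_zero:
  assumes U: "U \<in> bogU" and K: "ker11 U = {0}" and y: "P y = y" "P (U\<^sup>\<dagger> y) = 0"
  shows "y = 0"
proof -
  have r: "rop U" by (rule bog_HS_rop[OF bogU_HS[OF U]])
  let ?z = "J (U\<^sup>\<dagger> y)"
  have "P ?z = ?z" using J_S2[OF y(2)] .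
  moreover have "P (U ?z) = 0" using J_S1[OF y(1)] by (simp add: rop_J[OF r] bogU_adj_right[OF U])
  ultimately have "?z \<in> ker11 U" unfolding ker11_def by blast
  then have "U\<^sup>\<dagger> y = 0" unfolding K by simp
  then show ?thesis using bogU_adj_right[OF U, of y] by simp
qed

text \<open>Let \<open>B\<close> and \<open>R\<close> be the diagonal and off-diagonal parts of \<open>U\<close>, and \<open>B = D h\<close> the polar
  decomposition, where \<open>h\<close> is positive and invertible because \<open>B\<close> is bounded below. Unitarity of
  \<open>D\<^sup>\<dagger> U = h + Y\<close> with \<open>Y = D\<^sup>\<dagger> R\<close> forces \<open>Y\<close> to be skew-adjoint. Hence \<open>U x \<bullet> D x = x \<bullet> h x \<ge> 0\<close>,
  which joins \<open>U\<close> to \<open>D\<close>, and \<open>D\<close> commutes with \<open>P\<close>.\<close>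

lemma linked_id_if_ker11_zero:
  assumes U: "U \<in> bogU" and KU: "ker11 U = {0}"
  shows "linked U id_blinfun"
proof -
  have UHS: "U \<in> bog_HS J P" by (rule bogU_HS[OF U])
  have rU: "rop U" and rU': "rop (U\<^sup>\<dagger>)" using UHS by (auto intro: rop_adj bog_HS_rop)
  define B where "B = P \<odot> U \<odot> P + Q \<odot> U \<odot> Q"
  define R where "R = U - B"
  have UBR: "U = B + R" by (simp add: R_def)
  have B_apply: "B x = P (U (P x)) + Q (U (Q x))" for x by (simp add: B_def blinfun.add_left)
  have BP: "B (P x) = P (B x)" for x by (simp add: B_apply blin_simps)
  have rB: "rop B"
  proof (rule ropI)
    show "B (scaleC a x) = scaleC a (B x)" for a x
      by (simp add: B_apply blin_simps P_scaleC rop_scaleC[OF rU] scaleC_add_right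
          complex_vector.scale_right_diff_distrib)
    show "B (J x) = J (B x)" for x
      unfolding B_apply by (simp only: P_J Q_J rop_J[OF rU] J_add add.commute)
  qed
  \<comment> \<open>conjugating with the symmetry \<open>P - Q\<close> changes the sign of the off-diagonal part\<close>
  define G where "G = P - Q"
  have GG: "G \<odot> G = id_blinfun" by (rule blinfun_eqI) (simp add: G_def blin_simps)
  have adjG: "G\<^sup>\<dagger> = G" by (simp add: G_def adj_diff)
  have conjU: "G \<odot> U \<odot> G = B - R"
    by (rule blinfun_eqI) (simp add: G_def R_def B_apply blin_simps)
  have iso: "U\<^sup>\<dagger> \<odot> U = id_blinfun" "U \<odot> U\<^sup>\<dagger> = id_blinfun"
    using bog_HS_isometry[OF UHS] U by (auto simp: bogU_def)
  have iso1: "(B - R)\<^sup>\<dagger> \<odot> (B - R) = id_blinfun"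
  proof -
    have "(G \<odot> U \<odot> G)\<^sup>\<dagger> \<odot> (G \<odot> U \<odot> G) = G \<odot> (U\<^sup>\<dagger> \<odot> ((G \<odot> G) \<odot> (U \<odot> G)))"
      by (simp only: adj_compose adjG bmul_assoc)
    also have "\<dots> = G \<odot> ((U\<^sup>\<dagger> \<odot> U) \<odot> G)" by (simp only: GG bmul_id bmul_assoc)
    finally show ?thesis unfolding conjU by (simp only: iso GG bmul_id)
  qed
  have iso2: "(B - R) \<odot> (B - R)\<^sup>\<dagger> = id_blinfun"
  proof -
    have "(G \<odot> U \<odot> G) \<odot> (G \<odot> U \<odot> G)\<^sup>\<dagger> = G \<odot> (U \<odot> ((G \<odot> G) \<odot> (U\<^sup>\<dagger> \<odot> G)))"
      by (simp only: adj_compose adjG bmul_assoc)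
    also have "\<dots> = G \<odot> ((U \<odot> U\<^sup>\<dagger>) \<odot> G)" by (simp only: GG bmul_id bmul_assoc)
    finally show ?thesis unfolding conjU by (simp only: iso GG bmul_id)
  qed
  have two: "X = 0" if "2 *\<^sub>R X = 0" for X :: "'a \<Rightarrow>\<^sub>L 'a" using that by simp
  have off1: "B\<^sup>\<dagger> \<odot> R + R\<^sup>\<dagger> \<odot> B = 0"
  proof (rule two)
    have "2 *\<^sub>R (B\<^sup>\<dagger> \<odot> R + R\<^sup>\<dagger> \<odot> B) = U\<^sup>\<dagger> \<odot> U - (B - R)\<^sup>\<dagger> \<odot> (B - R)"
      unfolding UBR by (simp add: adj_simps bmul_distribs scaleR_2)
    then show "2 *\<^sub>R (B\<^sup>\<dagger> \<odot> R + R\<^sup>\<dagger> \<odot> B) = 0" by (simp only: iso iso1 diff_self)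
  qed
  have off2: "B \<odot> R\<^sup>\<dagger> + R \<odot> B\<^sup>\<dagger> = 0"
  proof (rule two)
    have "2 *\<^sub>R (B \<odot> R\<^sup>\<dagger> + R \<odot> B\<^sup>\<dagger>) = U \<odot> U\<^sup>\<dagger> - (B - R) \<odot> (B - R)\<^sup>\<dagger>"
      unfolding UBR by (simp add: adj_simps bmul_distribs scaleR_2)
    then show "2 *\<^sub>R (B \<odot> R\<^sup>\<dagger> + R \<odot> B\<^sup>\<dagger>) = 0" by (simp only: iso iso2 diff_self)
  qed
  have diag: "B\<^sup>\<dagger> \<odot> B = id_blinfun - R\<^sup>\<dagger> \<odot> R"
  proof -
    have "2 *\<^sub>R (B\<^sup>\<dagger> \<odot> B + R\<^sup>\<dagger> \<odot> R - id_blinfun) = U\<^sup>\<dagger> \<odot> U + (B - R)\<^sup>\<dagger> \<odot> (B - R) - 2 *\<^sub>R id_blinfun"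
      unfolding UBR by (simp add: adj_simps bmul_distribs scaleR_2)
    then have "2 *\<^sub>R (B\<^sup>\<dagger> \<odot> B + R\<^sup>\<dagger> \<odot> R - id_blinfun) = 0" by (simp only: iso iso1) (simp add: scaleR_2)
    then have "B\<^sup>\<dagger> \<odot> B + R\<^sup>\<dagger> \<odot> R - id_blinfun = 0" by (rule two)
    then show ?thesis by (simp add: algebra_simps)
  qed
  obtain c0 where c0: "c0 > 0" "\<And>x. P x = x \<Longrightarrow> c0 * norm x \<le> norm (P (U x))"
    using block11_bddbelow[OF UHS KU] by blast
  define c where "c = min c0 1"
  have c: "0 < c" "c \<le> 1" and cP: "\<And>x. P x = x \<Longrightarrow> c * norm x \<le> norm (P (U x))"
  proof -
    show "0 < c" "c \<le> 1" using c0(1) by (auto simp: c_def)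
    fix x assume "P x = x"
    have "c * norm x \<le> c0 * norm x" by (intro mult_right_mono) (auto simp: c_def)
    then show "c * norm x \<le> norm (P (U x))" using c0(2)[OF \<open>P x = x\<close>] by simp
  qed
  have normB: "c\<^sup>2 * (norm x)\<^sup>2 \<le> (norm (B x))\<^sup>2" for x
  proof -
    have "P (B x) = P (U (P x))" "Q (B x) = Q (U (Q x))" by (simp_all add: B_apply blin_simps)
    then have "(norm (B x))\<^sup>2 = (norm (P (U (P x))))\<^sup>2 + (norm (Q (U (Q x))))\<^sup>2"
      using norm_PQ[of "B x"] by simp
    also have "norm (Q (U (Q x))) = norm (P (U (P (J x))))"
    proof -
      have "P (U (P (J x))) = J (Q (U (Q x)))" by (simp only: P_J rop_J[OF rU])
      then show ?thesis by simp
    qed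
    finally have eq: "(norm (B x))\<^sup>2 = (norm (P (U (P x))))\<^sup>2 + (norm (P (U (P (J x)))))\<^sup>2" .
    have "(c * norm (P x))\<^sup>2 \<le> (norm (P (U (P x))))\<^sup>2"
      using c by (intro power_mono cP) auto
    moreover have "(c * norm (P (J x)))\<^sup>2 \<le> (norm (P (U (P (J x)))))\<^sup>2"
      using c by (intro power_mono cP) auto
    moreover have "norm (P (J x)) = norm (Q x)" by (simp only: P_J norm_J)
    ultimately have "c\<^sup>2 * (norm (P x))\<^sup>2 + c\<^sup>2 * (norm (Q x))\<^sup>2 \<le> (norm (B x))\<^sup>2"
      unfolding eq by (simp add: power_mult_distrib)
    then show ?thesis using norm_PQ[of x] by (simp add: distrib_left)
  qed
  define X where "X = R\<^sup>\<dagger> \<odot> R"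
  define \<rho> where "\<rho> = 1 - c\<^sup>2"
  have c2: "c\<^sup>2 \<le> 1" using c by (simp add: power_le_one)
  have rho: "0 \<le> \<rho>" "\<rho> < 1" using c c2 by (auto simp: \<rho>_def)
  have normR: "norm R \<le> sqrt \<rho>"
  proof (rule norm_blinfun_bound)
    fix x
    have "B x \<bullet> B x = x \<bullet> x - R x \<bullet> R x"
    proof -
      have "(B\<^sup>\<dagger> \<odot> B) x \<bullet> x = (id_blinfun - R\<^sup>\<dagger> \<odot> R) x \<bullet> x" using diag by simp
      then show ?thesis by (simp add: adj_left inner_diff blin_simps)
    qed
    then have "(norm (R x))\<^sup>2 \<le> \<rho> * (norm x)\<^sup>2"
      using normB[of x] by (simp add: \<rho>_def power2_norm_eq_inner algebra_simps)
    then have "norm (R x) \<le> sqrt (\<rho> * (norm x)\<^sup>2)" by (rule real_le_rsqrt)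
    then show "norm (R x) \<le> sqrt \<rho> * norm x" by (simp add: real_sqrt_mult)
  qed (use rho in simp)
  have nX: "norm X \<le> \<rho>"
  proof -
    have "norm X \<le> norm (R\<^sup>\<dagger>) * norm R" unfolding X_def by (rule norm_blinfun_compose)
    also have "\<dots> \<le> sqrt \<rho> * sqrt \<rho>" using normR rho by (intro mult_mono) auto
    finally show ?thesis using rho by simp
  qed
  have "X\<^sup>\<dagger> = X" by (simp add: X_def adj_compose)
  then obtain h where h: "h \<odot> h = id_blinfun - X" "h\<^sup>\<dagger> = h" "norm (id_blinfun - h) \<le> norm X"
    "\<And>T. T \<odot> X = X \<odot> T \<Longrightarrow> T \<odot> h = h \<odot> T"
    using operator_square_root[of X] nX rho by (metis le_less_trans less_imp_le)
  have nh: "norm (id_blinfun - h) \<le> \<rho>" using h(3) nX by simp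
  have hh: "h \<odot> h = B\<^sup>\<dagger> \<odot> B" using h(1) diag by (simp add: X_def)
  have h_pos: "0 \<le> x \<bullet> h x" for x
    using inner_ge_of_norm_id_diff[OF nh, of x] rho by (smt (verit) mult_nonneg_nonneg zero_le_power2)
  have hge: "(1 - \<rho>) * norm x \<le> norm (h x)" for x
  proof -
    have "norm x \<le> norm (h x) + norm ((id_blinfun - h) x)"
      using norm_triangle_ineq[of "h x" "x - h x"] by (simp add: blin_simps)
    also have "norm ((id_blinfun - h) x) \<le> \<rho> * norm x"
      by (rule order_trans[OF norm_blinfun]) (intro mult_right_mono nh, simp)
    finally show ?thesis by (simp add: algebra_simps)
  qed
  have "\<exists>g. g \<odot> h = id_blinfun \<and> h \<odot> g = id_blinfun"
  proof (rule bddbelow_invertible)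
    show "bddbelow h UNIV" unfolding bddbelow_def using hge rho by (intro exI[of _ "1 - \<rho>"]) simp
    show "y = 0" if "h\<^sup>\<dagger> y = 0" for y
      using hge[of y] that h(2) rho by (simp add: mult_le_0_iff)
  qed
  then obtain g where g: "g \<odot> h = id_blinfun" "h \<odot> g = id_blinfun" by blast
  have gh: "g (h x) = x" "h (g x) = x" for x
    using g by (metis blinfun_apply_blinfun_compose blinfun_apply_id_blinfun id_apply)+
  have rX: "rop X" unfolding X_def R_def by (intro rop_intros rU rB)
  have "rop h"
    unfolding rop_commute_iff using h(4) rX rop_commute_iff[of X] by metis
  then have rg: "rop g" using g by (rule rop_inverse)
  have adjg: "g\<^sup>\<dagger> = g"
  proof -
    have "g\<^sup>\<dagger> \<odot> h = id_blinfun" using arg_cong[OF g(2), of adj] by (simp add: adj_compose h(2))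
    then have "g\<^sup>\<dagger> \<odot> h \<odot> g = g" by simp
    then show ?thesis by (simp add: bmul_assoc g(2))
  qed
  have BP': "B\<^sup>\<dagger> (P x) = P (B\<^sup>\<dagger> x)" for x
  proof -
    have "P \<odot> B = B \<odot> P" by (rule blinfun_eqI) (simp add: BP)
    then have "(P \<odot> B)\<^sup>\<dagger> = (B \<odot> P)\<^sup>\<dagger>" by simp
    then show ?thesis by (simp add: adj_compose) (metis blinfun_apply_blinfun_compose)
  qed
  have hP: "P \<odot> h = h \<odot> P"
  proof (rule h(4))
    have "X = id_blinfun - B\<^sup>\<dagger> \<odot> B" using diag by (simp add: X_def)
    then show "P \<odot> X = X \<odot> P" by (intro blinfun_eqI) (simp add: blin_simps BP BP')
  qed
  have gP: "g (P x) = P (g x)" for x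
    using blinfun_commute_apply[OF hP, of "g x"] gh by metis
  define D where "D = B \<odot> g"
  have adjD: "D\<^sup>\<dagger> = g \<odot> B\<^sup>\<dagger>" by (simp add: D_def adj_compose adjg)
  have "D\<^sup>\<dagger> \<odot> D = id_blinfun"
  proof -
    have "D\<^sup>\<dagger> \<odot> D = (g \<odot> B\<^sup>\<dagger>) \<odot> D" by (simp only: adjD)
    also have "\<dots> = g \<odot> ((B\<^sup>\<dagger> \<odot> B) \<odot> g)" by (simp only: D_def bmul_assoc)
    also have "\<dots> = (g \<odot> h) \<odot> (h \<odot> g)" unfolding hh[symmetric] by (simp only: bmul_assoc)
    finally show ?thesis by (simp add: g)
  qed
  moreover have pD: "pcomm D = 0" by (simp add: pcomm_zero_iff D_def BP gP)
  moreover have "rop D" unfolding D_def by (intro rop_intros rB rg)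
  ultimately have DHS: "D \<in> bog_HS J P" by (simp add: bog_HS_iff is_hs_zero)
  have DU: "D \<in> bogU"
  proof (rule bogUI[OF DHS])
    fix y assume "D\<^sup>\<dagger> y = 0"
    then have "h (g (B\<^sup>\<dagger> y)) = 0" by (simp add: adjD blin_simps)
    then have B0: "B\<^sup>\<dagger> y = 0" by (simp add: gh)
    have adjB: "B\<^sup>\<dagger> y = P (U\<^sup>\<dagger> (P y)) + Q (U\<^sup>\<dagger> (Q y))"
      unfolding B_def adj_add adj_compose adj_P adj_Q
      by (simp only: blinfun.add_left blinfun_apply_blinfun_compose)
    have "P (B\<^sup>\<dagger> y) = P (U\<^sup>\<dagger> (P y))" "Q (B\<^sup>\<dagger> y) = Q (U\<^sup>\<dagger> (Q y))" unfolding adjB by (simp_all add: blin_simps)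
    then have 0: "P (U\<^sup>\<dagger> (P y)) = 0" "Q (U\<^sup>\<dagger> (Q y)) = 0" using B0 by (simp_all add: blin_simps)
    have "P y = 0" by (rule ker11_adj_zero[OF U KU]) (use 0 in auto)
    moreover have "P (J y) = 0"
    proof (rule ker11_adj_zero[OF U KU])
      show "P (U\<^sup>\<dagger> (P (J y))) = 0" unfolding P_J rop_J[OF rU'] using 0(2) by simp
    qed simp
    then have "Q y = 0" by (simp add: P_J)
    ultimately show "y = 0" by (simp add: blin_simps)
  qed
  have DD: "D \<odot> D\<^sup>\<dagger> = id_blinfun" using DU by (simp add: bogU_def)
  define Y where "Y = D\<^sup>\<dagger> \<odot> R"
  have hD: "D\<^sup>\<dagger> \<odot> B = h"
  proof -
    have "D\<^sup>\<dagger> \<odot> B = g \<odot> (h \<odot> h)" by (simp add: adjD bmul_assoc hh)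
    then show ?thesis by (simp add: bmul_assoc[symmetric] g)
  qed
  have hD': "B\<^sup>\<dagger> \<odot> D = h" using arg_cong[OF hD, of adj] by (simp add: adj_compose h(2))
  have adjY: "Y\<^sup>\<dagger> = R\<^sup>\<dagger> \<odot> D" by (simp add: Y_def adj_compose)
  have "h \<odot> Y + Y\<^sup>\<dagger> \<odot> h = 0"
  proof -
    have "h \<odot> Y = B\<^sup>\<dagger> \<odot> ((D \<odot> D\<^sup>\<dagger>) \<odot> R)" unfolding hD'[symmetric] Y_def by (simp only: bmul_assoc)
    moreover have "Y\<^sup>\<dagger> \<odot> h = R\<^sup>\<dagger> \<odot> ((D \<odot> D\<^sup>\<dagger>) \<odot> B)" unfolding adjY hD[symmetric] by (simp only: bmul_assoc)
    ultimately show ?thesis using off1 by (simp add: DD)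
  qed
  moreover have "h \<odot> Y\<^sup>\<dagger> + Y \<odot> h = 0"
  proof -
    have "h \<odot> Y\<^sup>\<dagger> = D\<^sup>\<dagger> \<odot> ((B \<odot> R\<^sup>\<dagger>) \<odot> D)" unfolding adjY hD[symmetric] by (simp only: bmul_assoc)
    moreover have "Y \<odot> h = D\<^sup>\<dagger> \<odot> ((R \<odot> B\<^sup>\<dagger>) \<odot> D)" unfolding hD'[symmetric] Y_def by (simp only: bmul_assoc)
    ultimately have "h \<odot> Y\<^sup>\<dagger> + Y \<odot> h = D\<^sup>\<dagger> \<odot> ((B \<odot> R\<^sup>\<dagger> + R \<odot> B\<^sup>\<dagger>) \<odot> D)"
      by (simp only: bmul_distribs)
    then show ?thesis by (simp add: off2)
  qed
  ultimately have "(h \<odot> Y + Y\<^sup>\<dagger> \<odot> h) + (h \<odot> Y\<^sup>\<dagger> + Y \<odot> h) = 0" by simp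
  then have syl: "h \<odot> (Y + Y\<^sup>\<dagger>) + (Y + Y\<^sup>\<dagger>) \<odot> h = 0"
    by (simp only: bmul_distribs add_ac)
  \<comment> \<open>a Sylvester equation with \<open>h\<close> close to the identity has only the trivial solution\<close>
  define Z where "Z = Y + Y\<^sup>\<dagger>"
  have "2 *\<^sub>R Z = (id_blinfun - h) \<odot> Z + Z \<odot> (id_blinfun - h)"
    using syl unfolding Z_def[symmetric] by (simp add: bmul_distribs scaleR_2 algebra_simps)
  then have "norm (2 *\<^sub>R Z) \<le> norm ((id_blinfun - h) \<odot> Z) + norm (Z \<odot> (id_blinfun - h))"
    by (simp only: norm_triangle_ineq)
  also have "\<dots> \<le> norm (id_blinfun - h) * norm Z + norm Z * norm (id_blinfun - h)"
    by (intro add_mono norm_blinfun_compose)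
  also have "\<dots> \<le> \<rho> * norm Z + norm Z * \<rho>"
    using nh by (intro add_mono mult_left_mono mult_right_mono) auto
  finally have "(1 - \<rho>) * norm Z \<le> 0" by (simp add: algebra_simps)
  then have Z0: "Z = 0" using rho by (simp add: mult_le_0_iff)
  have "linked U D"
  proof (rule linked_inner_nonneg[OF U DU])
    fix x
    have "Y x \<bullet> x = 0"
    proof -
      have "Y x \<bullet> x + Y\<^sup>\<dagger> x \<bullet> x = Z x \<bullet> x" by (simp add: Z_def blin_simps inner_add)
      moreover have "Y\<^sup>\<dagger> x \<bullet> x = Y x \<bullet> x" unfolding adj_left by (rule inner_commute)
      ultimately show ?thesis using Z0 by simp
    qed
    moreover have "U x \<bullet> D x = (D\<^sup>\<dagger> \<odot> B) x \<bullet> x + Y x \<bullet> x"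
    proof -
      have "U x = B x + R x" by (simp add: R_def blinfun.diff_left)
      then show ?thesis by (simp only: Y_def blinfun_apply_blinfun_compose adj_left inner_add_left)
    qed
    ultimately show "0 \<le> U x \<bullet> D x" unfolding hD using h_pos[of x] by (simp add: inner_commute)
  qed
  moreover have "linked D id_blinfun" by (rule linked_diagonal[OF DU pD])
  ultimately show ?thesis by (rule linked_trans)
qed

end


section \<open>Reflections\<close>

text \<open>The complex rank-one operator \<open>x \<mapsto> \<langle>v, x\<rangle> w\<close>, as a sum of two real ones so that their
  Hilbert--Schmidt bounds apply.\<close>

definition crank :: "'a::complex_inner \<Rightarrow> 'a \<Rightarrow> 'a \<Rightarrow>\<^sub>L 'a" where
  "crank v w = rank_one v w + rank_one (scaleC \<i> v) (scaleC \<i> w)"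

lemma crank_apply: "crank v w x = scaleC (cinner v x) w"
proof -
  have "scaleC \<i> v \<bullet> x = Im (cinner v x)"
    by (simp add: Re_cinner[symmetric] cinner_scaleC_left)
  then have "crank v w x = scaleC (complex_of_real (Re (cinner v x))) w +
      scaleC (complex_of_real (Im (cinner v x))) (scaleC \<i> w)"
    by (simp only: crank_def blinfun.add_left rank_one_apply Re_cinner scaleC_of_real)
  also have "\<dots> = scaleC (complex_of_real (Re (cinner v x)) + \<i> * complex_of_real (Im (cinner v x))) w"
    by (simp add: scaleC_scaleC scaleC_add_left mult.commute)
  finally show ?thesis by (simp add: complex_eq[symmetric])
qed

lemma hs_le_crank: "hs_le (crank v w :: 'a::chilbert_space \<Rightarrow>\<^sub>L 'a) (2 * (norm v * norm w))"
  using hs_le_add[OF hs_le_rank_one[of v w] hs_le_rank_one[of "scaleC \<i> v" "scaleC \<i> w"]]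
  by (simp add: crank_def norm_scaleC)

lemma hs_le_imp_norm_le:
  assumes "hs_le A C" shows "norm A \<le> C"
proof (rule norm_blinfun_bound)
  show "0 \<le> C" by (rule hs_le_nonneg[OF assms])
  fix x show "norm (A x) \<le> C * norm x"
  proof (cases "x = 0")
    case False
    have "orthon {(1 / norm x) *\<^sub>R x}" using orthon_insert_normalized[of "{}" x] False by simp
    then have "norm (A ((1 / norm x) *\<^sub>R x)) \<le> C" using hs_leD[OF assms, of "{(1 / norm x) *\<^sub>R x}"] by simp
    then show ?thesis using False by (simp add: blin_simps field_simps)
  qed (simp add: blin_simps)
qed

lemma abs_cos_diff_le: "\<bar>cos s - cos t\<bar> \<le> \<bar>s - t :: real\<bar>"
proof -
  have "cos s - cos t = 2 * (sin ((s + t) / 2) * sin ((t - s) / 2))"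
    by (simp add: cos_diff_cos)
  then have "\<bar>cos s - cos t\<bar> = 2 * (\<bar>sin ((s + t) / 2)\<bar> * \<bar>sin ((t - s) / 2)\<bar>)" by (simp add: abs_mult)
  also have "\<dots> \<le> 2 * (1 * \<bar>(t - s) / 2\<bar>)"
    by (intro mult_left_mono mult_mono abs_sin_le_one abs_sin_x_le_abs_x) auto
  finally show ?thesis by simp
qed

lemma abs_sin_diff_le: "\<bar>sin s - sin t\<bar> \<le> \<bar>s - t :: real\<bar>"
  using abs_cos_diff_le[of "pi / 2 - s" "pi / 2 - t"] by (simp add: cos_diff abs_minus_commute)

lemma cdim_kernel_functional:
  assumes S: "csubspace (S :: 'a::complex_inner set)" and fin: "finite B0" "S \<subseteq> cspan B0"
    and x: "x \<in> S" "cinner u x \<noteq> 0"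
  shows "cdim S = Suc (cdim {x\<in>S. cinner u x = 0})"
proof -
  let ?T = "{x\<in>S. cinner u x = 0}"
  have T: "csubspace ?T"
    using S by (auto simp: complex_vector.subspace_def cinner_simps)
  obtain B where B: "B \<subseteq> ?T" "cindependent B" "?T \<subseteq> cspan B" "card B = cdim ?T"
    using complex_vector.basis_exists by blast
  have "finite B" using complex_vector.independent_span_bound[OF fin(1) B(2)] B(1) fin(2) by blast
  have spB: "cspan B = ?T" using B(3) complex_vector.span_minimal[OF B(1) T] by blast
  then have nx: "x \<notin> cspan B" using x by simp
  then have ind: "cindependent (insert x B)" using B(2) complex_vector.independent_insertI by blast
  have "y \<in> cspan (insert x B)" if y: "y \<in> S" for y
  proof -
    let ?a = "cinner u y / cinner u x"
    have "y - scaleC ?a x \<in> ?T"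
      using y x S complex_vector.subspace_diff[OF S] complex_vector.subspace_scale[OF S] by (auto simp: cinner_simps)
    then show ?thesis unfolding complex_vector.span_breakdown_eq spB by blast
  qed
  moreover have "cspan (insert x B) \<subseteq> S"
    by (rule complex_vector.span_minimal[OF _ S]) (use B(1) x in auto)
  ultimately have "cspan (insert x B) = S" by blast
  then have "cspan (insert x B) = cspan S" using S by (metis complex_vector.span_span)
  then have "cdim S = card (insert x B)" using complex_vector.dim_eq_card[OF _ ind] by blast
  also have "\<dots> = Suc (card B)"
    using \<open>finite B\<close> nx complex_vector.span_base by (metis card_insert_disjoint)
  finally show ?thesis using B(4) by simp
qed

context basis_projection_setting
begin

definition unit1 :: "'a \<Rightarrow> bool" where "unit1 e \<longleftrightarrow> P e = e \<and> norm e = 1"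

text \<open>For a unit vector \<open>e\<close> in the range of \<open>P\<close> this is the reflection in the hyperplane orthogonal to
  \<open>e - J e\<close>; it exchanges \<open>e\<close> and \<open>J e\<close>.\<close>

definition reflection :: "'a \<Rightarrow> 'a \<Rightarrow>\<^sub>L 'a" where
  "reflection e = id_blinfun - crank (e - J e) (e - J e)"

lemma reflection_apply: "reflection e x = x - scaleC (cinner (e - J e) x) (e - J e)"
  by (simp add: reflection_def blinfun.diff_left crank_apply)

lemma cinner_S1_S2: "P x = x \<Longrightarrow> P y = 0 \<Longrightarrow> cinner x y = 0" "P x = x \<Longrightarrow> P y = 0 \<Longrightarrow> cinner y x = 0"
  using cinner_P[of x y] cinner_P[of y x] by simp_all

lemma unit1D:
  assumes "unit1 e" shows "P e = e" "cinner e e = 1" "P (J e) = 0" "cinner (J e) (J e) = 1"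
    "cinner e (J e) = 0" "cinner (J e) e = 0"
proof -
  show P: "P e = e" and "cinner e e = 1" using assms by (auto simp: unit1_def cinner_self)
  then show "cinner (J e) (J e) = 1" by (simp add: cinner_J_J)
  show PJ: "P (J e) = 0" by (rule J_S1[OF P])
  show "cinner e (J e) = 0" "cinner (J e) e = 0" using cinner_S1_S2[OF P PJ] by auto
qed

lemma norm_reflection_vector: assumes "unit1 e" shows "cinner (e - J e) (e - J e) = 2"
  by (simp add: cinner_simps unit1D[OF assms])

lemma reflection_involution: assumes "unit1 e" shows "reflection e (reflection e x) = x"
proof -
  let ?v = "e - J e"
  have "cinner ?v (x - scaleC (cinner ?v x) ?v) = - cinner ?v x"
    using norm_reflection_vector[OF assms] by (simp only: cinner_diff_right[of ?v x] cinner_scaleC_right) simp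
  then show ?thesis unfolding reflection_apply[of e "reflection e x"] by (simp add: reflection_apply complex_vector.scale_minus_left)
qed

lemma pcomm_crank: "pcomm (crank v w) = crank (P v) w - crank v (P w)"
  by (rule blinfun_eqI) (simp add: pcomm_apply blinfun.diff_left crank_apply cinner_P P_scaleC)

lemma pbd_crank: "pbd (crank v w) (2 * (norm v * norm w)) (4 * (norm v * norm w))"
  unfolding pbd_def
proof
  show "norm (crank v w) \<le> 2 * (norm v * norm w)" by (rule hs_le_imp_norm_le[OF hs_le_crank])
  have "hs_le (pcomm (crank v w)) (2 * (norm (P v) * norm w) + 2 * (norm v * norm (P w)))"
    unfolding pcomm_crank by (intro hs_le_diff hs_le_crank)
  moreover have "norm (P v) * norm w \<le> norm v * norm w" "norm v * norm (P w) \<le> norm v * norm w"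
    by (intro mult_right_mono mult_left_mono norm_P_apply_le norm_ge_zero)+
  ultimately show "hs_le (pcomm (crank v w)) (4 * (norm v * norm w))" by (auto intro: hs_le_mono)
qed

lemma reflection_bogU: assumes "unit1 e" shows "reflection e \<in> bogU"
proof -
  let ?v = "e - J e"
  have adj: "(reflection e)\<^sup>\<dagger> = reflection e"
  proof (rule adj_unique)
    fix x y
    have "cinner (reflection e x) y = cinner x (reflection e y)"
      unfolding reflection_apply
      by (simp only: cinner_diff_left[of x] cinner_diff_right[of x y] cinner_scaleC_left cinner_scaleC_right)
         (simp add: cinner_commute[of ?v x] mult.commute)
    then show "reflection e x \<bullet> y = x \<bullet> reflection e y" by (metis Re_cinner)
  qed
  have rr: "reflection e \<odot> reflection e = id_blinfun" by (rule blinfun_eqI) (simp add: reflection_involution[OF assms])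
  have "rop (reflection e)"
  proof (rule ropI)
    show "reflection e (scaleC a x) = scaleC a (reflection e x)" for a x
      by (simp add: reflection_apply cinner_scaleC_right scaleC_scaleC complex_vector.scale_right_diff_distrib)
    fix x
    have "cinner ?v (J x) = - cnj (cinner ?v x)"
    proof -
      have "cinner ?v (J x) = cnj (cinner (J ?v) x)" by (metis J_J cinner_J_J)
      also have "J ?v = - ?v" by (simp add: J_diff)
      finally show ?thesis by (simp only: cinner_minus_left complex_cnj_minus)
    qed
    moreover have "J (scaleC (cinner ?v x) ?v) = scaleC (- cnj (cinner ?v x)) ?v"
      by (simp only: J_scaleC) (simp add: J_diff complex_vector.scale_right_diff_distrib)
    ultimately show "reflection e (J x) = J (reflection e x)" unfolding reflection_apply by (simp only: J_diff[of x])
  qed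
  moreover have "is_hs (pcomm (reflection e))"
    unfolding reflection_def pcomm_diff is_hs_def using hs_le_diff[OF _ ] pbd_crank hs_le_zero
    by (metis pbd_def pbd_diff pbd_id pcomm_diff)
  ultimately show ?thesis using rr adj by (simp add: bogU_def bog_HS_iff)
qed

text \<open>\<open>V\<close> maps \<open>e - J e\<close> to a vector that is again odd under \<open>J\<close>, hence of the form \<open>f - J f\<close>.\<close>

lemma reflection_conj:
  assumes V: "V \<in> bog_HS J P" and e: "unit1 e"
  shows "unit1 (P (V (e - J e)))" "V \<odot> reflection e = reflection (P (V (e - J e))) \<odot> V"
proof -
  let ?v = "e - J e"
  let ?f = "P (V ?v)"
  have "J (V ?v) = - V ?v" using rop_J[OF bog_HS_rop[OF V], of ?v, symmetric] by (simp add: J_diff blin_simps)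
  then have "P (J (V ?v)) = - ?f" by (simp add: blin_simps)
  then have "J (Q (V ?v)) = - ?f" by (simp only: P_J)
  then have "Q (V ?v) = - J ?f" by (metis J_J J_minus)
  then have Vv: "V ?v = ?f - J ?f" using blinfun.diff_left[of id_blinfun P "V ?v"] by (simp add: algebra_simps)
  show u: "unit1 ?f"
  proof -
    have "cinner (V ?v) (V ?v) = 2" using bog_HS_cinner[OF V] norm_reflection_vector[OF e] by simp
    moreover have "cinner (V ?v) (V ?v) = cinner ?f ?f + cinner (J ?f) (J ?f)"
    proof -
      have "P ?f = ?f" by simp
      moreover have "P (J ?f) = 0" by (rule J_S1) simp
      ultimately have "cinner ?f (J ?f) = 0" "cinner (J ?f) ?f = 0" by (rule cinner_S1_S2)+
      then show ?thesis by (subst (1 2) Vv) (simp only: cinner_diff_left cinner_diff_right, simp)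
    qed
    ultimately have "2 * cinner ?f ?f = 2" by (simp add: cinner_J_J cinner_self)
    then have "(norm ?f)\<^sup>2 = 1" by (simp add: cinner_self flip: of_real_power)
    then have "norm ?f = 1 \<or> norm ?f = - 1" by (simp add: power2_eq_1_iff)
    then have "norm ?f = 1" using norm_ge_zero[of ?f] by linarith
    then show ?thesis by (simp add: unit1_def)
  qed
  show "V \<odot> reflection e = reflection ?f \<odot> V"
  proof (rule blinfun_eqI)
    fix x
    have "(V \<odot> reflection e) x = V x - scaleC (cinner ?v x) (V ?v)"
      by (simp only: blinfun_apply_blinfun_compose reflection_apply blinfun.diff_right[of V x]
          rop_scaleC[OF bog_HS_rop[OF V]])
    also have "cinner ?v x = cinner (V ?v) (V x)" by (simp only: bog_HS_cinner[OF V])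
    finally show "(V \<odot> reflection e) x = (reflection ?f \<odot> V) x"
      unfolding blinfun_apply_blinfun_compose reflection_apply Vv[symmetric] .
  qed
qed

lemma pbd_reflection_diff:
  assumes "unit1 e" "unit1 f"
  shows "bog_dist P (reflection e) (reflection f) \<le> 48 * norm (e - f)"
proof -
  let ?v = "e - J e" and ?w = "f - J f"
  have v: "norm ?v \<le> 2" "norm ?w \<le> 2"
    using norm_triangle_ineq4[of e "J e"] norm_triangle_ineq4[of f "J f"] assms by (auto simp: unit1_def)
  have wv: "norm (?w - ?v) \<le> 2 * norm (e - f)"
  proof -
    have "?w - ?v = J (e - f) - (e - f)" by (simp add: J_diff)
    then show ?thesis using norm_triangle_ineq4[of "J (e - f)" "e - f"] by (simp only: norm_J mult_2)
  qed
  have eq: "reflection e - reflection f = crank (?w - ?v) ?w + crank ?v (?w - ?v)"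
  proof (rule blinfun_eqI)
    fix x
    show "(reflection e - reflection f) x = (crank (?w - ?v) ?w + crank ?v (?w - ?v)) x"
      unfolding blinfun.diff_left blinfun.add_left crank_apply reflection_apply
      by (simp only: cinner_diff_left[of ?w ?v] complex_vector.scale_left_diff_distrib
          complex_vector.scale_right_diff_distrib[of _ ?w ?v]) simp
  qed
  have b: "pbd (reflection e - reflection f)
      (2 * (norm (?w - ?v) * norm ?w) + 2 * (norm ?v * norm (?w - ?v)))
      (4 * (norm (?w - ?v) * norm ?w) + 4 * (norm ?v * norm (?w - ?v)))"
    unfolding eq by (intro pbd_add pbd_crank)
  have m: "norm (?w - ?v) * norm ?w \<le> (2 * norm (e - f)) * 2" "norm ?v * norm (?w - ?v) \<le> 2 * (2 * norm (e - f))"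
    by (intro mult_mono v wv; simp)+
  show ?thesis using pbd_bog_dist[OF b] m by linarith
qed

text \<open>Rotate \<open>e\<close> to \<open>f\<close> in the real plane that they span.\<close>

lemma linked_reflections:
  assumes e: "unit1 e" and f: "unit1 f"
  shows "linked (reflection e) (reflection f)"
proof -
  define a where "a = e \<bullet> f"
  define r where "r = f - a *\<^sub>R e"
  have ee: "e \<bullet> e = 1" "f \<bullet> f = 1" using e f by (auto simp: unit1_def norm_eq_sqrt_inner)
  have re: "e \<bullet> r = 0" by (simp add: r_def inner_diff a_def ee)
  have rr: "r \<bullet> r = 1 - a\<^sup>2"
    by (simp add: r_def inner_diff ee a_def inner_commute power2_eq_square)
  define g where "g = (if r = 0 then 0 else (1 / norm r) *\<^sub>R r)"
  have fe: "f = a *\<^sub>R e + norm r *\<^sub>R g" by (simp add: g_def r_def)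
  have "a\<^sup>2 + (norm r)\<^sup>2 = 1" using rr by (simp add: power2_norm_eq_inner)
  then obtain \<theta> where t: "0 \<le> \<theta>" "a = cos \<theta>" "norm r = sin \<theta>" using sincos_total_2pi by metis
  have Pg: "P g = g"
    using e f by (auto simp: g_def r_def unit1_def blin_simps)
  show ?thesis
  proof (cases "r = 0")
    case True
    then have "a\<^sup>2 = 1" using rr by simp
    then have "f = e \<or> f = - e" using True by (auto simp: r_def power2_eq_1_iff)
    moreover have "reflection (- e) = reflection e"
      by (rule blinfun_eqI) (simp add: reflection_apply J_minus cinner_diff_left cinner_minus_left
          complex_vector.scale_right_diff_distrib complex_vector.scale_left_diff_distrib)
    ultimately show ?thesis using linked_refl[OF bogU_HS[OF reflection_bogU[OF e]]] by auto
  next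
    case False
    then have gg: "g \<bullet> g = 1" "e \<bullet> g = 0"
      using re by (auto simp: g_def dot_square_norm power2_eq_square)
    define p where "p t = cos t *\<^sub>R e + sin t *\<^sub>R g" for t
    have up: "unit1 (p t)" for t
    proof -
      have "p t \<bullet> p t = 1"
        using gg ee by (simp add: p_def inner_add inner_commute power2_eq_square[symmetric])
      moreover have "P (p t) = p t" using Pg e by (simp add: p_def unit1_def blin_simps)
      ultimately show ?thesis by (simp add: unit1_def norm_eq_sqrt_inner)
    qed
    \<comment> \<open>the path \<open>p\<close> has Lipschitz constant at most \<open>2\<close>, the reflection depends on it with constant \<open>48\<close>\<close>
    have "linked (reflection (p 0)) (reflection (p \<theta>))"
    proof (rule linked_path[where K=96])
      show "reflection (p s) \<in> bog_HS J P" for s by (rule bogU_HS[OF reflection_bogU[OF up]])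
      show "0 \<le> \<theta>" by fact
      fix s t
      have "p s - p t = (cos s - cos t) *\<^sub>R e + (sin s - sin t) *\<^sub>R g" by (simp add: p_def algebra_simps)
      then have "norm (p s - p t) \<le> \<bar>cos s - cos t\<bar> * norm e + \<bar>sin s - sin t\<bar> * norm g"
        by (metis norm_scaleR norm_triangle_ineq)
      also have "\<dots> \<le> \<bar>s - t\<bar> + \<bar>s - t\<bar>"
        using abs_cos_diff_le[of s t] abs_sin_diff_le[of s t] ee gg by (simp add: norm_eq_sqrt_inner)
      finally have "48 * norm (p s - p t) \<le> 48 * (\<bar>s - t\<bar> + \<bar>s - t\<bar>)" by (rule mult_left_mono) simp
      then have "bog_dist P (reflection (p s)) (reflection (p t)) \<le> 48 * (\<bar>s - t\<bar> + \<bar>s - t\<bar>)"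
        by (rule order_trans[OF pbd_reflection_diff[OF up up]])
      then show "bog_dist P (reflection (p s)) (reflection (p t)) \<le> 96 * \<bar>s - t\<bar>" by simp
    qed
    moreover have "p 0 = e" by (simp add: p_def)
    moreover have "p \<theta> = f" using fe t by (simp add: p_def)
    ultimately show ?thesis by simp
  qed
qed


section \<open>The parity of the kernel of the first diagonal block\<close>

lemma csubspace_K: "V \<in> bog_HS J P \<Longrightarrow> csubspace (ker11 V)"
  by (auto simp: ker11_def complex_vector.subspace_def blin_simps P_scaleC rop_scaleC[OF bog_HS_rop])

text \<open>The kernel of the first diagonal block is finite-dimensional by the Fredholm alternative.\<close>

lemma ker11_finite:
  assumes "V \<in> bog_HS J P"
  shows "\<exists>B\<subseteq>ker11 V. finite B \<and> corthon B \<and> cspan B = ker11 V"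
proof -
  interpret complementary_hs S1 "P \<odot> V" "Q \<odot> V \<odot> P" by (rule fredholm[OF assms])
  obtain n where n: "\<And>B. finite B \<Longrightarrow> orthon B \<Longrightarrow> B \<subseteq> {x\<in>S1. (P \<odot> V) x = 0} \<Longrightarrow> card B \<le> n"
    using kernel_orthon_card_bound by blast
  have "ker11 V = {x\<in>S1. (P \<odot> V) x = 0}" using in_range_P by (auto simp: ker11_def)
  then show ?thesis
    using n corthon_imp_orthon by (intro corthon_basis_if_bounded[OF csubspace_K[OF assms], of n]) blast
qed

lemma cdim_ker11_zero:
  assumes V: "V \<in> bog_HS J P" shows "cdim (ker11 V) = 0 \<longleftrightarrow> ker11 V = {0}"
proof -
  obtain B where B: "finite B" "corthon B" "cspan B = ker11 V" using ker11_finite[OF V] by blast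
  have "ecdim (ker11 V) = enat (card B)" "cdim (ker11 V) = card B" using ecdim_cspan_corthon[OF B] by auto
  then show ?thesis using ecdim_zero_iff[OF csubspace_K[OF V]] by (simp add: zero_enat_def)
qed

lemma ker11_reflection_iff:
  assumes e: "unit1 e"
  shows "x \<in> ker11 (reflection e \<odot> V) \<longleftrightarrow>
    P x = x \<and> P (V x) = scaleC (cinner e (V x)) e \<and> cinner (J e) (V x) = 0"
proof -
  let ?a = "cinner e (V x)" and ?b = "cinner (J e) (V x)"
  have eq: "P ((reflection e \<odot> V) x) = P (V x) - scaleC (?a - ?b) e"
    by (simp add: reflection_apply blin_simps P_scaleC cinner_diff_left unit1D[OF e])
  have a: "cinner e (P (V x)) = ?a" using cinner_P[of e "V x"] unit1D[OF e] by simp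
  show ?thesis
  proof
    assume "x \<in> ker11 (reflection e \<odot> V)"
    then have h: "P x = x" "P (V x) = scaleC (?a - ?b) e" using eq by (auto simp: ker11_def)
    then have "?a = ?a - ?b" using a by (simp add: cinner_scaleC_right unit1D[OF e])
    then show "P x = x \<and> P (V x) = scaleC ?a e \<and> ?b = 0" using h by simp
  next
    assume "P x = x \<and> P (V x) = scaleC ?a e \<and> ?b = 0"
    then show "x \<in> ker11 (reflection e \<odot> V)" using eq by (simp add: ker11_def)
  qed
qed

text \<open>The kernels belonging to \<open>V\<close> and to its product with a reflection share this subspace, which in
  each of them is the zero set of a linear form, \<open>\<langle>J e, V x\<rangle>\<close> or \<open>\<langle>e, V x\<rangle>\<close>. Exactly one of the two
  forms is nonzero if \<open>V\<close> is unitary; this is why the dimension changes by one.\<close>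

lemma ker11_reflection_inter:
  assumes e: "unit1 e"
  shows "{x\<in>ker11 V. cinner (J e) (V x) = 0} = {x\<in>ker11 (reflection e \<odot> V). cinner e (V x) = 0}"
proof -
  have "cinner e (V x) = 0" if "P (V x) = 0" for x
    using cinner_S1_S2(1)[OF unit1D(1)[OF e] that] .
  then show ?thesis unfolding ker11_reflection_iff[OF e] by (auto simp: ker11_def ker11_reflection_iff[OF e])
qed

text \<open>The bilinear form \<open>\<langle>J x, y\<rangle>\<close> is invariant under \<open>V\<close> and vanishes on the range of \<open>P\<close>. For \<open>x\<close> in
  the first kernel and \<open>y\<close> in the second its value is \<open>\<langle>e, V y\<rangle> * \<langle>J e, V x\<rangle>\<close>, so that one of the
  factors vanishes.\<close>

lemma ker11_reflection_exclusive:
  assumes V: "V \<in> bog_HS J P" and e: "unit1 e"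
    and x: "x \<in> ker11 V" "cinner (J e) (V x) \<noteq> 0" and y: "y \<in> ker11 (reflection e \<odot> V)"
  shows "cinner e (V y) = 0"
proof -
  have x': "P x = x" "P (V x) = 0" using x by (auto simp: ker11_def)
  have y': "P y = y" "P (V y) = scaleC (cinner e (V y)) e" using y ker11_reflection_iff[OF e] by auto
  have "cinner (J x) y = 0" using cinner_S1_S2(2)[OF y'(1) J_S1[OF x'(1)]] .
  then have "0 = cinner (J (V x)) (V y)"
    using bog_HS_cinner[OF V, of "J x" y] by (simp add: rop_J[OF bog_HS_rop[OF V]])
  also have "\<dots> = cinner (J (V x)) (P (V y))" using cinner_P[of "J (V x)" "V y"] J_S2[OF x'(2)] by simp
  also have "\<dots> = cinner e (V y) * cinner (J e) (V x)"
    by (subst y'(2)) (simp add: cinner_scaleC_right cinner_J_sym[of "V x" e])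
  finally show ?thesis using x(2) by simp
qed

text \<open>If the form vanishes on the kernel, then \<open>e\<close> is orthogonal to the cokernel of the first diagonal
  block, whose range is closed; hence \<open>e = P (U y)\<close> for some \<open>y\<close>. Isotropy of \<open>U y\<close> shows
  \<open>\<langle>J e, U y\<rangle> = 0\<close>, which puts \<open>y\<close> into the second kernel.\<close>

lemma ker11_reflection_total:
  assumes U: "U \<in> bogU" and e: "unit1 e" and K0: "\<And>x. x \<in> ker11 U \<Longrightarrow> cinner (J e) (U x) = 0"
  shows "\<exists>y\<in>ker11 (reflection e \<odot> U). cinner e (U y) \<noteq> 0"
proof -
  have UHS: "U \<in> bog_HS J P" by (rule bogU_HS[OF U])
  have r: "rop U" by (rule bog_HS_rop[OF UHS])
  interpret complementary_hs S1 "P \<odot> U" "Q \<odot> U \<odot> P" by (rule fredholm[OF UHS])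
  let ?R = "blinfun_apply (P \<odot> U) ` S1"
  have R: "closed ?R" "subspace ?R" by (rule closed_image, rule subspace_blinfun_image[OF S(2)])
  define p where "p = oproj ?R e"
  have pR: "p \<in> ?R" unfolding p_def by (rule oproj_in[OF R])
  then have Pp: "P p = p" by auto
  let ?r = "e - p"
  have Pr: "P ?r = ?r" using Pp unit1D(1)[OF e] by (simp add: blin_simps)
  have "U\<^sup>\<dagger> ?r \<bullet> P z = 0" for z
  proof -
    have "P (U (P z)) \<in> ?R" by auto
    then have "?r \<bullet> P (U (P z)) = 0" unfolding p_def by (rule oproj_orth[OF R])
    then show ?thesis using inner_P[of ?r "U (P z)"] Pr by (simp add: adj_left)
  qed
  from this[of "U\<^sup>\<dagger> ?r"] have "P (U\<^sup>\<dagger> ?r) = 0"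
    using inner_P[of "U\<^sup>\<dagger> ?r" "P (U\<^sup>\<dagger> ?r)"] by (metis PP inner_P inner_eq_zero_iff)
  define z where "z = J (U\<^sup>\<dagger> ?r)"
  have Uz: "U z = J ?r" by (simp add: z_def rop_J[OF r] bogU_adj_right[OF U])
  have "P z = z" unfolding z_def by (rule J_S2) fact
  moreover have "P (U z) = 0" unfolding Uz by (rule J_S1[OF Pr])
  ultimately have "z \<in> ker11 U" by (simp add: ker11_def)
  from K0[OF this] have "cinner e ?r = 0" by (simp only: Uz cinner_J_J) simp
  then have "?r \<bullet> e = 0" by (metis Re_cinner inner_commute zero_complex.simps(1))
  moreover have "?r \<bullet> p = 0" using oproj_orth[OF R pR, of e] by (simp add: p_def)
  ultimately have "?r \<bullet> ?r = 0" by (simp add: inner_diff_right)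
  then have "p = e" by simp
  then obtain y where y: "P y = y" "P (U y) = e" using pR in_range_P by auto
  have a: "cinner e (U y) = 1"
    using cinner_P[of e "U y"] unit1D[OF e] y(2) by simp
  have "cinner (J y) y = 0" using cinner_S1_S2(2)[OF y(1) J_S1[OF y(1)]] .
  then have 0: "cinner (J (U y)) (U y) = 0"
    using bog_HS_cinner[OF UHS, of "J y" y] by (simp add: rop_J[OF r])
  define q where "q = Q (U y)"
  have Uy: "U y = e + q" using y(2) by (simp add: q_def blinfun.diff_left)
  have Pq: "P q = 0" unfolding q_def by (rule QQ(2))
  have "cinner (J q) q = 0" using cinner_S1_S2(1)[OF J_S2[OF Pq] Pq] .
  moreover have "cinner (J q) e = cinner (J e) q" by (rule cinner_J_sym)
  ultimately have "2 * cinner (J e) q = 0"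
    using 0 by (simp add: Uy J_add cinner_add_left cinner_add_right unit1D[OF e])
  then have "cinner (J e) (U y) = 0" by (simp add: Uy cinner_add_right unit1D[OF e])
  then have "y \<in> ker11 (reflection e \<odot> U)" unfolding ker11_reflection_iff[OF e] using y a by simp
  then show ?thesis using a by (intro bexI[of _ y]) auto
qed

lemma cdim_ker11_functional:
  assumes V: "V \<in> bog_HS J P" and W: "W \<in> bog_HS J P" and x: "x \<in> ker11 W" "cinner u (V x) \<noteq> 0"
  shows "cdim (ker11 W) = Suc (cdim {x\<in>ker11 W. cinner u (V x) = 0})"
proof -
  obtain B where B: "finite B" "cspan B = ker11 W" using ker11_finite[OF W] by blast
  have eq: "cinner u (V y) = cinner (V\<^sup>\<dagger> u) y" for y
    using cinner_adj_left[OF rop_clinear[OF bog_HS_rop[OF V]]] by simp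
  show ?thesis unfolding eq
    by (rule cdim_kernel_functional[OF csubspace_K[OF W] B(1)]) (use B x eq in auto)
qed

lemma cdim_ker11_reflection_drop:
  assumes V: "V \<in> bog_HS J P" and e: "unit1 e" and x: "x \<in> ker11 V" "cinner (J e) (V x) \<noteq> 0"
  shows "cdim (ker11 V) = Suc (cdim (ker11 (reflection e \<odot> V)))"
proof -
  have "{x\<in>ker11 V. cinner (J e) (V x) = 0} = ker11 (reflection e \<odot> V)"
    unfolding ker11_reflection_inter[OF e] using ker11_reflection_exclusive[OF V e x] by blast
  then show ?thesis using cdim_ker11_functional[OF V V x] by simp
qed

lemma cdim_ker11_reflection_parity:
  assumes U: "U \<in> bogU" and e: "unit1 e"
  shows "even (cdim (ker11 (reflection e \<odot> U))) \<longleftrightarrow> odd (cdim (ker11 U))"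
proof (cases "\<exists>x\<in>ker11 U. cinner (J e) (U x) \<noteq> 0")
  case True
  then show ?thesis using cdim_ker11_reflection_drop[OF bogU_HS[OF U] e] by auto
next
  case False
  then have "{x\<in>ker11 U. cinner (J e) (U x) = 0} = ker11 U" by blast
  moreover obtain y where y: "y \<in> ker11 (reflection e \<odot> U)" "cinner e (U y) \<noteq> 0"
    using ker11_reflection_total[OF U e] False by blast
  moreover have "reflection e \<odot> U \<in> bog_HS J P" by (intro bogU_HS bogU_compose reflection_bogU e U)
  ultimately have "cdim (ker11 (reflection e \<odot> U)) = Suc (cdim (ker11 U))"
    using cdim_ker11_functional[OF bogU_HS[OF U] _ y] ker11_reflection_inter[OF e, of U] by metis
  then show ?thesis by simp
qed

text \<open>The order of the factors is such that the head of the list acts first.\<close>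

definition rprod :: "'a list \<Rightarrow> 'a \<Rightarrow>\<^sub>L 'a" where
  "rprod es = foldr (\<lambda>e A. A \<odot> reflection e) es id_blinfun"

lemma rprod_Nil [simp]: "rprod [] = id_blinfun" and rprod_Cons [simp]: "rprod (e # es) = rprod es \<odot> reflection e"
  by (simp_all add: rprod_def)

lemma rprod_bogU: "\<forall>e\<in>set es. unit1 e \<Longrightarrow> rprod es \<in> bogU"
  by (induction es) (auto intro: id_bogU bogU_compose reflection_bogU)

text \<open>For a unit vector \<open>x\<close> in the kernel, the reflection with \<open>e = J (V x)\<close> lowers the dimension
  by one, because \<open>\<langle>J e, V x\<rangle> = 1\<close>.\<close>

lemma exists_rprod_ker11_zero:
  assumes "V \<in> bog_HS J P"
  shows "\<exists>es. length es = cdim (ker11 V) \<and> (\<forall>e\<in>set es. unit1 e) \<and> ker11 (rprod es \<odot> V) = {0}"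
  using assms
proof (induction "cdim (ker11 V)" arbitrary: V)
  case 0
  then show ?case using cdim_ker11_zero[of V] by (intro exI[of _ "[]"]) auto
next
  case (Suc n)
  then have "ker11 V \<noteq> {0}" using cdim_ker11_zero[of V] by auto
  moreover have "0 \<in> ker11 V" using csubspace_K[OF Suc.prems] complex_vector.subspace_0 by blast
  ultimately obtain x0 where x0: "x0 \<in> ker11 V" "x0 \<noteq> 0" by blast
  define x where "x = (1 / norm x0) *\<^sub>R x0"
  have xK: "x \<in> ker11 V" unfolding x_def
    using x0(1) csubspace_imp_subspace[OF csubspace_K[OF Suc.prems]] subspace_scale by blast
  have nx: "norm x = 1" using x0(2) by (simp add: x_def)
  let ?e = "J (V x)"
  have e: "unit1 ?e" using xK nx J_S2[of "V x"] by (simp add: unit1_def ker11_def bog_HS_norm[OF Suc.prems])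
  have "cinner (J ?e) (V x) = 1" using nx by (simp add: cinner_self bog_HS_norm[OF Suc.prems])
  then have d: "cdim (ker11 V) = Suc (cdim (ker11 (reflection ?e \<odot> V)))"
    using cdim_ker11_reflection_drop[OF Suc.prems e xK] by simp
  have "reflection ?e \<odot> V \<in> bog_HS J P" by (intro bog_HS_compose bogU_HS reflection_bogU e Suc.prems)
  then obtain es where es: "length es = cdim (ker11 (reflection ?e \<odot> V))" "\<forall>e\<in>set es. unit1 e"
    "ker11 (rprod es \<odot> (reflection ?e \<odot> V)) = {0}"
    using Suc.hyps(1)[of "reflection ?e \<odot> V"] Suc.hyps(2) d by auto
  then show ?case using d e by (intro exI[of _ "?e # es"]) (simp add: bmul_assoc)
qed

lemma rprod_parity:
  assumes "\<forall>e\<in>set es. unit1 e" "U \<in> bogU"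
  shows "even (cdim (ker11 (rprod es \<odot> U))) \<longleftrightarrow> (even (cdim (ker11 U)) \<longleftrightarrow> even (length es))"
  using assms
proof (induction es arbitrary: U)
  case (Cons e es)
  have "reflection e \<odot> U \<in> bogU" using Cons.prems by (intro bogU_compose reflection_bogU) auto
  then have "even (cdim (ker11 (rprod es \<odot> (reflection e \<odot> U)))) \<longleftrightarrow> (even (cdim (ker11 (reflection e \<odot> U))) \<longleftrightarrow> even (length es))"
    using Cons.IH Cons.prems by auto
  then show ?case using cdim_ker11_reflection_parity[of U e] Cons.prems by (auto simp: bmul_assoc)
qed simp

lemma linked_rprod:
  assumes "\<forall>e\<in>set es. unit1 e" "unit1 e0"
  shows "linked (rprod es) (if even (length es) then id_blinfun else reflection e0)"
  using assms
proof (induction es)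
  case Nil then show ?case by (simp add: linked_refl bogU_HS id_bogU)
next
  case (Cons e es)
  have e: "unit1 e" using Cons.prems by simp
  have "linked (rprod es \<odot> reflection e) ((if even (length es) then id_blinfun else reflection e0) \<odot> reflection e)"
    using Cons by (intro linked_right bogU_HS reflection_bogU) auto
  also have "linked ((if even (length es) then id_blinfun else reflection e0) \<odot> reflection e)
      (if even (length (e # es)) then id_blinfun else reflection e0)"
  proof (cases "even (length es)")
    case True then show ?thesis using linked_reflections[OF e Cons.prems(2)] by simp
  next
    case False
    have "linked (reflection e0 \<odot> reflection e) (reflection e \<odot> reflection e)"
      by (intro linked_right bogU_HS reflection_bogU linked_reflections e Cons.prems)
    moreover have "reflection e \<odot> reflection e = id_blinfun" by (rule blinfun_eqI) (simp add: reflection_involution[OF e])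
    ultimately show ?thesis using False by simp
  qed
  finally show ?case by simp
qed

text \<open>Composing \<open>U\<close> with as many reflections as the kernel has dimensions makes the kernel trivial,
  so that the composition is joined to the identity. The product of the reflections itself is joined
  to the identity or to a single reflection, depending on the parity of their number.\<close>

lemma linked_classification:
  assumes U: "U \<in> bogU" and e0: "unit1 e0"
  shows "linked U (if even (cdim (ker11 U)) then id_blinfun else reflection e0)"
proof -
  have UHS: "U \<in> bog_HS J P" by (rule bogU_HS[OF U])
  obtain es where es: "length es = cdim (ker11 U)" "\<forall>e\<in>set es. unit1 e" "ker11 (rprod es \<odot> U) = {0}"
    using exists_rprod_ker11_zero[OF UHS] by (elim exE conjE)
  let ?T = "if even (cdim (ker11 U)) then id_blinfun else reflection e0"
  have T: "?T \<in> bogU" using id_bogU reflection_bogU[OF e0] by simp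
  have TT: "?T \<odot> ?T = id_blinfun" by (rule blinfun_eqI) (simp add: reflection_involution[OF e0])
  have "linked (rprod es \<odot> U) (?T \<odot> U)"
    using linked_rprod[OF es(2) e0] es(1) by (intro linked_right UHS) simp
  moreover have "linked (rprod es \<odot> U) id_blinfun"
    by (intro linked_id_if_ker11_zero bogU_compose rprod_bogU es U)
  ultimately have "linked (?T \<odot> U) id_blinfun" using linked_sym linked_trans by blast
  then have "linked (?T \<odot> (?T \<odot> U)) (?T \<odot> id_blinfun)" by (rule linked_left[OF bogU_HS[OF T]])
  moreover have "?T \<odot> (?T \<odot> U) = U" by (simp only: bmul_assoc[symmetric] TT bmul_id)
  ultimately show ?thesis by (simp only: bmul_id)
qed

text \<open>Reflections make the kernel trivial. The first diagonal block is then bounded below, which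
  persists for nearby operators.\<close>

lemma ker11_parity_locally_constant:
  assumes U: "U \<in> bogU"
  shows "\<exists>c>0. \<forall>U'\<in>bogU. norm (U' - U) < c \<longrightarrow> even (cdim (ker11 U')) = even (cdim (ker11 U))"
proof -
  have UHS: "U \<in> bog_HS J P" by (rule bogU_HS[OF U])
  obtain es where es: "length es = cdim (ker11 U)" "\<forall>e\<in>set es. unit1 e" "ker11 (rprod es \<odot> U) = {0}"
    using exists_rprod_ker11_zero[OF UHS] by (elim exE conjE)
  have R: "rprod es \<in> bogU" by (rule rprod_bogU[OF es(2)])
  obtain c where c: "c > 0" "\<And>x. P x = x \<Longrightarrow> c * norm x \<le> norm (P ((rprod es \<odot> U) x))"
    using block11_bddbelow[OF bog_HS_compose[OF bogU_HS[OF R] UHS] es(3)] by blast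
  have "even (cdim (ker11 U')) = even (cdim (ker11 U))" if U': "U' \<in> bogU" "norm (U' - U) < c" for U'
  proof -
    have RU': "rprod es \<odot> U' \<in> bog_HS J P" by (intro bogU_HS bogU_compose R U')
    have "x = 0" if x: "x \<in> ker11 (rprod es \<odot> U')" for x
    proof (rule ccontr)
      assume "x \<noteq> 0"
      have x': "P x = x" "P (rprod es (U' x)) = 0" using x by (auto simp: ker11_def)
      have "c * norm x \<le> norm (P (rprod es (U x)))" using c(2)[OF x'(1)] by simp
      also have "P (rprod es (U x)) = - P (rprod es ((U' - U) x))" using x'(2) by (simp add: blin_simps)
      also have "norm \<dots> \<le> norm (rprod es ((U' - U) x))" by (simp add: norm_P_apply_le)
      also have "\<dots> = norm ((U' - U) x)" by (rule bog_HS_norm[OF bogU_HS[OF R]])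
      also have "\<dots> \<le> norm (U' - U) * norm x" by (rule norm_blinfun)
      also have "\<dots> < c * norm x" using U'(2) \<open>x \<noteq> 0\<close> by simp
      finally show False by simp
    qed
    then have "ker11 (rprod es \<odot> U') = {0}"
      using csubspace_K[OF RU'] complex_vector.subspace_0 by blast
    then have "cdim (ker11 (rprod es \<odot> U')) = 0" using cdim_ker11_zero[OF RU'] by blast
    then show ?thesis using rprod_parity[OF es(2) U'(1)] es(1) by simp
  qed
  then show ?thesis using c(1) by blast
qed

lemma bog_chi_eq: "bog_chi P U = (if even (cdim (ker11 U)) then 1 else - 1)"
  by (simp add: bog_chi_def ker11_eq_ker)

lemma neg_ind_eq: "V \<in> bog_HS J P \<Longrightarrow> neg_ind V = ecdim {x. V\<^sup>\<dagger> x = 0}"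
  by (simp add: neg_ind_def ker_on_def cadjoint_eq_adj rop_clinear bog_HS_rop)

lemma csubspace_ker_adj: "V \<in> bog_HS J P \<Longrightarrow> csubspace {x. V\<^sup>\<dagger> x = 0}"
  using rop_scaleC[OF rop_adj[OF bog_HS_rop]] by (auto simp: complex_vector.subspace_def blin_simps)

lemma bogU_iff_neg_ind: "V \<in> bogU \<longleftrightarrow> V \<in> bog_HS J P \<and> neg_ind V = 0"
proof
  assume V: "V \<in> bogU"
  have "{x. V\<^sup>\<dagger> x = 0} = {0}" using bogU_adj_right[OF V] by (auto simp: blin_simps) (metis blinfun.zero_right)
  then show "V \<in> bog_HS J P \<and> neg_ind V = 0"
    using neg_ind_eq bogU_HS[OF V] ecdim_zero_iff[OF csubspace_ker_adj] by metis
next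
  assume "V \<in> bog_HS J P \<and> neg_ind V = 0"
  then have "V \<in> bog_HS J P" "{x. V\<^sup>\<dagger> x = 0} = {0}"
    using neg_ind_eq ecdim_zero_iff[OF csubspace_ker_adj] by metis+
  then show "V \<in> bogU" by (intro bogUI) auto
qed

text \<open>The projection to the kernel of \<open>W\<^sup>\<dagger>\<close> is injective on the kernel of \<open>V\<^sup>\<dagger>\<close>: if it kills \<open>x\<close>, then
  \<open>x = W y\<close> with \<open>y = V\<^sup>\<dagger> (V - W) y\<close>, and the right-hand side is shorter than \<open>y\<close> unless \<open>y = 0\<close>.\<close>

lemma neg_ind_le_near:
  assumes V: "V \<in> bog_HS J P" and W: "W \<in> bog_HS J P" and near: "norm (V - W) < 1"
  shows "neg_ind V \<le> neg_ind W"
  unfolding neg_ind_eq[OF V] neg_ind_eq[OF W]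
proof (rule ecdim_le_injective[where f = "\<lambda>x. x - W (W\<^sup>\<dagger> x)"])
  have rW: "rop W" "rop (W\<^sup>\<dagger>)" using bog_HS_rop[OF W] rop_adj by auto
  show "csubspace {x. V\<^sup>\<dagger> x = 0}" by (rule csubspace_ker_adj[OF V])
  show "x + y - W (W\<^sup>\<dagger> (x + y)) = (x - W (W\<^sup>\<dagger> x)) + (y - W (W\<^sup>\<dagger> y))" for x y
    by (simp add: blin_simps)
  show "scaleC a x - W (W\<^sup>\<dagger> (scaleC a x)) = scaleC a (x - W (W\<^sup>\<dagger> x))" for a x
    by (simp add: rop_scaleC[OF rW(1)] rop_scaleC[OF rW(2)] complex_vector.scale_right_diff_distrib)
  show "x - W (W\<^sup>\<dagger> x) \<in> {x. W\<^sup>\<dagger> x = 0}" for x by (simp add: blin_simps bog_HS_adj_left[OF W])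
  fix x assume x: "x \<in> {x. V\<^sup>\<dagger> x = 0}" "x - W (W\<^sup>\<dagger> x) = 0"
  let ?y = "W\<^sup>\<dagger> x"
  have xy: "x = W ?y" using x(2) by simp
  have "V\<^sup>\<dagger> (W ?y) = 0" using x(1) xy by simp
  then have "?y = V\<^sup>\<dagger> ((V - W) ?y)" by (simp add: blin_simps bog_HS_adj_left[OF V])
  then have "norm ?y \<le> norm (V\<^sup>\<dagger>) * norm ((V - W) ?y)" by (metis norm_blinfun)
  also have "\<dots> \<le> 1 * (norm (V - W) * norm ?y)"
    using norm_blinfun_bound[of 1 V] bog_HS_norm[OF V] by (intro mult_mono norm_blinfun) auto
  finally have "(1 - norm (V - W)) * norm ?y \<le> 0" by (simp add: algebra_simps)
  then have "?y = 0" using near by (simp add: mult_le_0_iff)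
  then show "x = 0" using xy by (simp add: blin_simps)
qed

lemma neg_ind_near:
  assumes "V \<in> bog_HS J P" "W \<in> bog_HS J P" "norm (V - W) < 1"
  shows "neg_ind V = neg_ind W"
  using neg_ind_le_near[OF assms] neg_ind_le_near[OF assms(2,1)] assms(3) by (simp add: norm_minus_commute)

lemma neg_ind_bogU_left:
  assumes U: "U \<in> bogU" and V: "V \<in> bog_HS J P"
  shows "neg_ind (U \<odot> V) = neg_ind V"
proof -
  have rU: "rop U" "rop (U\<^sup>\<dagger>)" using bog_HS_rop[OF bogU_HS[OF U]] rop_adj by auto
  have UV: "U \<odot> V \<in> bog_HS J P" by (rule bog_HS_compose[OF bogU_HS[OF U] V])
  have "ecdim {x. (U \<odot> V)\<^sup>\<dagger> x = 0} \<le> ecdim {x. V\<^sup>\<dagger> x = 0}"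
    by (rule ecdim_le_injective[OF csubspace_ker_adj[OF UV], where f = "blinfun_apply (U\<^sup>\<dagger>)"])
       (auto simp: adj_compose blin_simps rop_scaleC[OF rU(2)],
        metis blinfun.zero_right bogU_adj_right[OF U])
  moreover have "ecdim {x. V\<^sup>\<dagger> x = 0} \<le> ecdim {x. (U \<odot> V)\<^sup>\<dagger> x = 0}"
    by (rule ecdim_le_injective[OF csubspace_ker_adj[OF V], where f = "blinfun_apply U"])
       (auto simp: adj_compose blin_simps rop_scaleC[OF rU(1)] bog_HS_adj_left[OF bogU_HS[OF U]],
        metis blinfun.zero_right bog_HS_adj_left[OF bogU_HS[OF U]])
  ultimately show ?thesis by (simp add: neg_ind_eq[OF UV] neg_ind_eq[OF V])
qed

end


section \<open>The defect space of an isometry\<close>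

lemma clinear_maps_closure:
  assumes T: "clinear_op (T :: 'a::complex_inner \<Rightarrow>\<^sub>L 'a)" and M: "closed M" "csubspace M"
    and E: "\<And>e. e \<in> E \<Longrightarrow> T e \<in> M" and x: "x \<in> closure (cspan E)"
  shows "T x \<in> M"
proof -
  have "closed (blinfun_apply T -` M)"
    using M(1) by (intro closed_vimage) (auto intro: continuous_intros)
  moreover have "csubspace (blinfun_apply T -` M)"
    using M(2) by (auto simp: complex_vector.subspace_def blin_simps clinear_opD[OF T])
  then have "cspan E \<subseteq> blinfun_apply T -` M"
    by (intro complex_vector.span_minimal) (use E in auto)
  ultimately have "closure (cspan E) \<subseteq> blinfun_apply T -` M" by (rule closure_minimal[rotated])
  then show ?thesis using x by blast
qed

definition ecard :: "'a set \<Rightarrow> enat" where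
  "ecard A = (if finite A then enat (card A) else \<infinity>)"

lemma ecard_bij:
  assumes "ecard A = ecard B" "countable A" "countable B"
  shows "\<exists>f. bij_betw f A B"
proof (cases "finite A")
  case True
  then have "finite B" "card A = card B" using assms(1) by (auto simp: ecard_def split: if_splits)
  then show ?thesis using finite_same_card_bij[OF True] by blast
next
  case False
  then have "infinite B" using assms(1) by (auto simp: ecard_def split: if_splits)
  then show ?thesis
    using bij_betw_trans[OF to_nat_on_infinite[OF assms(2) False] bij_betw_from_nat_into[OF assms(3)]] by blast
qed

lemma infinite_subset_prescribed_complement:
  assumes "infinite E" "countable E"
  shows "\<exists>F\<subseteq>E. infinite F \<and> ecard (E - F) = m"
proof (cases m)
  case (enat n)
  obtain D where D: "D \<subseteq> E" "finite D" "card D = n" using infinite_arbitrarily_large[OF assms(1)] by blast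
  then have "E - (E - D) = D" by blast
  then show ?thesis using D assms(1) enat by (intro exI[of _ "E - D"]) (auto simp: ecard_def)
next
  case infinity
  have b: "bij_betw (from_nat_into E) UNIV E" by (rule bij_betw_from_nat_into[OF assms(2,1)])
  then have inj: "inj (from_nat_into E)" and rng: "range (from_nat_into E) = E" by (auto simp: bij_betw_def)
  let ?F = "range (\<lambda>k. from_nat_into E (2 * k))"
  have "infinite ?F" by (intro range_inj_infinite injI) (use inj in \<open>auto dest: injD\<close>)
  moreover have "infinite (E - ?F)"
  proof (rule infinite_super)
    show "range (\<lambda>k. from_nat_into E (2 * k + 1)) \<subseteq> E - ?F"
    proof (intro image_subsetI DiffI)
      fix k :: nat
      show "from_nat_into E (2 * k + 1) \<in> E" using rng by blast
      show "from_nat_into E (2 * k + 1) \<notin> ?F"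
      proof
        assume "from_nat_into E (2 * k + 1) \<in> ?F"
        then obtain l where "2 * k + 1 = 2 * l" using injD[OF inj] by blast
        then show False by presburger
      qed
    qed
    show "infinite (range (\<lambda>k. from_nat_into E (2 * k + 1)))"
      by (intro range_inj_infinite injI) (use inj in \<open>auto dest: injD\<close>)
  qed
  ultimately show ?thesis using infinity rng by (intro exI[of _ ?F]) (auto simp: ecard_def)
qed

lemma enat_double_eq_iff: "2 * a = 2 * b \<longleftrightarrow> a = (b :: enat)"
proof (cases a; cases b)
  fix i j assume "a = enat i" "b = enat j"
  then show ?thesis by (simp add: numeral_eq_enat)
next
  fix i assume "a = enat i" "b = \<infinity>"
  then show ?thesis by (simp add: numeral_eq_enat)
next
  fix j assume "a = \<infinity>" "b = enat j"
  then show ?thesis by (simp add: numeral_eq_enat)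
qed auto

lemma onbI:
  fixes S :: "'a::chilbert_space set"
  assumes S: "closed S" "csubspace S" and E: "E \<subseteq> S" "corthon E"
    and tot: "\<And>r. r \<in> S \<Longrightarrow> (\<And>e. e \<in> E \<Longrightarrow> cinner e r = 0) \<Longrightarrow> r = 0"
  shows "is_onb S E"
proof -
  let ?T = "closure (cspan E)"
  have T: "closed ?T" "csubspace ?T" by (auto intro: csubspace_closure)
  have TS: "?T \<subseteq> S" using E(1) S by (intro closure_minimal complex_vector.span_minimal)
  have "x \<in> ?T" if x: "x \<in> S" for x
  proof -
    have p: "oproj ?T x \<in> ?T" by (rule oproj_in[OF T(1) csubspace_imp_subspace[OF T(2)]])
    have "x - oproj ?T x = 0"
    proof (rule tot)
      show "x - oproj ?T x \<in> S" using x p TS complex_vector.subspace_diff[OF S(2)] by blast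
      show "cinner e (x - oproj ?T x) = 0" if "e \<in> E" for e
        by (rule oproj_corth'[OF T]) (use that complex_vector.span_base closure_subset in blast)
    qed
    then show ?thesis using p by simp
  qed
  then show ?thesis using E by (auto simp: is_onb_iff)
qed

context basis_projection_setting
begin

text \<open>A complex-linear operator on \<open>S1\<close> has exactly one complex-linear extension to the whole space
  that commutes with \<open>J\<close>.\<close>

definition dbl :: "('a \<Rightarrow>\<^sub>L 'a) \<Rightarrow> 'a \<Rightarrow>\<^sub>L 'a" where
  "dbl T = T \<odot> P + Jop \<odot> (T \<odot> (P \<odot> Jop))"

lemma dbl_apply: "dbl T x = T (P x) + J (T (P (J x)))"
  by (simp add: dbl_def blinfun.add_left)

lemma dbl_S1: "P x = x \<Longrightarrow> dbl T x = T x"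
  by (simp add: dbl_apply J_S1 blin_simps)

lemma rop_dbl: "clinear_op T \<Longrightarrow> rop (dbl T)"
  by (rule ropI) (simp_all add: dbl_apply P_scaleC J_scaleC clinear_opD scaleC_add_right J_add add.commute)

lemma dbl_isometry:
  assumes iso: "\<And>x. P x = x \<Longrightarrow> norm (blinfun_apply T x) = norm x"
    and lag: "\<And>x y. P x = x \<Longrightarrow> P y = y \<Longrightarrow> cinner (J (blinfun_apply T x)) (blinfun_apply T y) = 0"
  shows "norm (dbl T x) = norm x"
proof -
  have "cinner (J (T (P (J x)))) (T (P x)) = 0" by (rule lag) auto
  then have "J (T (P (J x))) \<bullet> T (P x) = 0" by (metis Re_cinner zero_complex.simps(1))
  then have "(norm (dbl T x))\<^sup>2 = (norm (P x))\<^sup>2 + (norm (P (J x)))\<^sup>2"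
    unfolding dbl_apply power2_norm_add by (simp add: iso inner_commute)
  also have "norm (P (J x)) = norm (Q x)" by (simp only: P_J norm_J)
  also have "(norm (P x))\<^sup>2 + (norm (Q x))\<^sup>2 = (norm x)\<^sup>2" by (rule norm_PQ[symmetric])
  finally show ?thesis by (simp add: power2_eq_iff_nonneg)
qed

lemma rop_eqI:
  assumes A: "rop A" and B: "rop B" and E: "is_onb S1 E" and eq: "\<And>e. e \<in> E \<Longrightarrow> A e = B e"
  shows "A = B"
proof -
  have S1eq: "A x = B x" if "P x = x" for x
  proof -
    have "(A - B) x \<in> {0}"
    proof (rule clinear_maps_closure)
      show "clinear_op (A - B)" using A B rop_clinear rop_diff by blast
      show "x \<in> closure (cspan E)" using E that in_range_P by (auto simp: is_onb_iff)
    qed (auto simp: blin_simps eq complex_vector.subspace_def)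
    then show ?thesis by (simp add: blin_simps)
  qed
  have "A x = B x" for x
  proof -
    have "A (J (P (J x))) = B (J (P (J x)))" using S1eq[of "P (J x)"] rop_J[OF A] rop_J[OF B] by simp
    then have "A (P x + J (P (J x))) = B (P x + J (P (J x)))" using S1eq[of "P x"] by (simp add: blin_simps)
    then show ?thesis by (simp only: P_J_P)
  qed
  then show ?thesis by (rule blinfun_eqI)
qed

text \<open>On the kernel of \<open>V\<^sup>\<dagger>\<close> consider the symmetric bilinear form \<open>\<langle>J x, y\<rangle>\<close>. Inside \<open>S1\<close> it vanishes,
  and the projection of the orthogonal complement \<open>codefect V\<close> of \<open>V S1\<close> in \<open>S1\<close> is still isotropic. It
  is moreover a maximal isotropic subspace of the kernel, namely \<open>lagrangian V\<close>
  (\<open>lag_eq_image\<close>, \<open>lag_iff\<close>). Therefore the kernel is the sum of \<open>lagrangian V\<close> and its conjugate.\<close>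

definition codefect :: "('a \<Rightarrow>\<^sub>L 'a) \<Rightarrow> 'a set" where
  "codefect V = {c. P c = c \<and> P (V\<^sup>\<dagger> c) = 0}"

definition defect_proj :: "('a \<Rightarrow>\<^sub>L 'a) \<Rightarrow> 'a \<Rightarrow>\<^sub>L 'a" where
  "defect_proj V = id_blinfun - V \<odot> V\<^sup>\<dagger>"

definition lagrangian :: "('a \<Rightarrow>\<^sub>L 'a) \<Rightarrow> 'a set" where
  "lagrangian V = {q. V\<^sup>\<dagger> q = 0 \<and> (\<forall>c\<in>codefect V. cinner (J c) q = 0)}"

lemma defect_proj_apply: "defect_proj V x = x - V (V\<^sup>\<dagger> x)"
  by (simp add: defect_proj_def blin_simps)

context
  fixes V assumes V: "V \<in> bog_HS J P"
begin

lemma rV: "rop V" "rop (V\<^sup>\<dagger>)" using bog_HS_rop[OF V] rop_adj by auto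

lemma closed_lag: "closed (lagrangian V)" and csubspace_lag: "csubspace (lagrangian V)"
proof -
  have eq: "{q. cinner u q = 0} = {q. u \<bullet> q = 0} \<inter> {q. scaleC \<i> u \<bullet> q = 0}" for u :: 'a
    by (auto simp: complex_eq_iff Re_cinner) (auto simp: Re_cinner[symmetric] cinner_scaleC_left)
  have lag: "lagrangian V = {q. V\<^sup>\<dagger> q = 0} \<inter> (\<Inter>c\<in>codefect V. {q. cinner (J c) q = 0})" by (auto simp: lagrangian_def)
  have cl: "closed {q. cinner u q = 0}" for u :: 'a
    unfolding eq by (intro closed_Int closed_Collect_eq continuous_intros)
  show "closed (lagrangian V)"
    unfolding lag by (intro closed_Int closed_INT ballI cl) (intro closed_Collect_eq continuous_intros)
  show "csubspace (lagrangian V)"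
    by (auto simp: lagrangian_def complex_vector.subspace_def blin_simps cinner_add_right cinner_scaleC_right
        rop_scaleC[OF rV(2)])
qed

lemma adj_defect_proj: "V\<^sup>\<dagger> (defect_proj V x) = 0"
  by (simp add: defect_proj_apply blin_simps bog_HS_adj_left[OF V])

lemma cinner_J_defect_proj:
  assumes "V\<^sup>\<dagger> q = 0" shows "cinner (J (defect_proj V c)) q = cinner (J c) q"
proof -
  have "cinner (J (V (V\<^sup>\<dagger> c))) q = cinner (V (J (V\<^sup>\<dagger> c))) q" by (simp add: rop_J[OF rV(1)])
  also have "\<dots> = cinner (J (V\<^sup>\<dagger> c)) (V\<^sup>\<dagger> q)" by (simp only: cinner_adj_right[OF rop_clinear[OF rV(1)]])
  finally show ?thesis using assms by (simp add: defect_proj_apply J_diff cinner_diff_left)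
qed

lemma defect_proj_in_lag:
  assumes "c \<in> codefect V" shows "defect_proj V c \<in> lagrangian V"
  unfolding lagrangian_def
proof (intro CollectI conjI ballI adj_defect_proj)
  have c: "P c = c" "P (V\<^sup>\<dagger> c) = 0" using assms by (auto simp: codefect_def)
  fix c' assume "c' \<in> codefect V"
  then have c': "P c' = c'" "P (V\<^sup>\<dagger> c') = 0" by (auto simp: codefect_def)
  have "cinner (J c') c = 0" using cinner_S1_S2(2)[OF c(1) J_S1[OF c'(1)]] .
  moreover have "cinner (J c') (V (V\<^sup>\<dagger> c)) = cinner (J (V\<^sup>\<dagger> c')) (V\<^sup>\<dagger> c)"
    using cinner_adj_left[OF rop_clinear[OF rV(1)], of "J c'" "V\<^sup>\<dagger> c"] by (simp add: rop_J[OF rV(2)])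
  moreover have "\<dots> = 0" using cinner_S1_S2(1)[OF J_S2[OF c'(2)] c(2)] .
  ultimately show "cinner (J c') (defect_proj V c) = 0" by (simp add: defect_proj_apply cinner_diff_right)
qed

text \<open>For maximality let \<open>q\<close> be orthogonal to the conjugate of the codefect. Then \<open>P (J q)\<close> lies in the
  closed range of the first diagonal block of \<open>V\<close>, and subtracting from \<open>q\<close> the conjugate of the
  corresponding value of \<open>V\<close> leaves a vector of the codefect that projects to \<open>q\<close>.\<close>

lemma lag_eq_image: "lagrangian V = defect_proj V ` codefect V"
proof
  show "defect_proj V ` codefect V \<subseteq> lagrangian V" using defect_proj_in_lag by blast
  show "lagrangian V \<subseteq> defect_proj V ` codefect V"
  proof
    fix q assume "q \<in> lagrangian V"
    then have q: "V\<^sup>\<dagger> q = 0" "\<And>c. c \<in> codefect V \<Longrightarrow> cinner (J c) q = 0" by (auto simp: lagrangian_def)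
    interpret complementary_hs S1 "P \<odot> V" "Q \<odot> V \<odot> P" by (rule fredholm[OF V])
    let ?R = "blinfun_apply (P \<odot> V) ` S1"
    have R: "closed ?R" "subspace ?R" by (rule closed_image, rule subspace_blinfun_image[OF S(2)])
    define p where "p = oproj ?R (P (J q))"
    have pR: "p \<in> ?R" unfolding p_def by (rule oproj_in[OF R])
    let ?r = "P (J q) - p"
    have Pr: "P ?r = ?r" using pR by (auto simp: blin_simps)
    have "V\<^sup>\<dagger> ?r \<bullet> P z = 0" for z
    proof -
      have "P (V (P z)) \<in> ?R" by auto
      then have "?r \<bullet> P (V (P z)) = 0" unfolding p_def by (rule oproj_orth[OF R])
      then show ?thesis using inner_P[of ?r "V (P z)"] Pr by (simp add: adj_left)
    qed
    from this[of "V\<^sup>\<dagger> ?r"] have "P (V\<^sup>\<dagger> ?r) = 0"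
      by (metis PP inner_P inner_eq_zero_iff)
    then have "?r \<in> codefect V" using Pr by (simp add: codefect_def)
    then have "cinner (J q) ?r = 0" using q(2) cinner_J_sym by metis
    then have "J q \<bullet> ?r = 0" by (metis Re_cinner zero_complex.simps(1))
    then have "P (J q) \<bullet> ?r = 0" using inner_P[of "J q" ?r] Pr by simp
    moreover have "?r \<bullet> p = 0" using oproj_orth[OF R pR, of "P (J q)"] by (simp add: p_def)
    ultimately have "?r \<bullet> ?r = 0" by (simp add: inner_diff_right inner_commute)
    then have "P (J q) \<in> ?R" using pR by simp
    then obtain x where x: "P x = x" "P (J q) = P (V x)" using in_range_P by auto
    let ?c = "q - V (J x)"
    have "Q (V (J x)) = J (P (V x))" by (simp only: rop_J[OF rV(1)] Q_J)
    also have "\<dots> = Q q" by (simp only: x(2)[symmetric] P_J J_J)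
    finally have "Q ?c = 0" by (simp only: blinfun.diff_right) simp
    then have "P ?c = ?c" by (simp add: blinfun.diff_left)
    moreover have Vc: "V\<^sup>\<dagger> ?c = - J x" using q(1) by (simp add: blin_simps bog_HS_adj_left[OF V])
    then have "P (V\<^sup>\<dagger> ?c) = 0" using J_S1[OF x(1)] by (simp add: blin_simps)
    ultimately have "?c \<in> codefect V" by (simp add: codefect_def)
    moreover have "defect_proj V ?c = q" unfolding defect_proj_apply Vc by (simp add: blin_simps)
    ultimately show "q \<in> defect_proj V ` codefect V" by (metis imageI)
  qed
qed

lemma lag_iff:
  "q \<in> lagrangian V \<longleftrightarrow> V\<^sup>\<dagger> q = 0 \<and> (\<forall>p\<in>lagrangian V. cinner (J p) q = 0)"
proof -
  have "(\<forall>p\<in>lagrangian V. cinner (J p) q = 0) \<longleftrightarrow> (\<forall>c\<in>codefect V. cinner (J c) q = 0)" if "V\<^sup>\<dagger> q = 0"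
    unfolding lag_eq_image using cinner_J_defect_proj[OF that] by auto
  then show ?thesis by (subst lagrangian_def) blast
qed

lemma lag_total:
  assumes q: "V\<^sup>\<dagger> q = 0" and E: "is_onb (lagrangian V) E"
    and o: "\<And>e. e \<in> E \<Longrightarrow> cinner e q = 0" "\<And>e. e \<in> E \<Longrightarrow> cinner (J e) q = 0"
  shows "q = 0"
proof -
  have sub: "lagrangian V \<subseteq> closure (cspan E)" using E by (auto simp: is_onb_iff)
  have "cinner (J p) q = 0" if "p \<in> lagrangian V" for p
  proof -
    have "cinner (J q) p = 0"
    proof (rule corth_closure_span)
      show "cinner (J q) e = 0" if "e \<in> E" for e using o(2)[OF that] cinner_J_sym by metis
      show "p \<in> closure (cspan E)" using sub \<open>p \<in> lagrangian V\<close> by blast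
    qed
    then show ?thesis using cinner_J_sym by metis
  qed
  then have "q \<in> lagrangian V" using lag_iff q by blast
  then have "q \<in> closure (cspan E)" using sub by blast
  moreover have "cinner q e = 0" if "e \<in> E" for e using o(1)[OF that] by (metis cinner_commute complex_cnj_zero)
  ultimately have "cinner q q = 0" by (rule corth_closure_span[rotated])
  then show ?thesis by simp
qed

lemma lag_corthon:
  assumes E: "is_onb (lagrangian V) E" and e: "e \<in> E" "e' \<in> E"
  shows "cinner (J e) e' = 0" "cinner e (J e') = 0"
proof -
  have "e \<in> lagrangian V" "e' \<in> lagrangian V" using E e by (auto simp: is_onb_iff)
  then show "cinner (J e) e' = 0" using lag_iff[of e'] by blast
  then show "cinner e (J e') = 0" by (metis J_J cinner_J_J complex_cnj_zero)
qed

text \<open>An orthonormal basis of \<open>lagrangian V\<close> and its conjugate together form one of the kernel of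
  \<open>V\<^sup>\<dagger>\<close>.\<close>

lemma neg_ind_lag: "neg_ind V = 2 * ecdim (lagrangian V)"
proof -
  obtain E where E: "is_onb (lagrangian V) E" using onb_exists[OF closed_lag csubspace_lag] by blast
  have Esub: "E \<subseteq> lagrangian V" "corthon E" using E by (auto simp: is_onb_iff)
  let ?N = "{x. V\<^sup>\<dagger> x = 0}"
  have oJE: "corthon (J ` E)"
    unfolding corthon_def using corthonD[OF Esub(2)] by (auto simp: cinner_J_J dest: arg_cong[of _ _ J])
  have disj: "E \<inter> J ` E = {}"
  proof (rule ccontr)
    assume "E \<inter> J ` E \<noteq> {}"
    then obtain e where e: "e \<in> E" "J e \<in> E" by blast
    then have "cinner (J e) (J e) = 0" using lag_corthon(1)[OF E] by blast
    then show False using corthonD[OF Esub(2) e(2) e(2)] by simp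
  qed
  have "is_onb ?N (E \<union> J ` E)"
  proof (rule onbI)
    show "closed ?N" by (intro closed_Collect_eq continuous_intros)
    show "csubspace ?N" by (rule csubspace_ker_adj[OF V])
    show "E \<union> J ` E \<subseteq> ?N" using Esub(1) by (auto simp: lagrangian_def rop_J[OF rV(2)])
    show "corthon (E \<union> J ` E)"
      unfolding corthon_def
    proof (intro ballI)
      fix x y assume "x \<in> E \<union> J ` E" "y \<in> E \<union> J ` E"
      then show "cinner x y = (if x = y then 1 else 0)"
        using corthonD[OF Esub(2), of x y] corthonD[OF oJE, of x y] lag_corthon[OF E] disj by auto
    qed
    show "r = 0" if "r \<in> ?N" "\<And>e. e \<in> E \<union> J ` E \<Longrightarrow> cinner e r = 0" for r
      by (rule lag_total[OF _ E]) (use that in auto)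
  qed
  then have "neg_ind V = ecard (E \<union> J ` E)"
    unfolding neg_ind_eq[OF V] ecard_def using ecdim_onb csubspace_ker_adj[OF V] by blast
  also have "\<dots> = 2 * ecard E"
  proof (cases "finite E")
    case True
    have "inj_on J E" by (rule inj_onI) (metis J_J)
    then have "card (E \<union> J ` E) = 2 * card E"
      using True disj by (simp add: card_Un_disjoint card_image)
    then show ?thesis using True by (simp add: ecard_def numeral_eq_enat)
  qed (simp add: ecard_def numeral_eq_enat)
  also have "ecard E = ecdim (lagrangian V)" unfolding ecdim_onb[OF E csubspace_lag] ecard_def ..
  finally show ?thesis .
qed

text \<open>The Lagrangian is a Hilbert--Schmidt perturbation of a subspace of \<open>S1\<close>. By the Fredholm
  alternative its vectors are projections of vectors \<open>c\<close> of the codefect of comparable norm, and the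
  difference \<open>V (V\<^sup>\<dagger> c)\<close> is a Hilbert--Schmidt image of \<open>c\<close> because \<open>V\<^sup>\<dagger> c\<close> lies in \<open>S2\<close>.\<close>

lemma is_hs_lag:
  assumes KV: "ker11 V = {0}" shows "is_hs (Q \<odot> oproj (lagrangian V))"
proof -
  have hs: "is_hs (Q \<odot> V\<^sup>\<dagger> \<odot> P)"
    by (rule is_hs_block21) (use bog_HS_hs[OF V] in \<open>simp add: pcomm_adj is_hs_minus is_hs_adj\<close>)
  interpret complementary_hs "codefect V" "defect_proj V" "Q \<odot> V\<^sup>\<dagger> \<odot> P"
  proof
    show "closed (codefect V)" unfolding codefect_def
      by (intro closed_Collect_conj closed_Collect_eq continuous_intros)
    show "subspace (codefect V)" by (auto simp: codefect_def subspace_def blin_simps)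
    show "is_hs (Q \<odot> V\<^sup>\<dagger> \<odot> P)" by (rule hs)
    fix c assume "c \<in> codefect V"
    then have c: "P c = c" "P (V\<^sup>\<dagger> c) = 0" by (auto simp: codefect_def)
    have "defect_proj V c \<bullet> V (V\<^sup>\<dagger> c) = 0"
      using adj_left[of V "defect_proj V c" "V\<^sup>\<dagger> c"] adj_defect_proj by simp
    then have "(norm c)\<^sup>2 = (norm (defect_proj V c))\<^sup>2 + (norm (V (V\<^sup>\<dagger> c)))\<^sup>2"
      using power2_norm_add[of "defect_proj V c" "V (V\<^sup>\<dagger> c)"] by (simp add: defect_proj_apply)
    then show "(norm (defect_proj V c))\<^sup>2 + (norm ((Q \<odot> V\<^sup>\<dagger> \<odot> P) c))\<^sup>2 = (norm c)\<^sup>2"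
      using c by (simp add: bog_HS_norm[OF V] blinfun.diff_left)
  qed
  have "bddbelow (defect_proj V) (codefect V)"
  proof (rule bddbelow_if_injective)
    fix c assume "c \<in> codefect V" "defect_proj V c = 0"
    then have c: "P c = c" "P (V\<^sup>\<dagger> c) = 0" "V (V\<^sup>\<dagger> c) = c" by (auto simp: codefect_def defect_proj_apply)
    let ?z = "J (V\<^sup>\<dagger> c)"
    have "P ?z = ?z" by (rule J_S2[OF c(2)])
    moreover have "P (V ?z) = 0" using J_S1[OF c(1)] by (simp add: rop_J[OF rV(1)] c(3))
    ultimately have "?z \<in> ker11 V" by (simp add: ker11_def)
    then have "V\<^sup>\<dagger> c = 0" unfolding KV by simp
    then show "c = 0" using c(3) by (simp add: blin_simps)
  qed
  then obtain G :: "'a \<Rightarrow>\<^sub>L 'a" where G: "\<And>c. c \<in> codefect V \<Longrightarrow> G (defect_proj V c) = c" "\<And>y. G y \<in> codefect V"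
    using bddbelow_left_inverse[OF S] by blast
  have "Q \<odot> oproj (lagrangian V) = - ((Q \<odot> V \<odot> (Q \<odot> V\<^sup>\<dagger> \<odot> P)) \<odot> (G \<odot> oproj (lagrangian V)))"
  proof (rule blinfun_eqI)
    fix x
    have "oproj (lagrangian V) x \<in> lagrangian V"
      by (rule oproj_in[OF closed_lag csubspace_imp_subspace[OF csubspace_lag]])
    then obtain c where c: "c \<in> codefect V" "oproj (lagrangian V) x = defect_proj V c" unfolding lag_eq_image by blast
    then have c': "P c = c" "P (V\<^sup>\<dagger> c) = 0" "G (oproj (lagrangian V) x) = c" using G(1) by (auto simp: codefect_def)
    have "Q (defect_proj V c) = - Q (V (V\<^sup>\<dagger> c))"
      unfolding defect_proj_apply blinfun.diff_right using c'(1) by (simp add: blinfun.diff_left)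
    moreover have "(Q \<odot> V \<odot> (Q \<odot> V\<^sup>\<dagger> \<odot> P)) c = Q (V (V\<^sup>\<dagger> c))"
      using c'(1,2) by (simp add: blinfun.diff_left)
    ultimately show "(Q \<odot> oproj (lagrangian V)) x = (- ((Q \<odot> V \<odot> (Q \<odot> V\<^sup>\<dagger> \<odot> P)) \<odot> (G \<odot> oproj (lagrangian V)))) x"
      using c(2) c'(3) by (simp add: blinfun.minus_left)
  qed
  then show ?thesis using hs by (metis is_hs_left is_hs_minus is_hs_right)
qed

end

end


section \<open>Standard isometries and factorization\<close>

locale separable_setting = basis_projection_setting +
  assumes infdim: "ecdim (UNIV :: 'a set) = \<infinity>"
    and separable: "separable_space (euclidean :: 'a topology)"
begin

lemma exists_countable_onb_S1: "\<exists>E. is_onb S1 E \<and> countable E \<and> infinite E"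
proof -
  obtain E where E: "is_onb S1 E" using onb_exists[OF S1] by blast
  have "countable E" using E countable_corthon[OF separable] by (auto simp: is_onb_iff)
  moreover have "infinite E"
  proof
    assume fin: "finite E"
    have "corthon E" "E \<subseteq> S1" "S1 \<subseteq> closure (cspan E)" using E by (auto simp: is_onb_iff)
    then have sub: "S1 \<subseteq> cspan E" using closed_cspan_corthon[OF fin] by simp
    have J_sub: "J y \<in> cspan (J ` E)" if y: "y \<in> cspan E" for y
    proof -
      have "csubspace {y. J y \<in> cspan (J ` E)}"
        by (auto simp: complex_vector.subspace_def J_add J_scaleC complex_vector.span_zero
            intro: complex_vector.span_add complex_vector.span_scale)
      then have "cspan E \<subseteq> {y. J y \<in> cspan (J ` E)}"
        by (intro complex_vector.span_minimal) (auto intro: complex_vector.span_base)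
      then show ?thesis using y by blast
    qed
    have "x \<in> cspan (E \<union> J ` E)" for x
    proof -
      have "P x \<in> cspan E" "J (P (J x)) \<in> cspan (J ` E)" using sub J_sub by auto
      then have "P x \<in> cspan (E \<union> J ` E)" "J (P (J x)) \<in> cspan (E \<union> J ` E)"
        using complex_vector.span_mono[of E "E \<union> J ` E"] complex_vector.span_mono[of "J ` E" "E \<union> J ` E"] by auto
      then have "P x + J (P (J x)) \<in> cspan (E \<union> J ` E)" by (rule complex_vector.span_add)
      then show ?thesis by (simp only: P_J_P)
    qed
    then have "\<exists>B::'a set. finite B \<and> UNIV \<subseteq> cspan B" using fin by (intro exI[of _ "E \<union> J ` E"]) auto
    then show False using infdim by (auto simp: ecdim_def split: if_splits)
  qed
  ultimately show ?thesis using E by blast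
qed

lemma exists_unit1: "\<exists>e. unit1 e"
proof -
  obtain E where E: "is_onb S1 E" "infinite E" using exists_countable_onb_S1 by blast
  then obtain e where "e \<in> E" by fastforce
  then have "P e = e" "norm e = 1"
    using E in_range_P[of e] corthon_norm[of E e] by (auto simp: is_onb_iff)
  then show ?thesis by (auto simp: unit1_def)
qed

text \<open>A model isometry of given index: it shifts an orthonormal basis of \<open>S1\<close>, and its index is twice
  the number of omitted basis vectors (\<open>std_shift_neg_ind\<close>).\<close>

definition std_shift :: "('a \<Rightarrow>\<^sub>L 'a) \<Rightarrow> 'a set \<Rightarrow> 'a set \<Rightarrow> bool" where
  "std_shift W E F \<longleftrightarrow> is_onb S1 E \<and> countable E \<and> F \<subseteq> E \<and> bij_betw W E F \<and>
     W \<in> bog_HS J P \<and> pcomm W = 0"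

lemma exists_std_shift: "\<exists>W E F. std_shift W E F \<and> ecard (E - F) = m"
proof -
  obtain E where E: "is_onb S1 E" "countable E" "infinite E" using exists_countable_onb_S1 by blast
  obtain F where F: "F \<subseteq> E" "infinite F" "ecard (E - F) = m"
    using infinite_subset_prescribed_complement[OF E(3,2)] by blast
  have "countable F" using F(1) E(2) countable_subset by blast
  then obtain g where g: "bij_betw g E F"
    using ecard_bij[of E F] E(2,3) F(2) by (auto simp: ecard_def)
  have ES: "E \<subseteq> S1" "S1 \<subseteq> closure (cspan E)" "corthon E" using E(1) by (auto simp: is_onb_iff)
  have "corthon (g ` E)" "inj_on g E"
    using g F(1) corthon_subset[OF ES(3)] by (auto simp: bij_betw_def)
  then obtain T where T: "clinear_op T" "\<And>e. e \<in> E \<Longrightarrow> T e = g e" "\<And>x. x \<in> S1 \<Longrightarrow> norm (T x) = norm x"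
    using isometric_extension[OF S1 E(1)] by blast
  have TS: "P (T x) = T x" if "P x = x" for x
  proof -
    have "T x \<in> S1"
    proof (rule clinear_maps_closure[OF T(1) S1])
      show "T e \<in> S1" if "e \<in> E" for e
      proof -
        have "g e \<in> F" using g that by (auto simp: bij_betw_def)
        then show ?thesis using T(2)[OF that] F(1) ES(1) by auto
      qed
      show "x \<in> closure (cspan E)" using ES(2) \<open>P x = x\<close> in_range_P by blast
    qed
    then show ?thesis using in_range_P by blast
  qed
  let ?W = "dbl T"
  have comm: "?W (P x) = P (?W x)" for x
  proof -
    have "P (J (T (P (J x)))) = 0" by (rule J_S1) (simp add: TS)
    then show ?thesis by (simp add: dbl_S1 TS dbl_apply[of T x] blinfun.add_right)
  qed
  have "?W \<in> bog_HS J P"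
  proof (rule bog_HSI)
    show "rop ?W" by (rule rop_dbl[OF T(1)])
    show "norm (?W x) = norm x" for x
    proof (rule dbl_isometry)
      show "norm (T x) = norm x" if "P x = x" for x using T(3) that in_range_P by blast
      show "cinner (J (T x)) (T y) = 0" if "P x = x" "P y = y" for x y
        using cinner_S1_S2(2)[OF TS[OF that(2)] J_S1[OF TS[OF that(1)]]] .
    qed
    have "pcomm ?W = 0" using comm by (simp add: pcomm_zero_iff)
    then show "is_hs (pcomm ?W)" by (simp add: is_hs_zero)
  qed
  moreover have "pcomm ?W = 0" using comm by (simp add: pcomm_zero_iff)
  moreover have "?W e = g e" if "e \<in> E" for e
    using that ES(1) in_range_P T(2) by (metis dbl_S1 subsetD)
  then have "bij_betw ?W E F" using g bij_betw_cong[of E "blinfun_apply ?W" g F] by blast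
  ultimately show ?thesis using E F unfolding std_shift_def by blast
qed

context
  fixes W E F assumes std: "std_shift W E F"
begin

lemma std_shiftD:
  shows "is_onb S1 E" "countable E" "F \<subseteq> E" "bij_betw W E F" "W \<in> bog_HS J P"
    "\<And>x. W (P x) = P (W x)" "\<And>x. W\<^sup>\<dagger> (P x) = P (W\<^sup>\<dagger> x)"
    "E \<subseteq> S1" "S1 \<subseteq> closure (cspan E)" "corthon E"
proof -
  show h: "is_onb S1 E" "countable E" "F \<subseteq> E" "bij_betw W E F" "W \<in> bog_HS J P"
    using std by (auto simp: std_shift_def)
  have 0: "pcomm W = 0" using std by (simp add: std_shift_def)
  then show "\<And>x. W (P x) = P (W x)" by (simp add: pcomm_zero_iff)
  have "pcomm (W\<^sup>\<dagger>) = 0"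
    unfolding pcomm_adj 0 using adj_unique[of "0 :: 'a \<Rightarrow>\<^sub>L 'a" 0] by simp
  then show "\<And>x. W\<^sup>\<dagger> (P x) = P (W\<^sup>\<dagger> x)" by (simp add: pcomm_zero_iff)
  show "E \<subseteq> S1" "S1 \<subseteq> closure (cspan E)" "corthon E" using h(1) by (auto simp: is_onb_iff)
qed

lemma std_shift_adj_complement:
  assumes "e \<in> E - F" shows "W\<^sup>\<dagger> e = 0"
proof -
  have "P (W\<^sup>\<dagger> e) = W\<^sup>\<dagger> e" using std_shiftD(7,8) assms in_range_P by (metis DiffD1 subsetD)
  then have mem: "W\<^sup>\<dagger> e \<in> closure (cspan E)" using std_shiftD(9) in_range_P by blast
  have "cinner (W\<^sup>\<dagger> e) e' = 0" if "e' \<in> E" for e'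
  proof -
    have "W e' \<in> F" using std_shiftD(4) that by (auto simp: bij_betw_def)
    then have "cinner e (W e') = 0" using corthonD[OF std_shiftD(10), of e "W e'"] assms std_shiftD(3) by auto
    then show ?thesis by (simp add: cinner_adj_left rop_clinear bog_HS_rop std_shiftD(5))
  qed
  then have "cinner (W\<^sup>\<dagger> e) (W\<^sup>\<dagger> e) = 0" using mem by (rule corth_closure_span)
  then show ?thesis by simp
qed

text \<open>As \<open>W\<close> commutes with \<open>P\<close>, its Lagrangian is the codefect itself.\<close>

lemma std_shift_lag: "is_onb (lagrangian W) (E - F)"
proof -
  note WHS = std_shiftD(5)
  have cod: "codefect W = {c. P c = c \<and> W\<^sup>\<dagger> c = 0}"
    using std_shiftD(7) by (auto simp: codefect_def) (metis)
  have lag: "lagrangian W = {c. P c = c \<and> W\<^sup>\<dagger> c = 0}"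
  proof -
    have "defect_proj W c = c" if "c \<in> codefect W" for c
      using that cod by (simp add: defect_proj_apply blin_simps)
    then show ?thesis unfolding lag_eq_image[OF WHS] using cod by force
  qed
  show ?thesis
  proof (rule onbI[OF closed_lag[OF WHS] csubspace_lag[OF WHS]])
    show "E - F \<subseteq> lagrangian W" using std_shift_adj_complement std_shiftD(8) in_range_P by (auto simp: lag)
    show "corthon (E - F)" using corthon_subset[OF std_shiftD(10)] by blast
    fix r assume r: "r \<in> lagrangian W" "\<And>e. e \<in> E - F \<Longrightarrow> cinner e r = 0"
    have "cinner e r = 0" if eF: "e \<in> F" for e
    proof -
      obtain e' where "e = W e'" using std_shiftD(4) eF by (auto simp: bij_betw_def)
      then show ?thesis using r(1) lag cinner_adj_right[OF rop_clinear[OF bog_HS_rop[OF WHS]], of e' r] by simp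
    qed
    then have "cinner r e = 0" if "e \<in> E" for e
      using r(2) that by (metis Diff_iff cinner_commute complex_cnj_zero)
    moreover have "r \<in> closure (cspan E)" using r(1) lag std_shiftD(9) in_range_P by blast
    ultimately have "cinner r r = 0" by (rule corth_closure_span)
    then show "r = 0" by simp
  qed
qed

lemma std_shift_neg_ind: "neg_ind W = 2 * ecard (E - F)"
  unfolding neg_ind_lag[OF std_shiftD(5)] ecdim_onb[OF std_shift_lag csubspace_lag[OF std_shiftD(5)]] ecard_def ..

lemma std_shift_reflection:
  assumes e: "e \<in> E - F" shows "unit1 e" "reflection e \<odot> W = W"
proof -
  show "unit1 e" using e std_shiftD(8) corthon_norm[OF std_shiftD(10)] in_range_P by (auto simp: unit1_def)
  have r: "rop W" by (rule bog_HS_rop[OF std_shiftD(5)])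
  have "cinner (e - J e) (W x) = 0" for x
  proof -
    have "W\<^sup>\<dagger> (e - J e) = 0" using std_shift_adj_complement[OF e] rop_J[OF rop_adj[OF r]] by (simp add: blin_simps)
    then show ?thesis using cinner_adj_left[OF rop_clinear[OF r], of "e - J e" x] by simp
  qed
  then show "reflection e \<odot> W = W" by (intro blinfun_eqI) (simp add: reflection_apply)
qed

text \<open>\<open>U\<close> is prescribed on an orthonormal basis of \<open>S1\<close>: it sends \<open>W e\<close> to \<open>V e\<close> and the omitted basis
  vectors to an orthonormal basis of \<open>lagrangian V\<close>. These values span an isotropic subspace, so that
  \<open>dbl\<close> extends \<open>U\<close> to a real isometry, and \<open>U\<close> is onto because the Lagrangian and its conjugate fill
  the kernel of \<open>V\<^sup>\<dagger>\<close>. In \<open>U = V W\<^sup>\<dagger> + U (1 - W W\<^sup>\<dagger>)\<close> the second term maps \<open>S1\<close> to \<open>lagrangian V\<close>,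
  where \<open>Q\<close> is Hilbert--Schmidt.\<close>

lemma factorization:
  assumes V: "V \<in> bog_HS J P" and KV: "ker11 V = {0}" and dim: "ecdim (lagrangian V) = ecard (E - F)"
  shows "\<exists>U\<in>bogU. U \<odot> W = V"
proof -
  note WHS = std_shiftD(5)
  have rV: "rop V" and rW: "rop W" using V WHS bog_HS_rop by auto
  note cV = rop_clinear[OF rV] and cW = rop_clinear[OF rW]
  obtain EI where EI: "is_onb (lagrangian V) EI" using onb_exists[OF closed_lag[OF V] csubspace_lag[OF V]] by blast
  have EI': "EI \<subseteq> lagrangian V" "corthon EI" "lagrangian V \<subseteq> closure (cspan EI)" using EI by (auto simp: is_onb_iff)
  have "ecard (E - F) = ecard EI"
    using ecdim_onb[OF EI csubspace_lag[OF V]] dim by (simp add: ecard_def)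
  then obtain \<phi> where phi: "bij_betw \<phi> (E - F) EI"
    using ecard_bij[of "E - F" EI] std_shiftD(2) countable_corthon[OF separable EI'(2)] by blast
  define g where "g e = (if e \<in> F then V (W\<^sup>\<dagger> e) else \<phi> e)" for e
  have gW: "g (W e) = V e" if "e \<in> E" for e
  proof -
    have "W e \<in> F" using std_shiftD(4) that by (auto simp: bij_betw_def)
    then show ?thesis by (simp add: g_def bog_HS_adj_left[OF WHS])
  qed
  have F_eq: "F = blinfun_apply W ` E" using std_shiftD(4) by (simp add: bij_betw_def)
  have split: "a \<in> E - F \<or> (\<exists>c. c \<in> E \<and> a = W c)" if "a \<in> E" for a using F_eq that by blast
  have gphi: "g e = \<phi> e" "g e \<in> EI" if "e \<in> E - F" for e
    using that phi by (auto simp: g_def bij_betw_def)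
  have lagV: "V\<^sup>\<dagger> p = 0" if "p \<in> EI" for p using that EI'(1) by (auto simp: lagrangian_def)
  have V_lag: "cinner (V x) p = 0" "cinner p (V x) = 0" if "p \<in> EI" for x p
    using lagV[OF that] cinner_adj_left[OF cV, of p x] cinner_adj_right[OF cV, of x p] by simp_all
  \<comment> \<open>\<open>V\<close> preserves orthonormality, and its range is orthogonal to the Lagrangian\<close>
  have g_on: "cinner (g a) (g b) = (if a = b then 1 else 0)" if ab: "a \<in> E" "b \<in> E" for a b
  proof -
    consider (1) c d where "c \<in> E" "d \<in> E" "a = W c" "b = W d" | (2) c where "c \<in> E" "a = W c" "b \<in> E - F"
      | (3) d where "a \<in> E - F" "d \<in> E" "b = W d" | (4) "a \<in> E - F" "b \<in> E - F"
      using split[OF ab(1)] split[OF ab(2)] by blast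
    then show ?thesis
    proof cases
      case 1
      then have "cinner (g a) (g b) = cinner c d" by (simp add: gW bog_HS_cinner[OF V])
      also have "\<dots> = cinner a b" using 1 by (simp add: bog_HS_cinner[OF WHS])
      finally show ?thesis using corthonD[OF std_shiftD(10) ab] by simp
    next
      case 2
      then have "a \<noteq> b" using F_eq by blast
      then show ?thesis using 2 V_lag(1)[OF gphi(2)] by (simp add: gW)
    next
      case 3
      then have "a \<noteq> b" using F_eq by blast
      then show ?thesis using 3 V_lag(2)[OF gphi(2)] by (simp add: gW)
    next
      case 4
      have "cinner (g a) (g b) = (if \<phi> a = \<phi> b then 1 else 0)"
        using corthonD[OF EI'(2) gphi(2)[OF 4(1)] gphi(2)[OF 4(2)]] gphi(1)[OF 4(1)] gphi(1)[OF 4(2)] by simp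
      then show ?thesis using 4 phi by (auto simp: bij_betw_def inj_on_eq_iff)
    qed
  qed
  have inj_g: "inj_on g E" using g_on by (intro inj_onI) (metis zero_neq_one)
  moreover have "corthon (g ` E)" unfolding corthon_def using g_on inj_on_eq_iff[OF inj_g] by auto
  ultimately obtain T where T: "clinear_op T" "\<And>e. e \<in> E \<Longrightarrow> T e = g e" "\<And>x. x \<in> S1 \<Longrightarrow> norm (T x) = norm x"
    using isometric_extension[OF S1 std_shiftD(1)] by blast
  define M where "M = closure (cspan (g ` E))"
  have M: "closed M" "csubspace M" unfolding M_def by (auto intro: csubspace_closure)
  have gM: "g e \<in> M" if "e \<in> E" for e
    unfolding M_def by (rule subsetD[OF closure_subset complex_vector.span_base]) (use that in blast)
  have TM: "T x \<in> M" if "P x = x" for x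
    by (rule clinear_maps_closure[OF T(1) M _ , of E]) (use T(2) gM that in_range_P std_shiftD(9) in auto)
  have lag_M: "p \<in> M" if "p \<in> lagrangian V" for p
  proof -
    have "EI \<subseteq> M"
    proof
      fix p assume "p \<in> EI"
      then obtain e where "e \<in> E - F" "p = \<phi> e" using phi by (auto simp: bij_betw_def)
      then show "p \<in> M" using gM[of e] gphi(1)[of e] by simp
    qed
    then have "closure (cspan EI) \<subseteq> M" using M by (intro closure_minimal complex_vector.span_minimal)
    then show ?thesis using that EI'(3) by blast
  qed
  have g_iso: "cinner (J (g a)) (g b) = 0" if ab: "a \<in> E" "b \<in> E" for a b
  proof -
    have JV: "J (V x) = V (J x)" for x by (simp add: rop_J[OF rV])
    consider (1) c d where "c \<in> E" "d \<in> E" "a = W c" "b = W d" | (2) c where "c \<in> E" "a = W c" "b \<in> E - F"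
      | (3) d where "a \<in> E - F" "d \<in> E" "b = W d" | (4) "a \<in> E - F" "b \<in> E - F"
      using split[OF ab(1)] split[OF ab(2)] by blast
    then show ?thesis
    proof cases
      case 1
      have "P c = c" "P d = d" using 1 std_shiftD(8) in_range_P by blast+
      then have "cinner (J c) d = 0" using cinner_S1_S2(2)[OF _ J_S1] by blast
      then show ?thesis using 1 by (simp add: gW JV bog_HS_cinner[OF V])
    next
      case 2
      then show ?thesis using V_lag(1)[OF gphi(2)] by (simp add: gW JV)
    next
      case 3
      have "cinner (J (g b)) (g a) = 0" using 3 V_lag(1)[OF gphi(2)] by (simp add: gW JV)
      then show ?thesis using cinner_J_sym by metis
    next
      case 4
      then show ?thesis using lag_corthon(1)[OF V EI gphi(2) gphi(2)] by blast
    qed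
  qed
  have M_iso: "cinner (J x) y = 0" if "x \<in> M" "y \<in> M" for x y
  proof -
    have "cinner (J b) y = 0" if "b \<in> g ` E" for b
      by (rule corth_closure_span[of "g ` E"]) (use that g_iso \<open>y \<in> M\<close> M_def in auto)
    then have "cinner (J y) b = 0" if "b \<in> g ` E" for b using that cinner_J_sym by metis
    then have "cinner (J y) x = 0" using \<open>x \<in> M\<close> unfolding M_def by (rule corth_closure_span)
    then show ?thesis using cinner_J_sym by metis
  qed
  define U where "U = dbl T"
  have rU: "rop U" unfolding U_def by (rule rop_dbl[OF T(1)])
  have U_S1: "U x = T x" if "P x = x" for x unfolding U_def by (rule dbl_S1[OF that])
  have U_norm: "norm (U x) = norm x" for x
    unfolding U_def
  proof (rule dbl_isometry)
    show "norm (T x) = norm x" if "P x = x" for x using T(3) that in_range_P by blast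
    show "cinner (J (T x)) (T y) = 0" if "P x = x" "P y = y" for x y by (intro M_iso TM that)
  qed
  have UU: "U\<^sup>\<dagger> (U x) = x" for x
  proof -
    have "U\<^sup>\<dagger> \<odot> U = id_blinfun" using U_norm isometry_iff by blast
    then show ?thesis using blinfun_apply_blinfun_compose[of "U\<^sup>\<dagger>" U x] by simp
  qed
  have UE: "U e = g e" if "e \<in> E" for e using that U_S1 T(2) std_shiftD(8) in_range_P by (metis subsetD)
  have UW: "U \<odot> W = V"
  proof (rule rop_eqI[OF rop_compose[OF rU rW] rV std_shiftD(1)])
    fix e assume "e \<in> E"
    then have "W e \<in> E" using F_eq std_shiftD(3) by blast
    then show "(U \<odot> W) e = V e" using UE gW[OF \<open>e \<in> E\<close>] by simp
  qed
  have UWx: "U (W x) = V x" for x using UW by (metis blinfun_apply_blinfun_compose)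
  have V_adj: "V\<^sup>\<dagger> x = W\<^sup>\<dagger> (U\<^sup>\<dagger> x)" for x using UW by (metis adj_compose blinfun_apply_blinfun_compose)
  have hs: "is_hs (Q \<odot> U \<odot> P)"
  proof -
    let ?D = "defect_proj W"
    have eq: "Q \<odot> U \<odot> P = (Q \<odot> V \<odot> P) \<odot> W\<^sup>\<dagger> + (Q \<odot> oproj (lagrangian V)) \<odot> (U \<odot> (?D \<odot> P))"
    proof (rule blinfun_eqI)
      fix x
      let ?z = "?D (P x)"
      have Pz: "P ?z = ?z" by (simp add: defect_proj_apply blinfun.diff_right std_shiftD(6,7)[symmetric])
      have "U ?z \<in> lagrangian V"
      proof -
        have "V\<^sup>\<dagger> (U ?z) = 0" unfolding V_adj UU using adj_defect_proj[OF WHS] .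
        moreover have "cinner (J p) (U ?z) = 0" if "p \<in> lagrangian V" for p
          using M_iso[OF lag_M[OF that] TM[OF Pz]] U_S1[OF Pz] by simp
        ultimately show ?thesis using lag_iff[OF V] by blast
      qed
      then have "oproj (lagrangian V) (U ?z) = U ?z"
        by (intro oproj_id closed_lag[OF V] csubspace_imp_subspace[OF csubspace_lag[OF V]])
      moreover have "U (P x) = V (P (W\<^sup>\<dagger> x)) + U ?z"
        by (simp add: defect_proj_apply blinfun.diff_right UWx std_shiftD(7))
      ultimately show "(Q \<odot> U \<odot> P) x = ((Q \<odot> V \<odot> P) \<odot> W\<^sup>\<dagger> + (Q \<odot> oproj (lagrangian V)) \<odot> (U \<odot> (?D \<odot> P))) x"
        by (simp only: blinfun_apply_blinfun_compose blinfun.add_left blinfun.add_right)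
    qed
    show ?thesis unfolding eq
      by (rule is_hs_add[OF is_hs_right[OF is_hs_block21[OF bog_HS_hs[OF V]]] is_hs_right[OF is_hs_lag[OF V KV]]])
  qed
  have "U \<in> bog_HS J P"
  proof (rule bog_HSI[OF rU U_norm])
    have "Jop \<odot> (Q \<odot> U \<odot> P) \<odot> Jop = P \<odot> U \<odot> Q"
      by (rule blinfun_eqI) (simp only: blinfun_apply_blinfun_compose Jop_apply P_J Q_J rop_J[OF rU] J_J)
    moreover have "is_hs (Jop \<odot> (Q \<odot> U \<odot> P) \<odot> Jop)" by (rule is_hs_right[OF is_hs_left[OF hs]])
    ultimately show "is_hs (pcomm U)" using is_hs_block12_iff[OF rU] by simp
  qed
  moreover have "y = 0" if y: "U\<^sup>\<dagger> y = 0" for y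
  proof (rule lag_total[OF V _ EI])
    show "V\<^sup>\<dagger> y = 0" unfolding V_adj y by (simp add: blin_simps)
    have 0: "cinner (U x) y = 0" for x using cinner_adj_right[OF rop_clinear[OF rU], of x y] y by simp
    fix p assume "p \<in> EI"
    then obtain e where e: "e \<in> E - F" "p = \<phi> e" using phi by (auto simp: bij_betw_def)
    then have "p = U e" using UE[of e] gphi(1)[of e] by simp
    then show "cinner p y = 0" "cinner (J p) y = 0" using 0[of e] 0[of "J e"] rop_J[OF rU, of e] by simp_all
  qed
  ultimately have "U \<in> bogU" by (rule bogUI)
  then show ?thesis using UW by blast
qed

text \<open>Reflections make the first diagonal block of \<open>V\<close> injective and do not change the index.\<close>

lemma factorization_index:
  assumes V: "V \<in> bog_HS J P" and ind: "neg_ind V = 2 * ecard (E - F)"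
  shows "\<exists>U\<in>bogU. U \<odot> W = V"
proof -
  obtain es where es: "\<forall>e\<in>set es. unit1 e" "ker11 (rprod es \<odot> V) = {0}"
    using exists_rprod_ker11_zero[OF V] by (elim exE conjE)
  have R: "rprod es \<in> bogU" by (rule rprod_bogU[OF es(1)])
  have RV: "rprod es \<odot> V \<in> bog_HS J P" by (rule bog_HS_compose[OF bogU_HS[OF R] V])
  have "2 * ecdim (lagrangian (rprod es \<odot> V)) = 2 * ecard (E - F)"
    using neg_ind_lag[OF RV] neg_ind_bogU_left[OF R V] ind by simp
  then have "ecdim (lagrangian (rprod es \<odot> V)) = ecard (E - F)" by (simp only: enat_double_eq_iff)
  then obtain U where U: "U \<in> bogU" "U \<odot> W = rprod es \<odot> V" using factorization[OF RV es(2)] by blast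
  have "(rprod es)\<^sup>\<dagger> \<odot> U \<odot> W = V"
    by (simp only: bmul_assoc U(2)) (simp only: bmul_assoc[symmetric] bog_HS_isometry[OF bogU_HS[OF R]] bmul_id)
  then show ?thesis using bogU_compose[OF bogU_adj[OF R] U(1)] by blast
qed

text \<open>The factor \<open>U\<close> may have the wrong parity. It can then be replaced by its product with the
  reflection of an omitted basis vector, which fixes \<open>W\<close>.\<close>

lemma linked_std_shift:
  assumes V: "V \<in> bog_HS J P" and ind: "neg_ind V = 2 * ecard (E - F)" and ne: "E - F \<noteq> {}"
  shows "linked V W"
proof -
  note WHS = std_shiftD(5)
  obtain e where e: "e \<in> E - F" using ne by blast
  have ue: "unit1 e" "reflection e \<odot> W = W" using std_shift_reflection[OF e] by auto
  obtain U where U: "U \<in> bogU" "U \<odot> W = V" using factorization_index[OF V ind] by blast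
  have lift: "linked V W" if "U' \<in> bogU" "U' \<odot> W = V" "even (cdim (ker11 U'))" for U'
  proof -
    have "linked U' id_blinfun" using linked_classification[OF that(1) ue(1)] that(3) by simp
    then have "linked (U' \<odot> W) (id_blinfun \<odot> W)" by (rule linked_right[OF WHS])
    then show ?thesis using that(2) by simp
  qed
  show ?thesis
  proof (cases "even (cdim (ker11 U))")
    case True
    then show ?thesis using lift U by blast
  next
    case False
    note c = reflection_conj[OF bogU_HS[OF U(1)] ue(1)]
    show ?thesis
    proof (rule lift)
      show "U \<odot> reflection e \<in> bogU" by (intro bogU_compose U reflection_bogU ue)
      show "U \<odot> reflection e \<odot> W = V" by (simp only: bmul_assoc ue(2) U(2))
      show "even (cdim (ker11 (U \<odot> reflection e)))"
        unfolding c(2) using cdim_ker11_reflection_parity[OF U(1) c(1)] False by simp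
    qed
  qed
qed

end

lemma neg_ind_even:
  assumes "V \<in> bog_HS J P" shows "\<exists>m. neg_ind V = 2 * m"
  using neg_ind_lag[OF assms] by blast


section \<open>The connected components\<close>

text \<open>A complete invariant of the components (\<open>linked_imp_same_class\<close>,
  \<open>same_class_imp_linked\<close>).\<close>

definition bog_class :: "('a \<Rightarrow>\<^sub>L 'a) \<Rightarrow> enat \<times> int" where
  "bog_class V = (neg_ind V, if neg_ind V = 0 then bog_chi P V else 0)"

lemma bog_class_locally_constant:
  assumes V: "V \<in> bog_HS J P"
  shows "\<exists>r>0. \<forall>W\<in>bog_HS J P. bog_dist P V W < r \<longrightarrow> bog_class W = bog_class V"
proof (cases "neg_ind V = 0")
  case True
  then have VU: "V \<in> bogU" using V bogU_iff_neg_ind by blast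
  obtain c where c: "c > 0" "\<And>W. W \<in> bogU \<Longrightarrow> norm (W - V) < c \<Longrightarrow> even (cdim (ker11 W)) = even (cdim (ker11 V))"
    using ker11_parity_locally_constant[OF VU] by blast
  show ?thesis
  proof (intro exI[of _ "min 1 c"] conjI ballI impI)
    show "0 < min 1 c" using c(1) by simp
    fix W assume W: "W \<in> bog_HS J P" "bog_dist P V W < min 1 c"
    then have n: "norm (V - W) < 1" "norm (W - V) < c"
      using norm_diff_le_bog_dist[of V W] by (auto simp: norm_minus_commute)
    have "neg_ind W = 0" using neg_ind_near[OF V W(1) n(1)] True by simp
    moreover from this have "W \<in> bogU" using W(1) bogU_iff_neg_ind by blast
    then have "bog_chi P W = bog_chi P V" using c(2)[OF _ n(2)] by (simp add: bog_chi_eq)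
    ultimately show "bog_class W = bog_class V" using True by (simp add: bog_class_def)
  qed
next
  case False
  show ?thesis
  proof (intro exI[of _ 1] conjI ballI impI)
    fix W assume W: "W \<in> bog_HS J P" "bog_dist P V W < 1"
    then have "norm (V - W) < 1" using norm_diff_le_bog_dist[of V W] by simp
    then show "bog_class W = bog_class V" using neg_ind_near[OF V W(1)] False by (simp add: bog_class_def)
  qed simp
qed

lemma linked_imp_same_class:
  assumes "linked V W" shows "bog_class V = bog_class W"
proof (rule ccontr)
  assume ne: "bog_class V \<noteq> bog_class W"
  obtain T where T: "connectedin bogm.mtopology T" "V \<in> T" "W \<in> T"
    using assms unfolding linked_def connected_component_of_def bog_topology_def by blast
  have open_class: "openin bogm.mtopology {X \<in> bog_HS J P. Pr (bog_class X)}" for Pr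
    unfolding bogm.openin_mtopology
  proof (intro conjI allI impI)
    fix X assume "X \<in> {X \<in> bog_HS J P. Pr (bog_class X)}"
    then have X: "X \<in> bog_HS J P" "Pr (bog_class X)" by auto
    obtain r where r: "r > 0" "\<And>Y. Y \<in> bog_HS J P \<Longrightarrow> bog_dist P X Y < r \<Longrightarrow> bog_class Y = bog_class X"
      using bog_class_locally_constant[OF X(1)] by blast
    have "Y \<in> bog_HS J P \<and> Pr (bog_class Y)" if "Y \<in> bogm.mball X r" for Y
    proof -
      have Y: "Y \<in> bog_HS J P" "bog_dist P X Y < r" using that by simp_all
      show ?thesis unfolding r(2)[OF Y] using Y(1) X(2) by blast
    qed
    then show "\<exists>r>0. bogm.mball X r \<subseteq> {X \<in> bog_HS J P. Pr (bog_class X)}" using r(1) by blast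
  qed auto
  let ?A = "{X \<in> bog_HS J P. bog_class X = bog_class V}"
  let ?B = "{X \<in> bog_HS J P. bog_class X \<noteq> bog_class V}"
  have sub: "T \<subseteq> bog_HS J P" using connectedin_subset_topspace[OF T(1)] by simp
  show False
  proof (rule connectedinD[OF T(1) open_class[of "\<lambda>c. c = bog_class V"] open_class[of "\<lambda>c. c \<noteq> bog_class V"]])
    show "T \<subseteq> ?A \<union> ?B" using sub by blast
    show "?A \<inter> ?B \<inter> T = {}" by blast
    show "?A \<inter> T \<noteq> {}" using T(2) sub by blast
    show "?B \<inter> T \<noteq> {}" using T(3) sub ne by fastforce
  qed
qed

lemma same_class_imp_linked:
  assumes V: "V \<in> bog_HS J P" and W: "W \<in> bog_HS J P" and eq: "bog_class V = bog_class W"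
  shows "linked V W"
proof -
  have ind: "neg_ind V = neg_ind W" using eq by (simp add: bog_class_def)
  show ?thesis
  proof (cases "neg_ind V = 0")
    case True
    then have UU: "V \<in> bogU" "W \<in> bogU" using V W ind bogU_iff_neg_ind by auto
    have "bog_chi P V = bog_chi P W" using eq True ind by (simp add: bog_class_def)
    then have par: "even (cdim (ker11 W)) = even (cdim (ker11 V))" by (simp add: bog_chi_eq split: if_splits)
    obtain e where e: "unit1 e" using exists_unit1 by blast
    show ?thesis
      using linked_trans[OF linked_classification[OF UU(1) e]
          linked_sym[OF linked_classification[OF UU(2) e, unfolded par]]] .
  next
    case False
    obtain m where m: "neg_ind V = 2 * m" using neg_ind_even[OF V] by blast
    obtain X E F where X: "std_shift X E F" "ecard (E - F) = m" using exists_std_shift by blast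
    have "E - F \<noteq> {}"
    proof
      assume "E - F = {}"
      then have "ecard (E - F) = 0" by (simp only: ecard_def) (simp add: zero_enat_def)
      then have "m = 0" using X(2) by simp
      then show False using False m by simp
    qed
    then have "linked V X" "linked W X" using linked_std_shift[OF X(1)] V W m ind X(2) by auto
    then show ?thesis using linked_sym linked_trans by blast
  qed
qed

lemma connected_components_bog:
  "connected_components_of (bog_topology J P) =
    {bog_HS_plus J P, bog_HS_minus J P} \<union> {bog_HS_ind J P m | m. 1 \<le> m}"
proof -
  define cls where "cls c = {W \<in> bog_HS J P. bog_class W = c}" for c
  have comp: "connected_component_of_set (bog_topology J P) V = cls (bog_class V)" if "V \<in> bog_HS J P" for V
  proof -
    have "linked V W \<longleftrightarrow> W \<in> bog_HS J P \<and> bog_class W = bog_class V" for W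
    proof
      assume l: "linked V W"
      then have "W \<in> bog_HS J P"
        unfolding linked_def using connected_component_in_topspace[of "bog_topology J P" V W] by simp
      then show "W \<in> bog_HS J P \<and> bog_class W = bog_class V" using linked_imp_same_class[OF l] by simp
    next
      assume "W \<in> bog_HS J P \<and> bog_class W = bog_class V"
      then show "linked V W" using same_class_imp_linked[OF that] by simp
    qed
    then show ?thesis unfolding cls_def linked_def[symmetric] by (rule Collect_cong)
  qed
  have plus: "bog_HS_plus J P = cls (0, 1)" and minus: "bog_HS_minus J P = cls (0, - 1)"
    by (auto simp: bog_HS_plus_def bog_HS_minus_def bog_HS_ind_def cls_def bog_class_def)
  have ind: "bog_HS_ind J P m = cls (2 * m, 0)" if "1 \<le> m" for m
  proof -
    have "2 * m \<noteq> 0" using that by auto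
    then show ?thesis by (auto simp: bog_HS_ind_def cls_def bog_class_def)
  qed
  have "cls (bog_class V) \<in> {cls (0, 1), cls (0, - 1)} \<union> {cls (2 * m, 0) | m. 1 \<le> m}"
    if V: "V \<in> bog_HS J P" for V
  proof (cases "neg_ind V = 0")
    case True
    then show ?thesis by (auto simp: bog_class_def bog_chi_eq)
  next
    case False
    obtain m where m: "neg_ind V = 2 * m" using neg_ind_even[OF V] by blast
    then have "1 \<le> m" using False by (cases "m = 0") (auto simp: ileI1 one_eSuc)
    then show ?thesis using False m by (auto simp: bog_class_def)
  qed
  moreover have "cls (0, 1) \<in> (\<lambda>V. cls (bog_class V)) ` bog_HS J P"
  proof -
    have id: "id_blinfun \<in> bog_HS J P" "neg_ind (id_blinfun :: 'a \<Rightarrow>\<^sub>L 'a) = 0"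
      using id_bogU bogU_iff_neg_ind by auto
    have "ker11 id_blinfun = {0}" by (auto simp: ker11_def blin_simps)
    then have "cdim (ker11 id_blinfun) = 0" using cdim_ker11_zero[OF id(1)] by blast
    then have "bog_class id_blinfun = (0, 1)" using id(2) by (simp add: bog_class_def bog_chi_eq)
    then show ?thesis using id(1) by (metis image_eqI)
  qed
  moreover have "cls (0, - 1) \<in> (\<lambda>V. cls (bog_class V)) ` bog_HS J P"
  proof -
    obtain e where e: "unit1 e" using exists_unit1 by blast
    have r: "reflection e \<in> bog_HS J P" "neg_ind (reflection e) = 0"
      using reflection_bogU[OF e] bogU_iff_neg_ind by auto
    have "ker11 id_blinfun = {0}" by (auto simp: ker11_def blin_simps)
    then have "cdim (ker11 id_blinfun) = 0" using cdim_ker11_zero[OF bogU_HS[OF id_bogU]] by blast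
    then have "odd (cdim (ker11 (reflection e)))" using cdim_ker11_reflection_parity[OF id_bogU e] by simp
    then have "bog_class (reflection e) = (0, - 1)" using r(2) by (simp add: bog_class_def bog_chi_eq)
    then show ?thesis using r(1) by (metis image_eqI)
  qed
  moreover have "cls (2 * m, 0) \<in> (\<lambda>V. cls (bog_class V)) ` bog_HS J P" if "1 \<le> m" for m
  proof -
    obtain X E F where X: "std_shift X E F" "ecard (E - F) = m" using exists_std_shift by blast
    have "neg_ind X = 2 * m" using std_shift_neg_ind[OF X(1)] X(2) by simp
    moreover have "2 * m \<noteq> 0" using that by auto
    ultimately have "bog_class X = (2 * m, 0)" by (simp add: bog_class_def)
    then show ?thesis using std_shiftD(5)[OF X(1)] by (metis image_eqI)
  qed
  ultimately have "(\<lambda>V. cls (bog_class V)) ` bog_HS J P =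
      {cls (0, 1), cls (0, - 1)} \<union> {cls (2 * m, 0) | m. 1 \<le> m}"
    by (intro antisym image_subsetI) auto
  moreover have "connected_components_of (bog_topology J P) = (\<lambda>V. cls (bog_class V)) ` bog_HS J P"
    unfolding connected_components_of_def topspace_bog by (rule image_cong) (simp_all add: comp)
  moreover have "{cls (2 * m, 0) | m. 1 \<le> m} = {bog_HS_ind J P m | m. 1 \<le> m}"
    using ind by auto
  ultimately show ?thesis unfolding plus minus by simp
qed

end


theorem corollary2p15:
  fixes J :: "'a::chilbert_space \<Rightarrow> 'a" and P1 :: "'a \<Rightarrow>\<^sub>L 'a"
  assumes "ecdim (UNIV :: 'a set) = \<infinity>"
    and "separable_space (euclidean :: 'a topology)"
    and "conjugation J"
    and "basis_projection J P1"
  shows "connected_components_of (bog_topology J P1) =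
    {bog_HS_plus J P1, bog_HS_minus J P1} \<union> {bog_HS_ind J P1 m | m. 1 \<le> m}"
proof -
  interpret separable_setting J P1
    by unfold_locales (fact assms)+
  show ?thesis by (rule connected_components_bog)
qed

end
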